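(* Let $(V,f)$ be a non-degenerate cubic space, and let $(W,g)$ be a cubic space of countable or finite dimension. Then $W$ embeds into $V$ if and only if $\mathrm{rrk}(W)\le \mathrm{rrk}(V)$ (as elements of $\mathbf{N}\cup\{\infty\}$).
   Context: Throughout, $k$ is an algebraically closed field of characteristic different from $2$ and $3$. For a $k$-vector space $V$ (of arbitrary dimension) with basis $\{v_i\}_{i\in I}$, let $x_i\in V^*$ be the dual coordinate functionals ("coordinates"). $P_n(V)$ denotes the space of degree-$n$ polynomial functions on $V$: every element of $P_n(V)$ is a unique formal, possibly infinite, $k$-linear combination of degree-$n$ monomials in the $x_i$, and can be evaluated at any $v\in V$. $P(V)=\bigoplus_{n\ge 0}P_n(V)$ is a graded ring. The strength $\mathrm{str}(f)$ of a homogeneous $f\in P_n(V)$, $n\ge 1$, is the least $s$ such that $f=\sum_{i=1}^s g_ih_i$ with $g_i,h_i$ homogeneous elements of $P(V)$ of positive degree less than $n$, and $\mathrm{str}(f)=\infty$ if no such expression exists. A cubic space is a pair $(V,f)$ with $f\in P_3(V)$; it is non-degenerate if $\mathrm{str}(f)=\infty$. An embedding $(W,g)\to(V,f)$ of cubic spaces is a $k$-linear map $\phi:W\to V$ with $f\circ\phi=g$. Let $P_2^\circ(V)\subset P_2(V)$ be the subspace of quadratic forms of finite strength and $\overline{P}_2(V)=P_2(V)/P_2^\circ(V)$. For $f\in P_3(V)$, the residual rank $\mathrm{rrk}(f)\in\mathbf{N}\cup\{\infty\}$ is the dimension of the subspace of $\overline{P}_2(V)$ spanned by the images of the formal partial derivatives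 $\partial f/\partial x_i$, $i\in I$ (computed termwise on monomials); this is independent of the basis. The residual rank of a cubic space $(V,f)$ is $\mathrm{rrk}(V)=\mathrm{rrk}(f)$. *)

theory Defs
  imports Main "HOL-Library.Multiset" "HOL-Library.Countable_Set"
    "HOL-Library.Extended_Nat" "HOL-Computational_Algebra.Polynomial"
begin

text \<open>A vector space with basis indexed by the set I is modelled as the finitely
supported functions I -> k.  A (formal, possibly infinite) polynomial on it is a
coefficient function on monomials, i.e. on finite multisets of indices.\<close>

definition vecs :: "'i set \<Rightarrow> ('i \<Rightarrow> 'k::field) set" where
  "vecs I = {v. finite {i. v i \<noteq> 0} \<and> {i. v i \<noteq> 0} \<subseteq> I}"

definition hpoly :: "'i set \<Rightarrow> nat \<Rightarrow> ('i multiset \<Rightarrow> 'k::field) set" where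
  "hpoly I n = {c. \<forall>m. c m \<noteq> 0 \<longrightarrow> size m = n \<and> set_mset m \<subseteq> I}"

definition peval :: "('i multiset \<Rightarrow> 'k::field) \<Rightarrow> ('i \<Rightarrow> 'k) \<Rightarrow> 'k" where
  "peval c v = (\<Sum>m \<in> {m. c m \<noteq> 0 \<and> set_mset m \<subseteq> {i. v i \<noteq> 0}}.
                   c m * prod_mset (image_mset v m))"

definition pmul :: "('i multiset \<Rightarrow> 'k::field) \<Rightarrow> ('i multiset \<Rightarrow> 'k) \<Rightarrow> 'i multiset \<Rightarrow> 'k" where
  "pmul g h m = (\<Sum>a \<in> {a. a \<subseteq># m}. g a * h (m - a))"

definition str_decomp :: "'i set \<Rightarrow> nat \<Rightarrow> ('i multiset \<Rightarrow> 'k::field) \<Rightarrow> nat \<Rightarrow> bool" where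
  "str_decomp I n f s \<longleftrightarrow>
     (\<exists>(g :: nat \<Rightarrow> 'i multiset \<Rightarrow> 'k) (h :: nat \<Rightarrow> 'i multiset \<Rightarrow> 'k) d e.
        (\<forall>j<s. 0 < d j \<and> d j < n \<and> 0 < e j \<and> e j < n \<and>
               g j \<in> hpoly I (d j) \<and> h j \<in> hpoly I (e j)) \<and>
        f = (\<lambda>m. \<Sum>j<s. pmul (g j) (h j) m))"

definition strength :: "'i set \<Rightarrow> nat \<Rightarrow> ('i multiset \<Rightarrow> 'k::field) \<Rightarrow> enat" where
  "strength I n f = (if \<exists>s. str_decomp I n f s then enat (LEAST s. str_decomp I n f s) else \<infinity>)"

definition pderiv_at :: "('i multiset \<Rightarrow> 'k::field) \<Rightarrow> 'i \<Rightarrow> 'i multiset \<Rightarrow> 'k" where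
  "pderiv_at f i = (\<lambda>m. of_nat (count m i + 1) * f (m + {#i#}))"

text \<open>Residual rank of a cubic f on the space with basis I: the dimension of the span
of the images of the partial derivatives in P_2 / P_2^o, i.e. the supremum of the sizes
of families of partial derivatives that are linearly independent modulo quadratic forms
of finite strength.\<close>
definition indep_mod_fin_str :: "'i set \<Rightarrow> ('i multiset \<Rightarrow> 'k::field) \<Rightarrow> nat \<Rightarrow> (nat \<Rightarrow> 'i) \<Rightarrow> bool" where
  "indep_mod_fin_str I f r idx \<longleftrightarrow>
     (\<forall>c :: nat \<Rightarrow> 'k.
        strength I 2 (\<lambda>m. \<Sum>j<r. c j * pderiv_at f (idx j) m) \<noteq> \<infinity> \<longrightarrow> (\<forall>j<r. c j = 0))"

definition rrk :: "'i set \<Rightarrow> ('i multiset \<Rightarrow> 'k::field) \<Rightarrow> enat" where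
  "rrk I f = Sup {enat r | r. \<exists>idx. (\<forall>j<r. idx j \<in> I) \<and> indep_mod_fin_str I f r idx}"

definition nondegenerate :: "'i set \<Rightarrow> ('i multiset \<Rightarrow> 'k::field) \<Rightarrow> bool" where
  "nondegenerate I f \<longleftrightarrow> strength I 3 f = \<infinity>"

definition cubic_embeds :: "'j set \<Rightarrow> ('j multiset \<Rightarrow> 'k::field) \<Rightarrow> 'i set \<Rightarrow> ('i multiset \<Rightarrow> 'k) \<Rightarrow> bool" where
  "cubic_embeds J g I f \<longleftrightarrow>
     (\<exists>\<phi> :: ('j \<Rightarrow> 'k) \<Rightarrow> ('i \<Rightarrow> 'k).
        (\<forall>w \<in> vecs J. \<phi> w \<in> vecs I) \<and>
        (\<forall>a b v w. v \<in> vecs J \<longrightarrow> w \<in> vecs J \<longrightarrow>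
            \<phi> (\<lambda>x. a * v x + b * w x) = (\<lambda>y. a * \<phi> v y + b * \<phi> w y)) \<and>
        (\<forall>w \<in> vecs J. peval f (\<phi> w) = peval g w))"

definition alg_closed :: "'k::field itself \<Rightarrow> bool" where
  "alg_closed _ \<longleftrightarrow> (\<forall>p :: 'k poly. 0 < degree p \<longrightarrow> (\<exists>x. poly p x = 0))"

end

theory Submission
  imports Defs "HOL-Library.Poly_Mapping" "HOL-Library.Nat_Bijection"
    "HOL-Combinatorics.Multiset_Permutations"
begin

text \<open>
  Polarising, a cubic space is a symmetric trilinear form \<open>F\<close> on a vector space \<open>V\<close>. A form of degree
  2 or 3 has finite strength iff it vanishes on a subspace of finite codimension, so the residual rank
  is the codimension of the subspace \<open>V\<^sub>0\<close> of those \<open>v\<close> for which the quadratic form \<open>F v x x\<close> vanishes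
  on such a subspace. If \<open>\<phi>\<close> is an embedding of \<open>W\<close> then \<open>\<phi>\<close> pulls \<open>V\<^sub>0\<close> back into \<open>W\<^sub>0\<close>, which gives
  one direction.

  For the converse, a greedy choice of vectors in ever smaller subspaces of finite codimension shows
  that, on any such subspace, quadratic forms \<open>F e\<^sub>i x x\<close> independent modulo finite strength together with
  the cubic form itself take arbitrary prescribed values. This produces in \<open>V\<close> a sequence \<open>t\<^sub>n\<close> on which
  the cubic is \<open>\<Sum> \<kappa>\<^sub>n a\<^bsub>\<iota>(n)\<^esub> a\<^sub>n\<^sup>2\<close> with prescribed \<open>\<kappa>\<close> and \<open>\<iota>\<close>; when the residual rank is finite, only
  that many vectors may be named by \<open>\<iota>(n) < n\<close>. On the other side, splitting a cubic form in countably many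
  variables according to the smallest variable of each monomial writes it as such a sum, evaluated at a
  locally finite family of linear functionals: a layer \<open>x\<^sub>i q\<^sub>i\<close> is \<open>x\<^sub>i\<close> times a sum of squares in
  general, and a finite sum of cubes when \<open>q\<^sub>i\<close> has finite rank. These functionals are the coordinates
  of the embedding.
\<close>

section \<open>Finite codimension and symmetric trilinear forms\<close>

text \<open>Prescribing values rests on roots: forms that are orthogonal along a family are linear
  in the squares of the coefficients, so a common zero is linear algebra followed by root
  extraction. The two cases differ in which earlier vectors can be named. If the residual rank is
  infinite, each new vector can be kept independent of the earlier ones modulo V_0, and then the
  values F t_i t_n t_n stay free for all i < n; the price is that quadratic and cubic values must be
  realised outside a given span. If it is finite, a whole subspace of finite codimension lies in
  V_0. The late vectors are taken there, each of their forms vanishes on some subspace of finite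
  codimension, and the only late vector that t_n can name is itself. This is why layers of finite
  rank must be rewritten as sums of cubes. The first few vectors, being any independent family,
  carry an uncontrolled cubic form of their own; it is subtracted from the form of W before that is
  decomposed. The divisions by 2, 4 and 24 come from polarisation, the division by 3 in the
  prescribed values from the mixed term in the cube of a sum.\<close>

lemma alg_closed_root:
  assumes "alg_closed TYPE('k::field)" "0 < n"
  shows "\<exists>x::'k. x ^ n = c"
proof -
  let ?p = "monom 1 n - [:c:] :: 'k poly"
  have "degree ?p = n"
    using assms(2) by (subst diff_conv_add_uminus, subst degree_add_eq_left) (auto simp: degree_monom_eq)
  then obtain x where "poly ?p x = 0"
    using assms unfolding alg_closed_def by metis
  then show ?thesis by (auto simp: poly_monom)
qed

text \<open>Elimination of one unknown \<open>j0\<close> at a time. In the applications to common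
  zeros the unknowns are squares of coefficients, and square roots turn a solution into a
  vector.\<close>

lemma homogeneous_system_solution:
  fixes p :: "'e \<Rightarrow> 'j \<Rightarrow> 'k::field"
  assumes "finite E" "finite J" "card E < card J"
  shows "\<exists>s. (\<exists>j\<in>J. s j \<noteq> 0) \<and> (\<forall>e\<in>E. (\<Sum>j\<in>J. s j * p e j) = 0)"
  using assms
proof (induction E arbitrary: J p rule: finite_induct)
  case empty
  then have "J \<noteq> {}" by auto
  then show ?case by (intro exI[of _ "\<lambda>_. 1"]) auto
next
  case (insert e E)
  show ?case
  proof (cases "\<forall>j\<in>J. p e j = 0")
    case True
    then show ?thesis using insert.IH[of J p] insert.prems insert.hyps by (auto simp: card_insert_if)
  next
    case False
    then obtain j0 where j0: "j0 \<in> J" "p e j0 \<noteq> 0" by auto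
    let ?J = "J - {j0}"
    let ?p = "\<lambda>e' j. p e' j - p e' j0 / p e j0 * p e j"
    have "card E < card ?J"
      using insert.prems insert.hyps j0 by (auto simp: card_insert_if)
    then obtain s where s: "\<exists>j\<in>?J. s j \<noteq> 0" "\<forall>e'\<in>E. (\<Sum>j\<in>?J. s j * ?p e' j) = 0"
      using insert.IH[of ?J ?p] insert.prems by auto
    define a where "a = (\<Sum>j\<in>?J. s j * p e j)"
    \<comment> \<open>The value at \<open>j0\<close> solves the equation of \<open>e\<close>; the
      matrix \<open>?p\<close> is what the other equations become after this substitution.\<close>
    define s' where "s' = s(j0 := - a / p e j0)"
    have split: "(\<Sum>j\<in>J. s' j * p e' j) = (\<Sum>j\<in>?J. s j * p e' j) - a / p e j0 * p e' j0" for e'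
    proof -
      have "(\<Sum>j\<in>J. s' j * p e' j) = s' j0 * p e' j0 + (\<Sum>j\<in>?J. s' j * p e' j)"
        using insert.prems j0 by (simp add: sum.remove)
      also have "(\<Sum>j\<in>?J. s' j * p e' j) = (\<Sum>j\<in>?J. s j * p e' j)"
        by (rule sum.cong) (auto simp: s'_def)
      finally show ?thesis by (simp add: s'_def)
    qed
    have "(\<Sum>j\<in>J. s' j * p e j) = 0"
      using j0 by (simp add: split a_def)
    moreover have "(\<Sum>j\<in>J. s' j * p e' j) = 0" if "e' \<in> E" for e'
    proof -
      have "0 = (\<Sum>j\<in>?J. s j * ?p e' j)" using s that by simp
      also have "\<dots> = (\<Sum>j\<in>?J. s j * p e' j) - (\<Sum>j\<in>?J. p e' j0 / p e j0 * (s j * p e j))"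
        by (simp add: sum_subtractf[symmetric] algebra_simps)
      also have "\<dots> = (\<Sum>j\<in>J. s' j * p e' j)"
        by (simp add: split a_def sum_distrib_left[symmetric] sum_divide_distrib[symmetric])
      finally show ?thesis by simp
    qed
    moreover have "\<exists>j\<in>J. s' j \<noteq> 0" using s(1) by (auto simp: s'_def)
    ultimately show ?thesis by (intro exI[of _ s']) auto
  qed
qed

text \<open>Greedy choice with full memory: the n-th value relates to all earlier ones, not just to
  the last. The second premise lets a step use that the earlier choices were correct, which later
  supplies independence or smallness of the earlier vectors.\<close>

lemma dependent_nat_sequence:
  assumes "\<And>f g n x. (\<forall>m<n. f m = g m) \<Longrightarrow> P f n x = P g n x"
    and "\<And>f n. (\<forall>m<n. P f m (f m)) \<Longrightarrow> \<exists>x. P f n x"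
  shows "\<exists>f. \<forall>n::nat. P f n (f n)"
  by (rule dependent_wf_choice[of less_than]) (use assms in auto)

section \<open>Subspaces of finite codimension as common kernels of functionals\<close>

locale functionals = vector_space scale
  for scale :: "'a::field \<Rightarrow> 'b::ab_group_add \<Rightarrow> 'b"
begin

definition functional :: "('b \<Rightarrow> 'a) \<Rightarrow> bool" where
  "functional l \<longleftrightarrow> (\<forall>x y. l (x + y) = l x + l y) \<and> (\<forall>c x. l (scale c x) = c * l x)"

definition fin_functionals :: "('b \<Rightarrow> 'a) set \<Rightarrow> bool" where
  "fin_functionals L \<longleftrightarrow> finite L \<and> (\<forall>l\<in>L. functional l)"

text \<open>A finite set of functionals stands for its kernel, so that intersecting subspaces is
  taking unions, pulling back along a linear map is composing, and no codimension has to be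
  computed.\<close>

definition kernel :: "('b \<Rightarrow> 'a) set \<Rightarrow> 'b set" where
  "kernel L = {v. \<forall>l\<in>L. l v = 0}"

lemma functionalI:
  "(\<And>x y. l (x + y) = l x + l y) \<Longrightarrow> (\<And>c x. l (scale c x) = c * l x) \<Longrightarrow> functional l"
  by (simp add: functional_def)

lemma functional_add: "functional l \<Longrightarrow> l (x + y) = l x + l y"
  and functional_scale: "functional l \<Longrightarrow> l (scale c x) = c * l x"
  by (simp_all add: functional_def)

lemma functional_zero: "functional l \<Longrightarrow> l 0 = 0"
  using functional_scale[of l 0 0] by simp

lemma functional_diff: "functional l \<Longrightarrow> l (x - y) = l x - l y"
  using functional_add[of l "x - y" y] by simp

lemma functional_sum: "functional l \<Longrightarrow> l (\<Sum>i\<in>S. scale (a i) (t i)) = (\<Sum>i\<in>S. a i * l (t i))"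
  by (induction S rule: infinite_finite_induct)
     (simp_all add: functional_zero functional_add functional_scale)

lemmas functional_simps = functional_add functional_scale functional_zero functional_diff functional_sum

lemma fin_functionals_empty [simp]: "fin_functionals {}"
  and fin_functionals_Un [simp]: "fin_functionals (L \<union> M) \<longleftrightarrow> fin_functionals L \<and> fin_functionals M"
  and fin_functionals_insert [simp]: "fin_functionals (insert l L) \<longleftrightarrow> functional l \<and> fin_functionals L"
  by (auto simp: fin_functionals_def)

lemma fin_functionals_UN:
  "finite S \<Longrightarrow> (\<And>i. i \<in> S \<Longrightarrow> fin_functionals (L i)) \<Longrightarrow> fin_functionals (\<Union>i\<in>S. L i)"
  by (auto simp: fin_functionals_def)

lemma fin_functionals_image:
  "finite S \<Longrightarrow> (\<And>i. i \<in> S \<Longrightarrow> functional (l i)) \<Longrightarrow> fin_functionals (l ` S)"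
  by (auto simp: fin_functionals_def)

lemma kernel_Un [simp]: "v \<in> kernel (L \<union> M) \<longleftrightarrow> v \<in> kernel L \<and> v \<in> kernel M"
  and kernel_insert [simp]: "v \<in> kernel (insert l L) \<longleftrightarrow> l v = 0 \<and> v \<in> kernel L"
  and kernel_image: "v \<in> kernel (f ` S) \<longleftrightarrow> (\<forall>i\<in>S. f i v = 0)"
  and kernel_UN: "v \<in> kernel (\<Union>i\<in>S. N i) \<longleftrightarrow> (\<forall>i\<in>S. v \<in> kernel (N i))"
  and kernel_empty [simp]: "v \<in> kernel {}"
  by (auto simp: kernel_def)

lemma kernel_add: "fin_functionals L \<Longrightarrow> x \<in> kernel L \<Longrightarrow> y \<in> kernel L \<Longrightarrow> x + y \<in> kernel L"
  and kernel_scale: "fin_functionals L \<Longrightarrow> x \<in> kernel L \<Longrightarrow> scale c x \<in> kernel L"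
  and kernel_sum: "fin_functionals L \<Longrightarrow> (\<And>i. i \<in> S \<Longrightarrow> t i \<in> kernel L) \<Longrightarrow>
    (\<Sum>i\<in>S. scale (a i) (t i)) \<in> kernel L"
  by (auto simp: kernel_def fin_functionals_def functional_simps intro!: sum.neutral)

text \<open>If a new \<open>l\<close> does not already vanish on the old kernel, subtracting
  \<open>l (?P v)\<close> times a normalised vector of that kernel repairs the old projection
  \<open>?P\<close>, and the new coefficient is again a functional of \<open>v\<close>.\<close>

lemma kernel_projection:
  assumes "fin_functionals L"
  shows "\<exists>(n::nat) m t. (\<forall>i<n. functional (m i)) \<and>
    (\<forall>v. v - (\<Sum>i<n. scale (m i v) (t i)) \<in> kernel L)"
proof -
  have "finite L" using assms by (simp add: fin_functionals_def)
  then show ?thesis using assms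
  proof (induction L rule: finite_induct)
    case empty
    then show ?case by (intro exI[of _ 0]) simp
  next
    case (insert l L)
    then obtain n :: nat and m t where IH: "\<forall>i<n. functional (m i)"
      "\<forall>v. v - (\<Sum>i<n. scale (m i v) (t i)) \<in> kernel L" by auto
    have l: "functional l" and L: "fin_functionals L" using insert by auto
    let ?P = "\<lambda>v. v - (\<Sum>i<n. scale (m i v) (t i))"
    show ?case
    proof (cases "\<forall>v\<in>kernel L. l v = 0")
      case True
      then show ?thesis using IH by (intro exI[of _ n] exI[of _ m] exI[of _ t]) auto
    next
      case False
      then obtain u where u: "u \<in> kernel L" "l u \<noteq> 0" by auto
      let ?u = "scale (1 / l u) u"
      have lu: "l ?u = 1" using u l by (simp add: functional_simps)
      have uL: "?u \<in> kernel L" using u L by (simp add: kernel_scale)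
      have fP: "functional (\<lambda>v. l (?P v))"
        using IH(1) l by (intro functionalI)
          (simp_all add: functional_simps functional_sum[OF l] sum_distrib_left algebra_simps sum.distrib)
      have in_ker: "?P v - scale (l (?P v)) ?u \<in> kernel (insert l L)" for v
      proof -
        have "?P v + scale (- l (?P v)) ?u \<in> kernel L"
          using kernel_add[OF L _ kernel_scale[OF L uL]] IH(2) by blast
        moreover have "l (?P v - scale (l (?P v)) ?u) = 0"
          using l lu by (simp only: functional_diff functional_scale) simp
        ultimately show ?thesis by (simp add: scale_minus_left)
      qed
      show ?thesis
        by (rule exI[of _ "Suc n"], rule exI[of _ "m(n := \<lambda>v. l (?P v))"], rule exI[of _ "t(n := ?u)"])
           (use IH(1) fP in_ker in \<open>auto simp: less_Suc_eq diff_diff_eq\<close>)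
    qed
  qed
qed

end

section \<open>Symmetric trilinear forms and the prescription of their values\<close>

locale cubic_form = functionals scale
  for scale :: "'k::field \<Rightarrow> 'v::ab_group_add \<Rightarrow> 'v" +
  fixes F :: "'v \<Rightarrow> 'v \<Rightarrow> 'v \<Rightarrow> 'k"
  assumes F_add1: "F (x + x') y z = F x y z + F x' y z"
    and F_scale1: "F (scale c x) y z = c * F x y z"
    and F_swap12: "F x y z = F y x z"
    and F_swap23: "F x y z = F x z y"
    and alg_closed: "alg_closed TYPE('k)"
    and two_nonzero: "(2::'k) \<noteq> 0"
    and three_nonzero: "(3::'k) \<noteq> 0"
begin

lemma F_rotate: "F x y z = F z x y"
  using F_swap23[of x y z] F_swap12[of x z y] by simp

lemma functional_F1: "functional (\<lambda>x. F x y z)"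
  by (intro functionalI) (simp_all add: F_add1 F_scale1)

lemma functional_F2: "functional (\<lambda>y. F x y z)"
  using functional_F1[of x z] F_swap12 by simp

lemma functional_F3: "functional (\<lambda>z. F x y z)"
  using functional_F2[of x y] F_swap23 by simp

lemmas F_simps =
  functional_add[OF functional_F1] functional_add[OF functional_F2] functional_add[OF functional_F3]
  functional_scale[OF functional_F1] functional_scale[OF functional_F2] functional_scale[OF functional_F3]
  functional_diff[OF functional_F1] functional_diff[OF functional_F2] functional_diff[OF functional_F3]
  functional_zero[OF functional_F1] functional_zero[OF functional_F2] functional_zero[OF functional_F3]

lemmas F_sum1 = functional_sum[OF functional_F1]
  and F_sum2 = functional_sum[OF functional_F2]
  and F_sum3 = functional_sum[OF functional_F3]

lemma fin_functionals_F: "finite S \<Longrightarrow> fin_functionals ((\<lambda>i. F (u i) (w i)) ` S)"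
  by (intro fin_functionals_image functional_F3)

lemma fin_functionals_F_pairs:
  "finite S \<Longrightarrow> finite T \<Longrightarrow> fin_functionals ((\<lambda>(i,j). F (u i) (w j)) ` (S \<times> T))"
  by (auto simp: fin_functionals_def functional_F3)

lemma F_quad_add: "F e (x + y) (x + y) = F e x x + 2 * F e x y + F e y y"
  using F_swap23[of e y x] by (simp add: F_simps)

lemma F_cube_add: "F (x + y) (x + y) (x + y) = F x x x + 3 * F x x y + 3 * F x y y + F y y y"
proof -
  have "F x y x = F x x y" "F y x x = F x x y" "F y x y = F x y y" "F y y x = F x y y"
    using F_swap23[of x y x] F_swap12[of y x x] F_swap12[of y x y] F_swap23[of y y x] by simp_all
  then show ?thesis by (simp add: F_simps)
qed

lemma square_root: "\<exists>a::'k. a ^ 2 = s"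
  using alg_closed_root[OF alg_closed] by auto

lemma cube_root: "\<exists>a::'k. a ^ 3 = s"
  using alg_closed_root[OF alg_closed] by auto

lemma F_diagonal:
  assumes "finite S" "\<And>i j. i \<in> S \<Longrightarrow> j \<in> S \<Longrightarrow> i \<noteq> j \<Longrightarrow> F e (t i) (t j) = 0"
  shows "F e (\<Sum>j\<in>S. scale (a j) (t j)) (\<Sum>j\<in>S. scale (a j) (t j)) = (\<Sum>j\<in>S. a j ^ 2 * F e (t j) (t j))"
proof -
  have "(\<Sum>j\<in>S. a j * F e (t i) (t j)) = a i * F e (t i) (t i)" if "i \<in> S" for i
    using assms that by (subst sum.remove[of _ i]) (auto intro!: sum.neutral dest: assms(2)[OF that])
  then show ?thesis
    by (simp add: F_sum2, subst F_sum3) (simp add: power2_eq_square mult.assoc)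
qed

definition small :: "'v \<Rightarrow> bool" where
  "small y \<longleftrightarrow> (\<exists>L. fin_functionals L \<and> (\<forall>v\<in>kernel L. F y v v = 0))"

text \<open>Linear independence in the quotient by small vectors, stated without a quotient type. A
  family is a sequence with a length, so that a function update extends it.\<close>

definition indep_mod_small :: "(nat \<Rightarrow> 'v) \<Rightarrow> nat \<Rightarrow> bool" where
  "indep_mod_small e n \<longleftrightarrow> (\<forall>c. small (\<Sum>i<n. scale (c i) (e i)) \<longrightarrow> (\<forall>i<n. c i = 0))"

definition nondeg :: bool where
  "nondeg \<longleftrightarrow> (\<forall>L. fin_functionals L \<longrightarrow> (\<exists>v\<in>kernel L. F v v v \<noteq> 0))"

lemma small_zero: "small 0"
  unfolding small_def by (intro exI[of _ "{}"]) (simp add: F_simps)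

lemma small_add:
  assumes "small x" "small y"
  shows "small (x + y)"
proof -
  obtain L M where "fin_functionals L" "\<forall>v\<in>kernel L. F x v v = 0"
    "fin_functionals M" "\<forall>v\<in>kernel M. F y v v = 0"
    using assms unfolding small_def by blast
  then show ?thesis unfolding small_def
    by (intro exI[of _ "L \<union> M"]) (simp add: F_simps)
qed

lemma small_scale: "small x \<Longrightarrow> small (scale c x)"
  unfolding small_def by (auto simp: F_simps)

lemma small_diff: "small x \<Longrightarrow> small y \<Longrightarrow> small (x - y)"
  using small_add[of x "scale (-1) y"] small_scale[of y "-1"] by simp

lemma small_sum: "(\<And>i. i \<in> S \<Longrightarrow> small (t i)) \<Longrightarrow> small (\<Sum>i\<in>S. scale (c i) (t i))"
  by (induction S rule: infinite_finite_induct) (auto intro: small_zero small_add small_scale)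

text \<open>The vectors \<open>t j\<close> are chosen so that on their span each \<open>F (e i)\<close> is diagonal and the cubic form
  has no term linear in the last coordinate. A combination on which all \<open>F (e i)\<close> vanish keeps this
  property when the sign of its last nonzero coefficient is flipped, and the cubic form differs at
  the two resulting vectors.\<close>

lemma common_zero_cubic_nonzero:
  fixes e :: "nat \<Rightarrow> 'v"
  assumes "nondeg" "fin_functionals L"
  shows "\<exists>x\<in>kernel L. (\<forall>i<n. F (e i) x x = 0) \<and> F x x x \<noteq> 0"
proof -
  define P where "P = (\<lambda>(t::nat \<Rightarrow> 'v) k x. x \<in> kernel L \<and> F x x x \<noteq> 0 \<and>
    (\<forall>i<k. \<forall>j<k. F (t i) (t j) x = 0) \<and> (\<forall>i<n. \<forall>j<k. F (e i) (t j) x = 0))"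
  have "\<exists>t. \<forall>k. P t k (t k)"
  proof (rule dependent_nat_sequence)
    show "P t k x = P t' k x" if "\<forall>m<k. t m = t' m" for t t' :: "nat \<Rightarrow> 'v" and k x
      using that by (simp add: P_def)
    show "\<exists>x. P t k x" for t k
    proof -
      let ?M = "L \<union> (\<lambda>(i,j). F (t i) (t j)) ` ({..<k} \<times> {..<k}) \<union> (\<lambda>(i,j). F (e i) (t j)) ` ({..<n} \<times> {..<k})"
      have "fin_functionals ?M" using assms(2)
        by (simp add: fin_functionals_F fin_functionals_F_pairs)
      then obtain x where "x \<in> kernel ?M" "F x x x \<noteq> 0"
        using assms(1) unfolding nondeg_def by blast
      then show ?thesis by (intro exI[of _ x]) (auto simp: P_def kernel_image)
    qed
  qed
  then obtain t where t: "\<And>k. P t k (t k)" by auto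
  have tL: "t k \<in> kernel L" and tc: "F (t k) (t k) (t k) \<noteq> 0" for k
    using t[of k] by (auto simp: P_def)
  have tt: "i < k \<Longrightarrow> j < k \<Longrightarrow> F (t i) (t j) (t k) = 0" for i j k
    using t[of k] by (auto simp: P_def)
  have te: "i < n \<Longrightarrow> j \<noteq> k \<Longrightarrow> F (e i) (t j) (t k) = 0" for i j k
    using t[of k] t[of j] F_swap23[of "e i" "t j" "t k"] unfolding P_def by (metis nat_neq_iff)
  \<comment> \<open>These are \<open>n\<close> equations in the squares of \<open>n + 1\<close>
    coefficients.\<close>
  obtain s where s: "\<exists>j\<in>{..n}. s j \<noteq> 0" "\<forall>i\<in>{..<n}. (\<Sum>j\<in>{..n}. s j * F (e i) (t j) (t j)) = 0"
    using homogeneous_system_solution[of "{..<n}" "{..n}" "\<lambda>i j. F (e i) (t j) (t j)"] by auto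
  obtain a where a: "\<And>j. a j ^ 2 = s j"
    using choice[of "\<lambda>j a. a ^ 2 = s j"] square_root by blast
  define m where "m = Max {j\<in>{..n}. a j \<noteq> 0}"
  have ne: "{j\<in>{..n}. a j \<noteq> 0} \<noteq> {}" using s(1) a by (metis (mono_tags, lifting) empty_iff mem_Collect_eq power_zero_numeral)
  have m: "m \<le> n" "a m \<noteq> 0" using Max_in[OF _ ne] by (auto simp: m_def)
  have m_max: "a j = 0" if "m < j" "j \<le> n" for j
  proof (rule ccontr)
    assume "a j \<noteq> 0"
    then have "j \<le> m" unfolding m_def using that by (intro Max_ge) auto
    then show False using that by simp
  qed
  define x where "x = (\<lambda>b. (\<Sum>j\<in>{..n}. scale ((a(m := b)) j) (t j)))"
  define x0 where "x0 = (\<Sum>j<m. scale (a j) (t j))"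
  have x_eq: "x b = x0 + scale b (t m)" for b
  proof -
    have "x b = (\<Sum>j\<in>{..m}. scale ((a(m := b)) j) (t j))"
      unfolding x_def using m m_max by (intro sum.mono_neutral_right) auto
    also have "\<dots> = x0 + scale b (t m)"
      unfolding x0_def by (subst lessThan_Suc_atMost[symmetric], subst sum.lessThan_Suc)
        (auto intro!: sum.cong)
    finally show ?thesis .
  qed
  have xq: "F (e i) (x b) (x b) = 0" if "b ^ 2 = a m ^ 2" "i < n" for b i
  proof -
    have "F (e i) (x b) (x b) = (\<Sum>j\<in>{..n}. (a(m := b)) j ^ 2 * F (e i) (t j) (t j))"
      unfolding x_def using te that(2) by (intro F_diagonal) auto
    also have "\<dots> = (\<Sum>j\<in>{..n}. s j * F (e i) (t j) (t j))"
      using that(1) a by (intro sum.cong) auto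
    finally show ?thesis using s(2) that(2) by simp
  qed
  \<comment> \<open>\<open>t m\<close> was chosen in the kernel of all \<open>F (t i) (t j)\<close>
    with \<open>i, j < m\<close>; this removes the term of \<open>cube\<close> that is linear in
    \<open>b\<close>.\<close>
  have x00: "F x0 x0 (t m) = 0"
    unfolding x0_def by (simp add: F_sum1 F_sum2 tt)
  have cube: "F (x b) (x b) (x b) = F x0 x0 x0 + 3 * b^2 * F x0 (t m) (t m) + b^3 * F (t m) (t m) (t m)" for b
    unfolding x_eq by (subst F_cube_add) (simp add: F_simps x00 power2_eq_square power3_eq_cube algebra_simps)
  have "F (x (a m)) (x (a m)) (x (a m)) - F (x (- a m)) (x (- a m)) (x (- a m))
      = 2 * a m ^ 3 * F (t m) (t m) (t m)"
    unfolding cube by (simp add: algebra_simps)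
  then have "F (x (a m)) (x (a m)) (x (a m)) \<noteq> F (x (- a m)) (x (- a m)) (x (- a m))"
    using two_nonzero m tc by auto
  then obtain b where b: "b = a m \<or> b = - a m" "F (x b) (x b) (x b) \<noteq> 0" by metis
  moreover have "x b \<in> kernel L" unfolding x_def by (intro kernel_sum assms tL)
  ultimately show ?thesis using xq[of b] by (intro bexI[of _ "x b"]) auto
qed

lemma indep_mod_small_mono:
  assumes "indep_mod_small e n" "m \<le> n"
  shows "indep_mod_small e m"
  unfolding indep_mod_small_def
proof (intro allI impI)
  fix c i assume c: "small (\<Sum>i<m. scale (c i) (e i))" "i < m"
  define c' where "c' = (\<lambda>i. if i < m then c i else 0)"
  have "(\<Sum>i<n. scale (c' i) (e i)) = (\<Sum>i<m. scale (c i) (e i))"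
    using assms(2) by (intro sum.mono_neutral_cong_right) (auto simp: c'_def)
  then have "\<forall>i<n. c' i = 0"
    using assms(1) c(1) unfolding indep_mod_small_def by metis
  then have "c' i = 0" using c(2) assms(2) by simp
  then show "c i = 0" using c(2) by (simp add: c'_def)
qed

text \<open>Induction on \<open>n\<close>. It suffices to find \<open>w\<close> on which the forms
  of \<open>e 0\<close>, ..., \<open>e (n - 1)\<close> vanish but that of \<open>e n\<close> does
  not: a solution \<open>x\<close> for the first \<open>n\<close> values, taken orthogonal to
  \<open>w\<close>, is completed by a multiple of \<open>w\<close>. Independence of
  \<open>e n\<close> from the others modulo small vectors makes \<open>w\<close> exist.\<close>

lemma quadratic_values:
  assumes "indep_mod_small e n" "fin_functionals L"
  shows "\<exists>z\<in>kernel L. \<forall>i<n. F (e i) z z = p i"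
  using assms
proof (induction n arbitrary: L p)
  case 0
  have "0 \<in> kernel L" using kernel_sum[OF 0(2), of "{}"] by simp
  then show ?case by auto
next
  case (Suc n)
  have IH: "\<exists>z\<in>kernel M. \<forall>i<n. F (e i) z z = p i" if "fin_functionals M" for M p
    using Suc.IH[OF indep_mod_small_mono[OF Suc.prems(1)] that] by simp
  \<comment> \<open>For \<open>k < n\<close> the \<open>z k\<close> are dual to the first
    \<open>n\<close> forms; all of them are mutually orthogonal for every \<open>e i\<close> with
    \<open>i \<le> n\<close>.\<close>
  define P where "P = (\<lambda>(z::nat \<Rightarrow> 'v) k x. x \<in> kernel L \<and>
    (\<forall>i\<le>n. \<forall>j<k. F (e i) (z j) x = 0) \<and> (\<forall>i<n. F (e i) x x = (if i = k then 1 else 0)))"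
  have "\<exists>z. \<forall>k. P z k (z k)"
  proof (rule dependent_nat_sequence)
    show "P t k x = P t' k x" if "\<forall>m<k. t m = t' m" for t t' :: "nat \<Rightarrow> 'v" and k x
      using that by (simp add: P_def)
    show "\<exists>x. P z k x" for z k
    proof -
      let ?M = "L \<union> (\<lambda>(i,j). F (e i) (z j)) ` ({..n} \<times> {..<k})"
      have "fin_functionals ?M" using Suc.prems(2)
        by (simp add: fin_functionals_F fin_functionals_F_pairs)
      from IH[OF this, of "\<lambda>i. if i = k then 1 else 0"] show ?thesis
        by (auto simp: P_def kernel_image)
    qed
  qed
  then obtain z where z: "\<And>k. P z k (z k)" by auto
  have zL: "z k \<in> kernel L" for k using z[of k] by (auto simp: P_def)
  have zd: "i < n \<Longrightarrow> F (e i) (z k) (z k) = (if i = k then 1 else 0)" for i k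
    using z[of k] by (auto simp: P_def)
  have zo: "i \<le> n \<Longrightarrow> j \<noteq> k \<Longrightarrow> F (e i) (z j) (z k) = 0" for i j k
    using z[of k] z[of j] F_swap23[of "e i" "z j" "z k"] unfolding P_def by (metis nat_neq_iff)
  \<comment> \<open>The coefficients are chosen so that \<open>F y\<close> vanishes on each
    \<open>z j\<close> with \<open>j < n\<close>; the coefficient 1 of \<open>e n\<close> keeps
    \<open>y\<close> from being small.\<close>
  define c where "c = (\<lambda>i. if i < n then - F (e n) (z i) (z i) else 1)"
  define y where "y = (\<Sum>i<Suc n. scale (c i) (e i))"
  have y_eq: "F y u w = (\<Sum>i<n. c i * F (e i) u w) + F (e n) u w" for u w
    unfolding y_def F_sum1 by (simp add: c_def)
  have yz: "F y (z j) (z j) = 0" if "j < n" for j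
  proof -
    have "(\<Sum>i<n. c i * F (e i) (z j) (z j)) = c j"
      using that by (subst sum.remove[of _ j]) (auto simp: zd intro!: sum.neutral)
    then show ?thesis using that by (simp add: y_eq c_def)
  qed
  let ?M = "L \<union> (\<lambda>(i,j). F (e i) (z j)) ` ({..n} \<times> {..<n})"
  have M: "fin_functionals ?M" using Suc.prems(2)
    by (simp add: fin_functionals_F fin_functionals_F_pairs)
  have "\<not> small y"
  proof
    assume "small y"
    then have "c n = 0" using Suc.prems(1) unfolding indep_mod_small_def y_def by blast
    then show False by (simp add: c_def)
  qed
  then obtain v where v: "v \<in> kernel ?M" "F y v v \<noteq> 0" using M unfolding small_def by blast
  have vz: "F (e i) (z j) v = 0" if "i \<le> n" "j < n" for i j
    using v that by (auto simp: kernel_image)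
  \<comment> \<open>The combination \<open>u\<close> of the \<open>z j\<close> cancels the first
    \<open>n\<close> values of \<open>v\<close> and leaves the value of \<open>F y\<close>
    unchanged.\<close>
  obtain a where a: "\<And>i. a i ^ 2 = - F (e i) v v"
    using choice[of "\<lambda>i a. a ^ 2 = - F (e i) v v"] square_root by blast
  define u where "u = (\<Sum>j<n. scale (a j) (z j))"
  have uv: "F (e i) u v = 0" if "i \<le> n" for i
    unfolding u_def using that by (simp add: F_sum2 vz)
  have uu: "F (e i) u u = (\<Sum>j<n. a j ^ 2 * F (e i) (z j) (z j))" if "i \<le> n" for i
    unfolding u_def using that by (intro F_diagonal) (auto simp: zo)
  define w where "w = u + v"
  have wi: "F (e i) w w = 0" if "i < n" for i
  proof -
    have "(\<Sum>j<n. a j ^ 2 * F (e i) (z j) (z j)) = a i ^ 2"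
      using that by (subst sum.remove[of _ i]) (auto simp: zd intro!: sum.neutral)
    then show ?thesis using that a by (simp add: w_def F_quad_add uu uv)
  qed
  have wn: "F (e n) w w \<noteq> 0"
  proof -
    have "F y u u = (\<Sum>j<n. a j ^ 2 * F y (z j) (z j))"
      unfolding u_def by (intro F_diagonal) (auto simp: y_eq zo)
    then have "F y u u = 0" by (simp add: yz)
    moreover have "F y u v = 0" by (simp add: y_eq uv)
    ultimately have "F y w w = F y v v" by (simp add: w_def F_quad_add)
    then show ?thesis using v(2) by (simp add: y_eq wi)
  qed
  have wL: "w \<in> kernel L" unfolding w_def u_def using v
    by (intro kernel_add kernel_sum Suc.prems zL) auto
  let ?N = "L \<union> (\<lambda>i. F (e i) w) ` {..n}"
  have "fin_functionals ?N" using Suc.prems(2)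
    by (simp add: fin_functionals_F fin_functionals_F_pairs)
  then obtain x where x: "x \<in> kernel ?N" "\<forall>i<n. F (e i) x x = p i" using IH by blast
  obtain b where b: "b ^ 2 = (p n - F (e n) x x) / F (e n) w w" using square_root by blast
  have val: "F (e i) (scale b w + x) (scale b w + x) = b^2 * F (e i) w w + F (e i) x x" if "i \<le> n" for i
    using that x unfolding F_quad_add by (auto simp: F_simps kernel_image power2_eq_square)
  have "scale b w + x \<in> kernel L" using x wL
    by (intro kernel_add kernel_scale Suc.prems) auto
  moreover have "\<forall>i<Suc n. F (e i) (scale b w + x) (scale b w + x) = p i"
    using x(2) wn by (auto simp: less_Suc_eq_le val wi b le_less)
  ultimately show ?case by blast
qed

text \<open>Once \<open>z\<close> has the right quadratic values, its cube is corrected by a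
  multiple of a vector \<open>x\<close> on which all these forms vanish. Counting \<open>z\<close>
  among the forms given to \<open>common_zero_cubic_nonzero\<close> kills \<open>F z x x\<close>,
  and the kernel kills \<open>F z z x\<close>, so the cubes simply add.\<close>

lemma quadratic_cubic_values:
  assumes "nondeg" "indep_mod_small e n" "fin_functionals L"
  shows "\<exists>z\<in>kernel L. (\<forall>i<n. F (e i) z z = p i) \<and> F z z z = q"
proof -
  obtain z where z: "z \<in> kernel L" "\<forall>i<n. F (e i) z z = p i"
    using quadratic_values assms by blast
  let ?e = "e(n := z)"
  let ?M = "L \<union> insert (F z z) ((\<lambda>i. F (e i) z) ` {..<n})"
  have "fin_functionals ?M" using assms(3)
    by (simp add: fin_functionals_F functional_F3)
  from common_zero_cubic_nonzero[OF assms(1) this, of "Suc n" ?e]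
  obtain x where x: "x \<in> kernel ?M" "\<forall>i<Suc n. F (?e i) x x = 0" "F x x x \<noteq> 0" by auto
  obtain b where b: "b ^ 3 = (q - F z z z) / F x x x" using cube_root by blast
  have "F z x x = 0" using x(2) by auto
  moreover have "F z z x = 0" using x(1) by auto
  ultimately have "F (z + scale b x) (z + scale b x) (z + scale b x) = F z z z + b^3 * F x x x"
    unfolding F_cube_add by (simp add: F_simps power3_eq_cube)
  then have "F (z + scale b x) (z + scale b x) (z + scale b x) = q" using b x(3) by simp
  moreover have "F (e i) (z + scale b x) (z + scale b x) = p i" if "i < n" for i
  proof -
    have "F (?e i) x x = 0" using x(2) that less_SucI by blast
    then have "F (e i) x x = 0" using that by simp
    moreover have "F (e i) z x = 0" using x(1) that by (auto simp: kernel_image)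
    ultimately show ?thesis using z that unfolding F_quad_add by (simp add: F_simps)
  qed
  moreover have "z + scale b x \<in> kernel L"
    using z x by (intro kernel_add kernel_scale assms) auto
  ultimately show ?thesis by blast
qed

end

section \<open>Independence modulo small vectors\<close>

lemma sum_lessThan_add:
  fixes f :: "nat \<Rightarrow> 'a::comm_monoid_add"
  shows "(\<Sum>k<n + r. f k) = (\<Sum>k<n. f k) + (\<Sum>k<r. f (n + k))"
  by (induction r) (simp_all add: add.assoc)

context cubic_form
begin

definition span_mod_small :: "(nat \<Rightarrow> 'v) \<Rightarrow> nat \<Rightarrow> 'v set" where
  "span_mod_small e n = {x. \<exists>c. small (x - (\<Sum>i<n. scale (c i) (e i)))}"

lemma span_mod_small_cong:
  "(\<And>i. i < n \<Longrightarrow> e i = e' i) \<Longrightarrow> span_mod_small e n = span_mod_small e' n"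
  by (simp add: span_mod_small_def)

lemma indep_mod_small_cong:
  "(\<And>i. i < n \<Longrightarrow> e i = e' i) \<Longrightarrow> indep_mod_small e n = indep_mod_small e' n"
  by (simp add: indep_mod_small_def)

lemma span_mod_small_add:
  assumes "x \<in> span_mod_small e n" "y \<in> span_mod_small e n"
  shows "x + y \<in> span_mod_small e n"
proof -
  obtain c d where "small (x - (\<Sum>i<n. scale (c i) (e i)))" "small (y - (\<Sum>i<n. scale (d i) (e i)))"
    using assms by (auto simp: span_mod_small_def)
  from small_add[OF this] have "small ((x + y) - (\<Sum>i<n. scale (c i + d i) (e i)))"
    by (simp add: scale_left_distrib sum.distrib algebra_simps)
  then show ?thesis unfolding span_mod_small_def mem_Collect_eq
    by (rule exI[of _ "\<lambda>i. c i + d i"])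
qed

lemma span_mod_small_scale:
  assumes "x \<in> span_mod_small e n"
  shows "scale a x \<in> span_mod_small e n"
proof -
  obtain c where "small (x - (\<Sum>i<n. scale (c i) (e i)))"
    using assms by (auto simp: span_mod_small_def)
  from small_scale[OF this, of a] have "small (scale a x - (\<Sum>i<n. scale (a * c i) (e i)))"
    by (simp add: scale_right_diff_distrib scale_sum_right)
  then show ?thesis unfolding span_mod_small_def mem_Collect_eq
    by (rule exI[of _ "\<lambda>i. a * c i"])
qed

lemma span_mod_small_diff:
  assumes "x \<in> span_mod_small e n" "y \<in> span_mod_small e n"
  shows "x - y \<in> span_mod_small e n"
  using span_mod_small_add[OF assms(1) span_mod_small_scale[OF assms(2), of "-1"]] by simp

lemma indep_mod_small_0 [simp]: "indep_mod_small e 0"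
  by (simp add: indep_mod_small_def)

lemma indep_mod_small_Suc:
  assumes "indep_mod_small e n" "e n \<notin> span_mod_small e n"
  shows "indep_mod_small e (Suc n)"
  unfolding indep_mod_small_def
proof (intro allI impI)
  fix c i assume c: "small (\<Sum>i<Suc n. scale (c i) (e i))" "i < Suc n"
  have cn: "c n = 0"
  proof (rule ccontr)
    assume "c n \<noteq> 0"
    define d where "d = (\<lambda>i. - c i / c n)"
    have "scale (1 / c n) (\<Sum>i<Suc n. scale (c i) (e i)) = e n - (\<Sum>i<n. scale (d i) (e i))"
      using \<open>c n \<noteq> 0\<close> by (simp add: scale_right_distrib scale_sum_right d_def sum_negf)
    then have "small (e n - (\<Sum>i<n. scale (d i) (e i)))" using small_scale[OF c(1)] by metis
    then show False using assms(2) unfolding span_mod_small_def by blast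
  qed
  then have "\<forall>i<n. c i = 0" using assms(1) c(1) unfolding indep_mod_small_def by simp
  then show "c i = 0" using cn c(2) by (auto simp: less_Suc_eq)
qed

text \<open>Expressed through \<open>u\<close> modulo small vectors, more vectors than coordinates
  leave a nontrivial relation.\<close>

lemma indep_mod_small_le_dim:
  assumes "\<And>v. v \<in> span_mod_small u m" "indep_mod_small y r"
  shows "r \<le> m"
proof (rule ccontr)
  assume "\<not> r \<le> m"
  have "\<forall>j. \<exists>c. small (y j - (\<Sum>i<m. scale (c i) (u i)))"
    using assms(1) by (auto simp: span_mod_small_def)
  then obtain C where C: "\<And>j. small (y j - (\<Sum>i<m. scale (C j i) (u i)))" by metis
  obtain s where s: "\<exists>j\<in>{..<r}. s j \<noteq> 0" "\<forall>i\<in>{..<m}. (\<Sum>j\<in>{..<r}. s j * C j i) = 0"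
    using homogeneous_system_solution[of "{..<m}" "{..<r}" "\<lambda>i j. C j i"] \<open>\<not> r \<le> m\<close> by auto
  have "(\<Sum>j<r. scale (s j) (\<Sum>i<m. scale (C j i) (u i))) = (\<Sum>j<r. \<Sum>i<m. scale (s j * C j i) (u i))"
    by (simp add: scale_sum_right)
  also have "\<dots> = (\<Sum>i<m. \<Sum>j<r. scale (s j * C j i) (u i))"
    by (rule sum.swap)
  also have "\<dots> = 0" using s(2) by (simp add: scale_sum_left[symmetric])
  finally have z: "(\<Sum>j<r. scale (s j) (\<Sum>i<m. scale (C j i) (u i))) = 0" .
  have "small (\<Sum>j<r. scale (s j) (y j - (\<Sum>i<m. scale (C j i) (u i))))"
    using C by (rule small_sum)
  then have "small (\<Sum>j<r. scale (s j) (y j))"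
    by (simp add: scale_right_diff_distrib sum_subtractf z)
  then show False using assms(2) s(1) unfolding indep_mod_small_def by blast
qed

lemma maximal_indep_spans:
  assumes "indep_mod_small e n" "\<nexists>y. indep_mod_small y (Suc n)"
  shows "v \<in> span_mod_small e n"
proof (rule ccontr)
  assume v: "v \<notin> span_mod_small e n"
  have "span_mod_small (e(n := v)) n = span_mod_small e n"
    by (rule span_mod_small_cong) simp
  moreover have "indep_mod_small (e(n := v)) n = indep_mod_small e n"
    by (rule indep_mod_small_cong) simp
  ultimately have "indep_mod_small (e(n := v)) (Suc n)"
    using v assms(1) by (intro indep_mod_small_Suc) auto
  then show False using assms(2) by blast
qed

text \<open>Independence makes the coordinates with respect to \<open>e\<close> modulo small vectors
  unique, hence linear in \<open>v\<close>; their common kernel consists of small vectors.\<close>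

lemma small_finite_codim:
  assumes "indep_mod_small e n" "\<And>v. v \<in> span_mod_small e n"
  shows "\<exists>L. fin_functionals L \<and> (\<forall>v\<in>kernel L. small v)"
proof -
  have "\<forall>v. \<exists>c. small (v - (\<Sum>i<n. scale (c i) (e i)))"
    using assms(2) by (auto simp: span_mod_small_def)
  then obtain C where C: "\<And>v. small (v - (\<Sum>i<n. scale (C v i) (e i)))" by metis
  have unique: "c i = d i" if "i < n" "small (v - (\<Sum>i<n. scale (c i) (e i)))"
    "small (v - (\<Sum>i<n. scale (d i) (e i)))" for c d v i
  proof -
    have "small (\<Sum>i<n. scale (d i - c i) (e i))"
      using small_diff[OF that(2,3)] by (simp add: scale_left_diff_distrib sum_subtractf)
    then have "\<forall>i<n. d i - c i = 0"
      using assms(1)[unfolded indep_mod_small_def, rule_format, of "\<lambda>i. d i - c i"] by blast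
    then have "d i - c i = 0" using that(1) by blast
    then show ?thesis by simp
  qed
  have fC: "functional (\<lambda>v. C v i)" if "i < n" for i
  proof (rule functionalI)
    fix x y
    have "small ((x + y) - (\<Sum>i<n. scale (C x i + C y i) (e i)))"
      using small_add[OF C[of x] C[of y]] by (simp add: scale_left_distrib sum.distrib algebra_simps)
    then show "C (x + y) i = C x i + C y i"
      by (rule unique[OF that C])
  next
    fix a x
    have "small (scale a x - (\<Sum>i<n. scale (a * C x i) (e i)))"
      using small_scale[OF C[of x], of a] by (simp add: scale_right_diff_distrib scale_sum_right)
    then show "C (scale a x) i = a * C x i"
      by (rule unique[OF that C])
  qed
  have "fin_functionals ((\<lambda>i v. C v i) ` {..<n})" by (intro fin_functionals_image fC) auto
  moreover have "small v" if "v \<in> kernel ((\<lambda>i v. C v i) ` {..<n})" for v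
    using C[of v] that by (simp add: kernel_image)
  ultimately show ?thesis by blast
qed

text \<open>Otherwise \<open>e\<close> and the finitely many vectors spanning a complement of the
  kernel would together span everything modulo small vectors, which would bound the length of
  independent families.\<close>

lemma kernel_not_in_span_mod_small:
  assumes "\<And>r. \<exists>y. indep_mod_small y r" "fin_functionals L"
  shows "\<exists>u\<in>kernel L. u \<notin> span_mod_small e n"
proof (rule ccontr)
  assume "\<not> ?thesis"
  then have sub: "u \<in> span_mod_small e n" if "u \<in> kernel L" for u using that by blast
  obtain k :: nat and m t where P: "\<And>v. v - (\<Sum>i<k. scale (m i v) (t i)) \<in> kernel L"
    using kernel_projection[OF assms(2)] by blast
  define w where "w = (\<lambda>i. if i < n then e i else t (i - n))"
  have "v \<in> span_mod_small w (n + k)" for v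
  proof -
    obtain c where c: "small (v - (\<Sum>i<k. scale (m i v) (t i)) - (\<Sum>i<n. scale (c i) (e i)))"
      using sub[OF P] by (auto simp: span_mod_small_def)
    define d where "d = (\<lambda>i. if i < n then c i else m (i - n) v)"
    have "v - (\<Sum>i<k. scale (m i v) (t i)) - (\<Sum>i<n. scale (c i) (e i)) = v - (\<Sum>i<n + k. scale (d i) (w i))"
      unfolding sum_lessThan_add by (simp add: d_def w_def diff_diff_eq add.commute)
    then show ?thesis using c unfolding span_mod_small_def by (metis (mono_tags, lifting) mem_Collect_eq)
  qed
  moreover obtain y where "indep_mod_small y (Suc (n + k))" using assms(1) by blast
  ultimately have "Suc (n + k) \<le> n + k" by (rule indep_mod_small_le_dim)
  then show False by simp
qed

text \<open>Infinite residual rank leaves room in \<open>kernel L\<close> for arbitrarily many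
  vectors that are orthogonal for the \<open>e i\<close> and independent of \<open>t\<close>; some
  combination of \<open>m + 1\<close> of them is isotropic for all \<open>m\<close> forms and stays
  outside the span. A nonzero cube is cancelled by adding a multiple of a suitable \<open>x\<close>.
  This might lead into the span, but not for two different cube roots.\<close>

lemma isotropic_outside_span:
  fixes e t :: "nat \<Rightarrow> 'v"
  assumes "nondeg" "\<And>r. \<exists>y. indep_mod_small y r" "indep_mod_small t n" "fin_functionals L"
  shows "\<exists>u\<in>kernel L. u \<notin> span_mod_small t n \<and> (\<forall>i<m. F (e i) u u = 0) \<and> F u u u = 0"
proof -
  \<comment> \<open>Starting the sequence with \<open>t\<close> makes the later members avoid the
    span of \<open>t\<close> together with that of their predecessors.\<close>
  define P where "P = (\<lambda>(w::nat \<Rightarrow> 'v) k x. if k < n then x = t k else x \<in> kernel L \<and>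
    (\<forall>i<m. \<forall>j<k. F (e i) (w j) x = 0) \<and> x \<notin> span_mod_small w k)"
  have "\<exists>w. \<forall>k. P w k (w k)"
  proof (rule dependent_nat_sequence)
    show "P w k x = P w' k x" if "\<forall>m<k. w m = w' m" for w w' :: "nat \<Rightarrow> 'v" and k x
      using that span_mod_small_cong[of k w w'] by (simp add: P_def)
    show "\<exists>x. P w k x" for w k
    proof -
      let ?M = "L \<union> (\<lambda>(i,j). F (e i) (w j)) ` ({..<m} \<times> {..<k})"
      have "fin_functionals ?M" using assms(4) by (simp add: fin_functionals_F_pairs)
      then obtain x where "x \<in> kernel ?M" "x \<notin> span_mod_small w k"
        using kernel_not_in_span_mod_small[OF assms(2)] by blast
      then show ?thesis by (cases "k < n") (auto simp: P_def kernel_image)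
    qed
  qed
  then obtain w where w: "\<And>k. P w k (w k)" by auto
  have wt: "w k = t k" if "k < n" for k using w[of k] that by (simp add: P_def)
  have w_ge: "w k \<in> kernel L" "\<forall>i<m. \<forall>j<k. F (e i) (w j) (w k) = 0" "w k \<notin> span_mod_small w k"
    if "n \<le> k" for k using w[of k] that by (auto simp: P_def)
  have w_indep: "indep_mod_small w (n + j)" for j
  proof (induction j)
    case 0
    then show ?case using assms(3) indep_mod_small_cong[of n w t] wt by simp
  next
    case (Suc j)
    then show ?case using w_ge(3)[of "n + j"] indep_mod_small_Suc by simp
  qed
  have we: "F (e i) (w j) (w k) = 0" if "i < m" "j \<noteq> k" "n \<le> j" "n \<le> k" for i j k
    using w_ge(2)[of k] w_ge(2)[of j] that F_swap23[of "e i" "w j" "w k"] by (metis nat_neq_iff)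
  obtain s where s: "\<exists>j\<in>{..<Suc m}. s j \<noteq> 0"
      "\<forall>i\<in>{..<m}. (\<Sum>j\<in>{..<Suc m}. s j * F (e i) (w (n + j)) (w (n + j))) = 0"
    using homogeneous_system_solution[of "{..<m}" "{..<Suc m}" "\<lambda>i j. F (e i) (w (n + j)) (w (n + j))"] by auto
  obtain a where a: "\<And>j. a j ^ 2 = s j"
    using choice[of "\<lambda>j a. a ^ 2 = s j"] square_root by blast
  define u where "u = (\<Sum>j<Suc m. scale (a j) (w (n + j)))"
  have uL: "u \<in> kernel L" unfolding u_def by (intro kernel_sum assms w_ge) auto
  have uH: "u \<notin> span_mod_small t n"
  proof
    assume "u \<in> span_mod_small t n"
    then obtain c where c: "small (u - (\<Sum>i<n. scale (c i) (t i)))" by (auto simp: span_mod_small_def)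
    define d where "d = (\<lambda>i. if i < n then - c i else a (i - n))"
    have "u - (\<Sum>i<n. scale (c i) (t i)) = (\<Sum>i<n + Suc m. scale (d i) (w i))"
      unfolding sum_lessThan_add u_def by (simp add: d_def wt sum_negf)
    then have d: "\<forall>i<n + Suc m. d i = 0"
      using c w_indep[of "Suc m"] unfolding indep_mod_small_def by metis
    obtain j where j: "j < Suc m" "s j \<noteq> 0" using s(1) by auto
    then have "d (n + j) = 0" using d by simp
    then have "s j = 0" using a[of j] by (simp add: d_def)
    then show False using j by simp
  qed
  have ue: "F (e i) u u = 0" if "i < m" for i
  proof -
    have "F (e i) u u = (\<Sum>j<Suc m. a j ^ 2 * F (e i) (w (n + j)) (w (n + j)))"
      unfolding u_def using we that by (intro F_diagonal) auto
    then show ?thesis using s(2) that a by simp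
  qed
  show ?thesis
  proof (cases "F u u u = 0")
    case True
    then show ?thesis using uL uH ue by blast
  next
    case False
    let ?M = "L \<union> insert (F u u) ((\<lambda>i. F (e i) u) ` {..<m})"
    have "fin_functionals ?M" using assms(4) by (simp add: fin_functionals_F functional_F3)
    from common_zero_cubic_nonzero[OF assms(1) this, of "Suc m" "e(m := u)"]
    obtain x where x: "x \<in> kernel ?M" "\<forall>i<Suc m. F ((e(m := u)) i) x x = 0" "F x x x \<noteq> 0" by auto
    have xe: "F (e i) x x = 0" if "i < m" for i
    proof -
      have "F ((e(m := u)) i) x x = 0" using x(2) that less_SucI by blast
      then show ?thesis using that by simp
    qed
    have xu: "F u x x = 0" using x(2) by auto
    have good: "u + scale b x \<in> kernel L \<and> (\<forall>i<m. F (e i) (u + scale b x) (u + scale b x) = 0) \<and>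
      F (u + scale b x) (u + scale b x) (u + scale b x) = 0" if "b ^ 3 = - F u u u / F x x x" for b
    proof (intro conjI allI impI)
      show "u + scale b x \<in> kernel L" using uL x(1) by (intro kernel_add kernel_scale assms) auto
      show "F (e i) (u + scale b x) (u + scale b x) = 0" if "i < m" for i
        unfolding F_quad_add using x(1) that by (simp add: F_simps ue xe kernel_image)
      have "F (u + scale b x) (u + scale b x) (u + scale b x) = F u u u + b ^ 3 * F x x x"
        unfolding F_cube_add using x(1) by (simp add: F_simps xu power3_eq_cube)
      then show "F (u + scale b x) (u + scale b x) (u + scale b x) = 0" using that x(3) by simp
    qed
    obtain b where b: "b ^ 3 = - F u u u / F x x x" using cube_root by blast
    \<comment> \<open>A root of \<open>1 + X + X^2\<close>; it differs from 1 because 3 is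
      nonzero.\<close>
    obtain \<omega> :: 'k where \<omega>: "\<omega> \<noteq> 1" "\<omega> ^ 3 = 1"
    proof -
      have "0 < degree [:1, 1, 1::'k:]" by simp
      then obtain \<omega> :: 'k where "poly [:1, 1, 1:] \<omega> = 0"
        using alg_closed unfolding alg_closed_def by blast
      then have r: "1 + \<omega> * (1 + \<omega>) = 0" by simp
      have "\<omega> ^ 3 - 1 = (\<omega> - 1) * (1 + \<omega> * (1 + \<omega>))" by (simp add: power3_eq_cube algebra_simps)
      then have "\<omega> ^ 3 = 1" using r by simp
      moreover have "\<omega> \<noteq> 1"
      proof
        assume "\<omega> = 1"
        with r have "(3::'k) = 0" by simp
        then show False using three_nonzero by simp
      qed
      ultimately show thesis using that by blast
    qed
    have b': "(\<omega> * b) ^ 3 = - F u u u / F x x x" using b \<omega> by (simp add: power_mult_distrib)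
    have "u + scale b x \<notin> span_mod_small t n \<or> u + scale (\<omega> * b) x \<notin> span_mod_small t n"
    proof (rule ccontr)
      assume "\<not> ?thesis"
      then have H: "u + scale b x \<in> span_mod_small t n" "u + scale (\<omega> * b) x \<in> span_mod_small t n" by auto
      \<comment> \<open>In this combination of the two candidates \<open>x\<close> cancels.\<close>
      have "u = scale (1 / (\<omega> - 1)) (scale \<omega> (u + scale b x) - (u + scale (\<omega> * b) x))"
      proof -
        have "scale \<omega> (u + scale b x) - (u + scale (\<omega> * b) x) = scale (\<omega> - 1) u"
          by (simp add: scale_right_distrib scale_left_diff_distrib)
        then show ?thesis using \<omega>(1) by simp
      qed
      then have "u \<in> span_mod_small t n"
        using H span_mod_small_diff span_mod_small_scale by metis
      then show False using uH by simp
    qed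
    then show ?thesis using good[OF b] good[OF b'] by blast
  qed
qed

text \<open>A solution \<open>z\<close> that falls into the span is moved out by a vector
  \<open>u\<close> whose own values and whose mixed terms with \<open>z\<close> vanish; for
  \<open>F z u u\<close> this is achieved by adding \<open>z\<close> to the list of forms.\<close>

lemma values_outside_span:
  assumes "nondeg" "\<And>r. \<exists>y. indep_mod_small y r" "indep_mod_small t n" "fin_functionals L"
  shows "\<exists>x\<in>kernel L. (\<forall>i<n. F (t i) x x = p i) \<and> F x x x = q \<and> x \<notin> span_mod_small t n"
proof -
  obtain z where z: "z \<in> kernel L" "\<forall>i<n. F (t i) z z = p i" "F z z z = q"
    using quadratic_cubic_values assms by blast
  show ?thesis
  proof (cases "z \<in> span_mod_small t n")
    case False
    then show ?thesis using z by blast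
  next
    case True
    let ?M = "L \<union> insert (F z z) ((\<lambda>i. F (t i) z) ` {..<n})"
    have "fin_functionals ?M" using assms(4) by (simp add: fin_functionals_F functional_F3)
    from isotropic_outside_span[OF assms(1-3) this, of "Suc n" "t(n := z)"]
    obtain u where u: "u \<in> kernel ?M" "u \<notin> span_mod_small t n"
      "\<forall>i<Suc n. F ((t(n := z)) i) u u = 0" "F u u u = 0" by auto
    have ut: "F (t i) u u = 0" if "i < n" for i
    proof -
      have "F ((t(n := z)) i) u u = 0" using u(3) that less_SucI by blast
      then show ?thesis using that by simp
    qed
    have uz: "F z u u = 0" using u(3) by auto
    have "z + u \<in> kernel L" using z u by (intro kernel_add assms) auto
    moreover have "F (t i) (z + u) (z + u) = p i" if "i < n" for i
      unfolding F_quad_add using z u(1) that by (simp add: ut kernel_image)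
    moreover have "F (z + u) (z + u) (z + u) = q"
      unfolding F_cube_add using z u by (simp add: uz)
    moreover have "z + u \<notin> span_mod_small t n"
      using span_mod_small_diff[of "z + u" t n z] True u(2) by auto
    ultimately show ?thesis by blast
  qed
qed

text \<open>The vectors chosen after \<open>y\<close> lie in \<open>kernel L\<close>, so they are
  small and every later vector can be taken where their forms vanish. This gives the zeros for
  \<open>s \<le> i < n\<close>; the forms of \<open>y\<close> are independent, and their values can
  be prescribed together with the cube.\<close>

lemma normal_sequence_finite:
  assumes "nondeg" "fin_functionals L" "\<And>v. v \<in> kernel L \<Longrightarrow> small v" "indep_mod_small y s"
    and "\<And>n. s \<le> n \<Longrightarrow> \<iota> n < s \<or> \<iota> n = n"
  shows "\<exists>t. (\<forall>i<s. t i = y i) \<and> (\<forall>n\<ge>s. (\<forall>i<n. \<forall>j<n. F (t i) (t j) (t n) = 0) \<and>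
    (\<forall>i\<le>n. F (t i) (t n) (t n) = (if i = \<iota> n then \<kappa> n else 0)))"
proof -
  define P where "P = (\<lambda>(t::nat \<Rightarrow> 'v) n x. if n < s then x = y n else x \<in> kernel L \<and>
    (\<forall>i<n. \<forall>j<n. F (t i) (t j) x = 0) \<and> (\<forall>i<n. F (t i) x x = (if i = \<iota> n then \<kappa> n else 0)) \<and>
    F x x x = (if n = \<iota> n then \<kappa> n else 0))"
  have "\<exists>t. \<forall>n. P t n (t n)"
  proof (rule dependent_nat_sequence)
    show "P t n x = P t' n x" if "\<forall>m<n. t m = t' m" for t t' :: "nat \<Rightarrow> 'v" and n x
      using that by (simp add: P_def)
    show "\<exists>x. P t n x" if prev: "\<forall>m<n. P t m (t m)" for t n
    proof (cases "n < s")
      case True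
      then show ?thesis by (simp add: P_def)
    next
      case False
      have ty: "t i = y i" if "i < s" for i
        using prev[rule_format, of i] that False by (simp add: P_def)
      have "\<exists>M. fin_functionals M \<and> (\<forall>v\<in>kernel M. F (t i) v v = 0)" if "i \<in> {s..<n}" for i
      proof -
        have "t i \<in> kernel L" using prev[rule_format, of i] that by (simp add: P_def)
        then show ?thesis using assms(3) unfolding small_def by blast
      qed
      then obtain M where M: "\<And>i. i \<in> {s..<n} \<Longrightarrow> fin_functionals (M i) \<and> (\<forall>v\<in>kernel (M i). F (t i) v v = 0)"
        by metis
      let ?M = "L \<union> (\<Union>i\<in>{s..<n}. M i) \<union> (\<lambda>(i,j). F (t i) (t j)) ` ({..<n} \<times> {..<n})"
      have "fin_functionals (\<Union>i\<in>{s..<n}. M i)" using M by (intro fin_functionals_UN) auto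
      then have "fin_functionals ?M" using assms(2) by (simp add: fin_functionals_F_pairs)
      from quadratic_cubic_values[OF assms(1,4) this, of "\<lambda>i. if i = \<iota> n then \<kappa> n else 0" "if n = \<iota> n then \<kappa> n else 0"]
      obtain x where x: "x \<in> kernel ?M" "\<forall>i<s. F (y i) x x = (if i = \<iota> n then \<kappa> n else 0)"
        "F x x x = (if n = \<iota> n then \<kappa> n else 0)" by auto
      have "F (t i) x x = (if i = \<iota> n then \<kappa> n else 0)" if "i < n" for i
      proof (cases "i < s")
        case True
        then show ?thesis using x(2) ty by simp
      next
        case i: False
        then have "i \<noteq> \<iota> n" using assms(5)[of n] False that by auto
        moreover have "F (t i) x x = 0" using M[of i] x(1) i that by (simp add: kernel_UN)
        ultimately show ?thesis by simp
      qed
      then have "P t n x" using x False by (auto simp: P_def kernel_image)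
      then show ?thesis by blast
    qed
  qed
  then obtain t where t: "\<And>n. P t n (t n)" by auto
  have "t i = y i" if "i < s" for i using t[of i] that by (simp add: P_def)
  moreover have "(\<forall>i<n. \<forall>j<n. F (t i) (t j) (t n) = 0) \<and>
    (\<forall>i\<le>n. F (t i) (t n) (t n) = (if i = \<iota> n then \<kappa> n else 0))" if "s \<le> n" for n
    using t[of n] that by (auto simp: P_def le_less)
  ultimately show ?thesis by blast
qed

text \<open>Keeping each vector outside the span of its predecessors makes the predecessors
  independent modulo small vectors, and this is what permits the next step to prescribe all
  \<open>F (t i) x x\<close>.\<close>

lemma normal_sequence_infinite:
  assumes "nondeg" "\<And>r. \<exists>y. indep_mod_small y r"
  shows "\<exists>t. \<forall>n. (\<forall>i<n. \<forall>j<n. F (t i) (t j) (t n) = 0) \<and>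
    (\<forall>i\<le>n::nat. F (t i) (t n) (t n) = (if i = \<iota> n then \<kappa> n else 0))"
proof -
  define P where "P = (\<lambda>(t::nat \<Rightarrow> 'v) n x. (\<forall>i<n. \<forall>j<n. F (t i) (t j) x = 0) \<and>
    (\<forall>i<n. F (t i) x x = (if i = \<iota> n then \<kappa> n else 0)) \<and>
    F x x x = (if n = \<iota> n then \<kappa> n else 0) \<and> x \<notin> span_mod_small t n)"
  have "\<exists>t. \<forall>n. P t n (t n)"
  proof (rule dependent_nat_sequence)
    show "P t n x = P t' n x" if "\<forall>m<n. t m = t' m" for t t' :: "nat \<Rightarrow> 'v" and n x
      using that span_mod_small_cong[of n t t'] by (simp add: P_def)
    show "\<exists>x. P t n x" if prev: "\<forall>m<n. P t m (t m)" for t n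
    proof -
      have "indep_mod_small t k" if "k \<le> n" for k
        using that
      proof (induction k)
        case (Suc k)
        then show ?case using prev[rule_format, of k] by (intro indep_mod_small_Suc) (auto simp: P_def)
      qed simp
      then have ind: "indep_mod_small t n" by simp
      let ?M = "(\<lambda>(i,j). F (t i) (t j)) ` ({..<n} \<times> {..<n})"
      have "fin_functionals ?M" by (simp add: fin_functionals_F_pairs)
      from values_outside_span[OF assms ind this, of "\<lambda>i. if i = \<iota> n then \<kappa> n else 0" "if n = \<iota> n then \<kappa> n else 0"]
      obtain x where "x \<in> kernel ?M" "\<forall>i<n. F (t i) x x = (if i = \<iota> n then \<kappa> n else 0)"
        "F x x x = (if n = \<iota> n then \<kappa> n else 0)" "x \<notin> span_mod_small t n" by blast
      then have "P t n x" by (auto simp: P_def kernel_image)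
      then show ?thesis by blast
    qed
  qed
  then obtain t where t: "\<And>n. P t n (t n)" by auto
  have "(\<forall>i<n. \<forall>j<n. F (t i) (t j) (t n) = 0) \<and>
    (\<forall>i\<le>n. F (t i) (t n) (t n) = (if i = \<iota> n then \<kappa> n else 0))" for n
    using t[of n] by (auto simp: P_def le_less)
  then show ?thesis by blast
qed

text \<open>Adding \<open>a N\<close> times \<open>t N\<close> to a partial sum \<open>x\<close>
  gives no term linear in \<open>t N\<close>, and the mixed term \<open>3 * F x (t N) (t N)\<close>
  picks out the single index \<open>\<iota> N\<close>. Its factor 3 is why
  \<open>\<kappa> n / 3\<close> is prescribed, except for \<open>\<iota> n = n\<close>, where the
  pure cube with factor 1 does the work.\<close>

lemma normal_sequence_cube:
  fixes t :: "nat \<Rightarrow> 'v"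
  assumes "\<And>n. s \<le> n \<Longrightarrow> (\<forall>i<n. \<forall>j<n. F (t i) (t j) (t n) = 0) \<and>
    (\<forall>i\<le>n. F (t i) (t n) (t n) = (if i = \<iota> n then \<kappa> n / (if \<iota> n = n then 1 else 3) else 0)) \<and> \<iota> n \<le> n"
    and "s \<le> N"
  shows "(let x = \<Sum>n<N. scale (a n) (t n); y = \<Sum>n<s. scale (a n) (t n) in
    F x x x = F y y y + (\<Sum>n\<in>{s..<N}. \<kappa> n * a (\<iota> n) * a n ^ 2))"
  using assms(2)
proof (induction N rule: dec_induct)
  case base
  then show ?case by simp
next
  case (step N)
  define x where "x = (\<Sum>n<N. scale (a n) (t n))"
  have xx: "F x x (t N) = 0" unfolding x_def using assms(1)[OF step.hyps(1)] by (simp add: F_sum1 F_sum2)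
  have xt: "F x (t N) (t N) = (if \<iota> N = N then 0 else \<kappa> N / 3 * a (\<iota> N))"
  proof -
    have "F x (t N) (t N) = (\<Sum>n<N. if n = \<iota> N then \<kappa> N / (if \<iota> N = N then 1 else 3) * a n else 0)"
      unfolding x_def F_sum1 using assms(1)[OF step.hyps(1)] by (intro sum.cong) auto
    then show ?thesis using assms(1)[OF step.hyps(1)] by auto
  qed
  have tt: "F (t N) (t N) (t N) = (if \<iota> N = N then \<kappa> N else 0)"
    using assms(1)[OF step.hyps(1)] by auto
  have "F (x + scale (a N) (t N)) (x + scale (a N) (t N)) (x + scale (a N) (t N))
    = F x x x + \<kappa> N * a (\<iota> N) * a N ^ 2"
    unfolding F_cube_add using three_nonzero
    by (simp add: F_simps xx xt tt power2_eq_square)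
  then show ?case using step by (simp add: Let_def x_def)
qed

end

section \<open>Decomposition of cubic forms in countably many variables\<close>

context functionals
begin

lemma functional_plus: "functional l \<Longrightarrow> functional m \<Longrightarrow> functional (\<lambda>v. l v + m v)"
  and functional_minus: "functional l \<Longrightarrow> functional m \<Longrightarrow> functional (\<lambda>v. l v - m v)"
  and functional_times: "functional l \<Longrightarrow> functional (\<lambda>v. a * l v)"
  and functional_times_right: "functional l \<Longrightarrow> functional (\<lambda>v. l v * a)"
  and functional_0: "functional (\<lambda>v. 0)"
  by (auto intro!: functionalI simp: functional_simps algebra_simps)

definition finite_rank :: "('b \<Rightarrow> 'b \<Rightarrow> 'a) \<Rightarrow> bool" where
  "finite_rank B \<longleftrightarrow> (\<exists>ps. (\<forall>(l, m)\<in>set ps. functional l \<and> functional m) \<and>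
    (\<forall>x y. B x y = (\<Sum>(l, m)\<leftarrow>ps. l x * m y)))"

lemma finite_rank_zero: "finite_rank (\<lambda>x y. 0)"
  unfolding finite_rank_def by (rule exI[of _ "[]"]) simp

lemma finite_rank_product: "functional l \<Longrightarrow> functional m \<Longrightarrow> finite_rank (\<lambda>x y. l x * m y)"
  unfolding finite_rank_def by (rule exI[of _ "[(l, m)]"]) simp

lemma finite_rank_add:
  assumes "finite_rank B" "finite_rank C"
  shows "finite_rank (\<lambda>x y. B x y + C x y)"
proof -
  obtain ps qs where "\<forall>(l, m)\<in>set ps. functional l \<and> functional m"
    "\<forall>x y. B x y = (\<Sum>(l, m)\<leftarrow>ps. l x * m y)" "\<forall>(l, m)\<in>set qs. functional l \<and> functional m"
    "\<forall>x y. C x y = (\<Sum>(l, m)\<leftarrow>qs. l x * m y)"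
    using assms unfolding finite_rank_def by blast
  then show ?thesis unfolding finite_rank_def by (intro exI[of _ "ps @ qs"]) auto
qed

lemma finite_rank_sum:
  assumes "\<And>i. i < (n::nat) \<Longrightarrow> functional (l i)" "\<And>i. i < n \<Longrightarrow> functional (m i)"
  shows "finite_rank (\<lambda>x y. \<Sum>i<n. l i x * m i y)"
  using assms by (induction n) (auto intro!: finite_rank_zero finite_rank_add finite_rank_product)

text \<open>The set \<open>Z\<close> records where the functionals vanish. With
  \<open>Z = tail_zero i\<close> this ensures that only finitely many layers contribute at a given
  vector.\<close>

definition cube_sum_on :: "'b set \<Rightarrow> ('b \<Rightarrow> 'a) \<Rightarrow> bool" where
  "cube_sum_on Z h \<longleftrightarrow> (\<exists>qs. (\<forall>(k, l)\<in>set qs. functional l \<and> (\<forall>v\<in>Z. l v = 0)) \<and>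
    (\<forall>v. h v = (\<Sum>(k, l)\<leftarrow>qs. k * l v ^ 3)))"

lemma cube_sum_on_zero: "cube_sum_on Z (\<lambda>v. 0)"
  unfolding cube_sum_on_def by (rule exI[of _ "[]"]) simp

lemma cube_sum_on_add:
  assumes "cube_sum_on Z g" "cube_sum_on Z h"
  shows "cube_sum_on Z (\<lambda>v. g v + h v)"
proof -
  obtain ps qs where "\<forall>(k, l)\<in>set ps. functional l \<and> (\<forall>v\<in>Z. l v = 0)"
    "\<forall>v. g v = (\<Sum>(k, l)\<leftarrow>ps. k * l v ^ 3)" "\<forall>(k, l)\<in>set qs. functional l \<and> (\<forall>v\<in>Z. l v = 0)"
    "\<forall>v. h v = (\<Sum>(k, l)\<leftarrow>qs. k * l v ^ 3)"
    using assms unfolding cube_sum_on_def by blast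
  then show ?thesis unfolding cube_sum_on_def by (intro exI[of _ "ps @ qs"]) auto
qed

text \<open>Polarisation of \<open>x * y * z\<close> over the signs of \<open>y\<close> and
  \<open>z\<close>; the denominator \<open>24 = 2^3 * 3\<close> is invertible.\<close>

lemma cube_sum_on_product:
  assumes "(2::'a) \<noteq> 0" "(3::'a) \<noteq> 0" "functional a" "functional b" "functional c"
    and "\<And>v. v \<in> Z \<Longrightarrow> a v = 0" "\<And>v. v \<in> Z \<Longrightarrow> b v = 0" "\<And>v. v \<in> Z \<Longrightarrow> c v = 0"
  shows "cube_sum_on Z (\<lambda>v. a v * b v * c v)"
proof -
  have n24: "(24::'a) = 2 * 2 * 2 * 3" by simp
  then have nz: "(24::'a) \<noteq> 0" using assms(1,2) by (metis mult_eq_0_iff)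
  have id: "24 * (x * y * z) = (x + y + z) ^ 3 - (x + y - z) ^ 3 - (x - y + z) ^ 3 + (x - y - z) ^ 3"
    for x y z :: 'a by (simp add: power3_eq_cube algebra_simps)
  have "x * y * z = 1/24 * (x + y + z) ^ 3 + (-1/24 * (x + y - z) ^ 3 + (-1/24 * (x - y + z) ^ 3
    + 1/24 * (x - y - z) ^ 3))" for x y z :: 'a
  proof -
    have "x * y * z = 1/24 * (24 * (x * y * z))" using nz by simp
    also have "\<dots> = 1/24 * (x + y + z) ^ 3 + (-1/24 * (x + y - z) ^ 3 + (-1/24 * (x - y + z) ^ 3
      + 1/24 * (x - y - z) ^ 3))" unfolding id by (simp add: distrib_left right_diff_distrib)
    finally show ?thesis .
  qed
  then show ?thesis unfolding cube_sum_on_def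
    by (intro exI[of _ "[(1/24, \<lambda>v. a v + b v + c v), (-1/24, \<lambda>v. a v + b v - c v),
        (-1/24, \<lambda>v. a v - b v + c v), (1/24, \<lambda>v. a v - b v - c v)]"])
      (use assms in \<open>simp add: functional_plus functional_minus\<close>)
qed

end

context cubic_form
begin

text \<open>Split both arguments along \<open>kernel_projection\<close>. Polarised, the vanishing on
  \<open>kernel L\<close> kills the term with both arguments projected; every other term contains
  one of finitely many \<open>t i\<close> and is a product of two functionals.\<close>

lemma small_finite_rank:
  assumes "small w"
  shows "finite_rank (F w)"
proof -
  obtain L where L: "fin_functionals L" "\<And>v. v \<in> kernel L \<Longrightarrow> F w v v = 0"
    using assms unfolding small_def by blast
  obtain n :: nat and m t where m: "\<And>i. i < n \<Longrightarrow> functional (m i)"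
    and P: "\<And>v. v - (\<Sum>i<n. scale (m i v) (t i)) \<in> kernel L"
    using kernel_projection[OF L(1)] by blast
  define p where "p v = v - (\<Sum>i<n. scale (m i v) (t i))" for v
  have pp: "F w (p x) (p y) = 0" for x y
  proof -
    have "p x + p y \<in> kernel L" using P L(1) by (simp add: p_def kernel_add)
    then have "2 * F w (p x) (p y) = 0"
      using L(2)[of "p x + p y"] L(2)[of "p x"] L(2)[of "p y"] P unfolding F_quad_add by (simp add: p_def)
    then show ?thesis using two_nonzero by simp
  qed
  have fp: "functional (\<lambda>x. F w (p x) z)" for z
    using m unfolding p_def by (intro functionalI)
      (simp_all add: F_simps F_sum2 functional_simps algebra_simps sum.distrib sum_distrib_left)
  have "F w x y = (\<Sum>i<n. m i x * F w (t i) y) + (\<Sum>i<n. F w (p x) (t i) * m i y)" for x y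
  proof -
    have "F w (p x) y = F w (p x) (p y) + (\<Sum>i<n. F w (p x) (t i) * m i y)"
      unfolding p_def[of y] by (simp add: F_simps F_sum3 mult.commute)
    moreover have "F w (p x) y = F w x y - (\<Sum>i<n. m i x * F w (t i) y)"
      unfolding p_def by (simp add: F_simps F_sum2)
    ultimately show ?thesis by (simp add: pp algebra_simps)
  qed
  then have "F w = (\<lambda>x y. (\<Sum>i<n. m i x * F w (t i) y) + (\<Sum>i<n. F w (p x) (t i) * m i y))"
    by blast
  moreover have "finite_rank (\<lambda>x y. (\<Sum>i<n. m i x * F w (t i) y) + (\<Sum>i<n. F w (p x) (t i) * m i y))"
    by (intro finite_rank_add finite_rank_sum m fp functional_F3)
  ultimately show ?thesis by simp
qed

end

text \<open>Asking for a reconstruction of each vector from its coordinates, rather than for a dual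
  basis, admits the redundant family of \<open>cubic_form_coords_adapted\<close>.\<close>

locale cubic_form_coords = cubic_form scale F
  for scale :: "'k::field \<Rightarrow> 'v::ab_group_add \<Rightarrow> 'v" and F +
  fixes b :: "nat \<Rightarrow> 'v" and \<beta> :: "nat \<Rightarrow> 'v \<Rightarrow> 'k"
  assumes functional_coord: "functional (\<beta> n)"
    and coords_exhaust: "\<exists>N. \<forall>n\<ge>N. \<beta> n v = 0 \<and> v = (\<Sum>i<n. scale (\<beta> i v) (b i))"
begin

definition tail :: "nat \<Rightarrow> 'v \<Rightarrow> 'v" where
  "tail n v = v - (\<Sum>i<n. scale (\<beta> i v) (b i))"

definition tail_zero :: "nat \<Rightarrow> 'v set" where
  "tail_zero n = {v. \<forall>j\<ge>n. \<beta> j v = 0 \<and> tail j v = 0}"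

lemma tail_0 [simp]: "tail 0 v = v"
  by (simp add: tail_def)

lemma tail_Suc: "tail n v = tail (Suc n) v + scale (\<beta> n v) (b n)"
  by (simp add: tail_def)

lemma tail_add: "tail n (x + y) = tail n x + tail n y"
  by (simp add: tail_def functional_simps[OF functional_coord] scale_left_distrib sum.distrib)

lemma tail_scale: "tail n (scale c x) = scale c (tail n x)"
  by (simp add: tail_def functional_simps[OF functional_coord] scale_right_diff_distrib scale_sum_right)

lemma functional_tail: "functional l \<Longrightarrow> functional (\<lambda>v. l (tail n v))"
  by (intro functionalI) (simp_all add: tail_add tail_scale functional_simps)

lemma tail_zero_mono: "m \<le> n \<Longrightarrow> tail_zero m \<subseteq> tail_zero n"
  by (auto simp: tail_zero_def)

lemma tail_zero_exhaust: "\<exists>N. v \<in> tail_zero N"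
  using coords_exhaust[of v] by (auto simp: tail_zero_def tail_def)

text \<open>Replacing \<open>tail j v\<close> by \<open>tail (Suc j) v\<close> in one argument after
  the other leaves \<open>\<beta> j v\<close> times a functional of \<open>v\<close>. A quadratic
  form thus becomes a locally finite sum of products of two functionals.\<close>

lemma F_telescope:
  assumes "i \<le> K"
  shows "F w (tail i v) (tail i v) = (\<Sum>j\<in>{i..<K}. \<beta> j v * (F w (b j) (tail j v) + F w (tail (Suc j) v) (b j)))
    + F w (tail K v) (tail K v)"
  using assms
proof (induction K rule: dec_induct)
  case (step K)
  have "F w (tail K v) (tail K v) = \<beta> K v * (F w (b K) (tail K v) + F w (tail (Suc K) v) (b K)) +
      F w (tail (Suc K) v) (tail (Suc K) v)"
    unfolding tail_Suc[of K v] by (simp add: F_simps algebra_simps)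
  then show ?case using step by (simp add: algebra_simps)
qed simp

text \<open>Each product is a difference of squares,
  \<open>c * l = ((c + l)^2 - (c - l)^2) / 4\<close>, with sums at the even and differences at the
  odd indices.\<close>

lemma sum_products_squares:
  fixes c l :: "nat \<Rightarrow> 'v \<Rightarrow> 'k"
  assumes "\<And>j. functional (c j)" "\<And>j. functional (l j)"
    and "\<And>v. \<exists>N. \<forall>j\<ge>N. c j v = 0 \<and> l j v = 0"
    and "\<And>j v. v \<in> Z \<Longrightarrow> c j v = 0 \<and> l j v = 0"
  shows "\<exists>\<kappa> \<mu>. (\<forall>n::nat. functional (\<mu> n)) \<and> (\<forall>v. finite {n. \<mu> n v \<noteq> 0}) \<and>
    (\<forall>n. \<forall>v\<in>Z. \<mu> n v = 0) \<and>
    (\<forall>v N. (\<forall>j\<ge>N. c j v = 0 \<and> l j v = 0) \<longrightarrow>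
      (\<Sum>n | \<mu> n v \<noteq> 0. \<kappa> n * \<mu> n v ^ 2) = (\<Sum>j<N. c j v * l j v))"
proof -
  define \<mu> where "\<mu> = (\<lambda>n v. if even n then c (n div 2) v + l (n div 2) v else c (n div 2) v - l (n div 2) v)"
  define \<kappa> :: "nat \<Rightarrow> 'k" where "\<kappa> = (\<lambda>n. if even n then 1/4 else -1/4)"
  have "functional (\<mu> n)" for n
    using assms(1,2) by (cases "even n") (simp_all add: \<mu>_def functional_plus functional_minus)
  moreover have bound: "\<mu> n v = 0" if "\<forall>j\<ge>N. c j v = 0 \<and> l j v = 0" "2 * N \<le> n" for n N v
    using that by (simp add: \<mu>_def)
  moreover have sub: "{n. \<mu> n v \<noteq> 0} \<subseteq> {..<2 * N}" if "\<forall>j\<ge>N. c j v = 0 \<and> l j v = 0" for N v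
  proof
    fix n assume "n \<in> {n. \<mu> n v \<noteq> 0}"
    then show "n \<in> {..<2 * N}" using bound[OF that, of n] by (cases "2 * N \<le> n") auto
  qed
  moreover have "finite {n. \<mu> n v \<noteq> 0}" for v
  proof -
    obtain N where "\<forall>j\<ge>N. c j v = 0 \<and> l j v = 0" using assms(3) by blast
    then show ?thesis by (rule finite_subset[OF sub]) simp
  qed
  moreover have "\<mu> n v = 0" if "v \<in> Z" for n v using assms(4)[OF that] by (simp add: \<mu>_def)
  moreover have "(\<Sum>n | \<mu> n v \<noteq> 0. \<kappa> n * \<mu> n v ^ 2) = (\<Sum>j<N. c j v * l j v)"
    if "\<forall>j\<ge>N. c j v = 0 \<and> l j v = 0" for v N
  proof -
    have "(\<Sum>n | \<mu> n v \<noteq> 0. \<kappa> n * \<mu> n v ^ 2) = (\<Sum>n<2 * N. \<kappa> n * \<mu> n v ^ 2)"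
      using sub[OF that] by (intro sum.mono_neutral_left) auto
    also have "\<dots> = (\<Sum>j<N. \<kappa> (2*j) * \<mu> (2*j) v ^ 2 + \<kappa> (2*j+1) * \<mu> (2*j+1) v ^ 2)"
      by (induction N) (simp_all add: algebra_simps)
    also have "\<dots> = (\<Sum>j<N. c j v * l j v)"
    proof (rule sum.cong[OF refl])
      fix j
      have "(4::'k) = 2 * 2" by simp
      then have four: "(4::'k) \<noteq> 0" using two_nonzero by (metis mult_eq_0_iff)
      have "\<kappa> (2*j) * \<mu> (2*j) v ^ 2 + \<kappa> (2*j+1) * \<mu> (2*j+1) v ^ 2
          = 1/4 * ((c j v + l j v) ^ 2 - (c j v - l j v) ^ 2)"
        by (simp add: \<kappa>_def \<mu>_def diff_divide_distrib)
      also have "(c j v + l j v) ^ 2 - (c j v - l j v) ^ 2 = 4 * (c j v * l j v)"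
        by (simp add: power2_eq_square algebra_simps)
      finally show "\<kappa> (2*j) * \<mu> (2*j) v ^ 2 + \<kappa> (2*j+1) * \<mu> (2*j+1) v ^ 2 = c j v * l j v"
        using four by simp
    qed
    finally show ?thesis .
  qed
  ultimately show ?thesis by blast
qed

definition layer :: "nat \<Rightarrow> 'v \<Rightarrow> 'k" where
  "layer i v = F (tail i v) (tail i v) (tail i v) - F (tail (Suc i) v) (tail (Suc i) v) (tail (Suc i) v)"

lemma layer_eq:
  "layer i v = \<beta> i v * (3 * F (b i) (tail (Suc i) v) (tail (Suc i) v) +
    \<beta> i v * (3 * F (b i) (b i) (tail (Suc i) v) + \<beta> i v * F (b i) (b i) (b i)))"
proof -
  let ?x = "tail (Suc i) v" and ?b = "b i"
  have "F ?x ?x ?b = F ?b ?x ?x" "F ?x ?b ?b = F ?b ?b ?x"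
    using F_rotate[of ?x ?x ?b] F_rotate[of ?b ?b ?x] by simp_all
  then show ?thesis unfolding layer_def tail_Suc[of i v] F_cube_add by (simp add: F_simps algebra_simps)
qed

lemma layer_squares:
  "\<exists>\<kappa> \<mu>. (\<forall>n::nat. functional (\<mu> n)) \<and> (\<forall>v. finite {n. \<mu> n v \<noteq> 0}) \<and>
    (\<forall>n. \<forall>v\<in>tail_zero i. \<mu> n v = 0) \<and>
    (\<forall>v. layer i v = (\<Sum>n | \<mu> n v \<noteq> 0. \<kappa> n * \<beta> i v * \<mu> n v ^ 2))"
proof -
  define c where "c = (\<lambda>j v. if i \<le> j then \<beta> j v else 0)"
  \<comment> \<open>The index \<open>j = i\<close> carries the bracket of \<open>layer_eq\<close>
    that already has a factor \<open>\<beta> i v\<close>; larger \<open>j\<close> carry the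
    telescoped quadratic form with its factor 3.\<close>
  define l where "l = (\<lambda>j v. if j < i then 0 else if j = i
    then 3 * F (b i) (b i) (tail (Suc i) v) + \<beta> i v * F (b i) (b i) (b i)
    else 3 * (F (b i) (b j) (tail j v) + F (b i) (tail (Suc j) v) (b j)))"
  have fc: "functional (c j)" for j
    by (cases "i \<le> j") (simp_all add: c_def functional_coord functional_0)
  have fl: "functional (l j)" for j
  proof -
    have "functional (\<lambda>v. \<beta> i v * F (b i) (b i) (b i))"
      by (rule functional_times_right[OF functional_coord])
    moreover have "functional (\<lambda>v. F (b i) (tail (Suc j) v) (b j))"
      by (rule functional_tail[OF functional_F2])
    moreover have "functional (\<lambda>v. F (b i) (b k) (tail j v))" for j k
      by (rule functional_tail[OF functional_F3])
    ultimately show ?thesis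
      by (cases i j rule: linorder_cases) (auto simp: l_def intro!: functional_0 functional_plus functional_times)
  qed
  have vanish: "c j v = 0 \<and> l j v = 0" if "v \<in> tail_zero N" "N \<le> j \<or> N \<le> i" for j v N
    using that by (auto simp: c_def l_def tail_zero_def F_simps)
  obtain \<kappa> \<mu> where k: "\<forall>n::nat. functional (\<mu> n)" "\<forall>v. finite {n. \<mu> n v \<noteq> 0}"
    "\<forall>n. \<forall>v\<in>tail_zero i. \<mu> n v = 0"
    "\<And>v N. (\<forall>j\<ge>N. c j v = 0 \<and> l j v = 0) \<Longrightarrow>
      (\<Sum>n | \<mu> n v \<noteq> 0. \<kappa> n * \<mu> n v ^ 2) = (\<Sum>j<N. c j v * l j v)"
  proof -
    have "\<exists>N. \<forall>j\<ge>N. c j v = 0 \<and> l j v = 0" for v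
      using tail_zero_exhaust[of v] vanish by blast
    from sum_products_squares[of c l "tail_zero i", OF fc fl this] vanish show thesis
      using that by blast
  qed
  have "layer i v = (\<Sum>n | \<mu> n v \<noteq> 0. \<kappa> n * \<beta> i v * \<mu> n v ^ 2)" for v
  proof -
    obtain N0 where "v \<in> tail_zero N0" using tail_zero_exhaust by blast
    then have N: "v \<in> tail_zero (N0 + Suc i)" using tail_zero_mono[of N0 "N0 + Suc i"] by auto
    let ?N = "N0 + Suc i"
    have "(\<Sum>j<?N. c j v * l j v) = (\<Sum>j\<in>{i..<?N}. c j v * l j v)"
      by (rule sum.mono_neutral_right) (auto simp: c_def)
    also have "\<dots> = c i v * l i v + (\<Sum>j\<in>{Suc i..<?N}. c j v * l j v)"
      by (subst sum.atLeast_Suc_lessThan) auto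
    also have "(\<Sum>j\<in>{Suc i..<?N}. c j v * l j v) =
        3 * (\<Sum>j\<in>{Suc i..<?N}. \<beta> j v * (F (b i) (b j) (tail j v) + F (b i) (tail (Suc j) v) (b j)))"
      unfolding sum_distrib_left by (rule sum.cong) (auto simp: c_def l_def)
    also have "\<dots> = 3 * F (b i) (tail (Suc i) v) (tail (Suc i) v)"
      using F_telescope[of "Suc i" ?N "b i" v] N by (simp add: tail_zero_def F_simps)
    finally have "layer i v = \<beta> i v * (\<Sum>j<?N. c j v * l j v)"
      by (simp add: layer_eq c_def l_def algebra_simps)
    also have "(\<Sum>j<?N. c j v * l j v) = (\<Sum>n | \<mu> n v \<noteq> 0. \<kappa> n * \<mu> n v ^ 2)"
      using vanish[OF N] by (intro k(4)[symmetric]) auto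
    finally show ?thesis by (simp add: sum_distrib_left mult.assoc mult.left_commute)
  qed
  then show ?thesis using k(1-3) by blast
qed

text \<open>If \<open>F (b i)\<close> has finite rank, the layer is a finite sum of products of
  three functionals that vanish on \<open>tail_zero i\<close>, hence a finite sum of cubes. A cube
  refers only to its own functional, the one kind of term that \<open>normal_sequence_finite\<close>
  allows without naming one of the first \<open>s\<close> vectors.\<close>

lemma layer_cubes:
  assumes "small (b i)"
  shows "\<exists>\<kappa> \<mu>. (\<forall>n::nat. functional (\<mu> n)) \<and> (\<forall>v. finite {n. \<mu> n v \<noteq> 0}) \<and>
    (\<forall>n. \<forall>v\<in>tail_zero i. \<mu> n v = 0) \<and>
    (\<forall>v. layer i v = (\<Sum>n | \<mu> n v \<noteq> 0. \<kappa> n * \<mu> n v * \<mu> n v ^ 2))"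
proof -
  let ?Z = "tail_zero i"
  obtain ps where ps: "\<forall>(l, m)\<in>set ps. functional l \<and> functional m"
    "\<forall>x y. F (b i) x y = (\<Sum>(l, m)\<leftarrow>ps. l x * m y)"
    using small_finite_rank[OF assms] unfolding finite_rank_def by blast
  note prod = cube_sum_on_product[OF two_nonzero three_nonzero]
  have quad: "cube_sum_on ?Z (\<lambda>v. \<Sum>(l, m)\<leftarrow>ps. (3 * \<beta> i v) * l (tail (Suc i) v) * m (tail (Suc i) v))"
    using ps(1)
  proof (induction ps)
    case (Cons p ps)
    obtain l m where p: "p = (l, m)" by fastforce
    have "cube_sum_on ?Z (\<lambda>v. (3 * \<beta> i v) * l (tail (Suc i) v) * m (tail (Suc i) v))"
      using Cons.prems p functional_zero
      by (intro prod functional_tail functional_times functional_coord) (auto simp: tail_zero_def)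
    then show ?case using cube_sum_on_add Cons p by simp
  qed (simp add: cube_sum_on_zero)
  have lin: "cube_sum_on ?Z (\<lambda>v. \<beta> i v * \<beta> i v * (3 * F (b i) (b i) (tail (Suc i) v) + \<beta> i v * F (b i) (b i) (b i)))"
  proof (intro prod functional_coord functional_plus)
    show "functional (\<lambda>v. 3 * F (b i) (b i) (tail (Suc i) v))"
      by (intro functional_times functional_tail[OF functional_F3])
    show "functional (\<lambda>v. \<beta> i v * F (b i) (b i) (b i))"
      by (rule functional_times_right[OF functional_coord])
  qed (auto simp: tail_zero_def F_simps)
  have eq: "layer i v = (\<Sum>(l, m)\<leftarrow>ps. (3 * \<beta> i v) * l (tail (Suc i) v) * m (tail (Suc i) v)) +
    \<beta> i v * \<beta> i v * (3 * F (b i) (b i) (tail (Suc i) v) + \<beta> i v * F (b i) (b i) (b i))" for v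
  proof -
    let ?x = "tail (Suc i) v"
    have "(\<Sum>(l, m)\<leftarrow>ps. (3 * \<beta> i v) * l ?x * m ?x) = 3 * \<beta> i v * F (b i) ?x ?x"
      using ps(2) by (simp add: sum_list_const_mult[symmetric] case_prod_unfold mult.assoc)
    then show ?thesis unfolding layer_eq by (simp add: algebra_simps)
  qed
  have "cube_sum_on ?Z (layer i)"
    using cube_sum_on_add[OF quad lin] unfolding eq[symmetric] .
  then obtain qs where qs: "\<forall>(k, l)\<in>set qs. functional l \<and> (\<forall>v\<in>?Z. l v = 0)"
    "\<And>v. layer i v = (\<Sum>(k, l)\<leftarrow>qs. k * l v ^ 3)" unfolding cube_sum_on_def by blast
  define \<kappa> where "\<kappa> = (\<lambda>n. fst (qs ! n))"
  define \<mu> where "\<mu> = (\<lambda>n. if n < length qs then snd (qs ! n) else (\<lambda>v. 0))"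
  have "functional (\<mu> n)" for n
    using qs(1)[unfolded case_prod_unfold] by (simp add: \<mu>_def functional_0)
  moreover have "\<mu> n v = 0" if "v \<in> ?Z" for n v
    using qs(1)[unfolded case_prod_unfold] that by (simp add: \<mu>_def)
  moreover have sub: "{n. \<mu> n v \<noteq> 0} \<subseteq> {..<length qs}" for v by (auto simp: \<mu>_def split: if_splits)
  moreover have "finite {n. \<mu> n v \<noteq> 0}" for v by (rule finite_subset[OF sub]) simp
  moreover have "layer i v = (\<Sum>n | \<mu> n v \<noteq> 0. \<kappa> n * \<mu> n v * \<mu> n v ^ 2)" for v
  proof -
    have "layer i v = (\<Sum>n<length qs. \<kappa> n * \<mu> n v * \<mu> n v ^ 2)"
      unfolding qs(2) by (subst sum_list_sum_nth)
        (auto simp: \<kappa>_def \<mu>_def case_prod_unfold lessThan_atLeast0 power3_eq_cube power2_eq_square mult.assoc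
          intro!: sum.cong)
    also have "\<dots> = (\<Sum>n | \<mu> n v \<noteq> 0. \<kappa> n * \<mu> n v * \<mu> n v ^ 2)"
      using sub by (intro sum.mono_neutral_right) auto
    finally show ?thesis .
  qed
  ultimately show ?thesis by blast
qed

text \<open>Layers in \<open>A\<close> stay coordinate times squares, the others become cubes;
  \<open>prod_encode\<close> lines up the terms \<open>(i, n)\<close> of all layers in one
  sequence.\<close>

lemma cubic_decomposition:
  assumes "\<And>i. i \<notin> A \<Longrightarrow> small (b i)"
  shows "\<exists>\<kappa> \<mu>. (\<forall>m. functional (\<mu> m)) \<and> (\<forall>v. finite {m. \<mu> m v \<noteq> 0}) \<and>
    (\<forall>v. F v v v = (\<Sum>m | \<mu> m v \<noteq> 0. \<kappa> m *
      (if fst (prod_decode m) \<in> A then \<beta> (fst (prod_decode m)) v else \<mu> m v) * \<mu> m v ^ 2))"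
proof -
  have "\<forall>i. \<exists>\<kappa> \<mu>. (\<forall>n::nat. functional (\<mu> n)) \<and> (\<forall>v. finite {n. \<mu> n v \<noteq> 0}) \<and>
    (\<forall>n. \<forall>v\<in>tail_zero i. \<mu> n v = 0) \<and>
    (\<forall>v. layer i v = (\<Sum>n | \<mu> n v \<noteq> 0. \<kappa> n * (if i \<in> A then \<beta> i v else \<mu> n v) * \<mu> n v ^ 2))"
    (is "\<forall>i. \<exists>\<kappa> \<mu>. ?R i \<kappa> \<mu>")
  proof
    fix i
    show "\<exists>\<kappa> \<mu>. ?R i \<kappa> \<mu>" using layer_squares[of i] layer_cubes[of i] assms by (cases "i \<in> A") simp_all
  qed
  from choice[OF this] obtain \<kappa> where "\<forall>i. \<exists>\<mu>. ?R i (\<kappa> i) \<mu>" by blast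
  from choice[OF this] obtain \<mu> where R: "\<forall>i. ?R i (\<kappa> i) (\<mu> i)" by blast
  have R1: "functional (\<mu> i n)" and R2: "finite {n. \<mu> i n v \<noteq> 0}"
    and R3: "v \<in> tail_zero i \<Longrightarrow> \<mu> i n v = 0"
    and R4: "layer i v = (\<Sum>n | \<mu> i n v \<noteq> 0. \<kappa> i n * (if i \<in> A then \<beta> i v else \<mu> i n v) * \<mu> i n v ^ 2)"
    for i n v using R by simp_all
  define \<kappa>' where "\<kappa>' = (\<lambda>m. case_prod \<kappa> (prod_decode m))"
  define \<mu>' where "\<mu>' = (\<lambda>m. case_prod \<mu> (prod_decode m))"
  have "functional (\<mu>' m)" for m using R1 by (auto simp: \<mu>'_def split: prod.splits)
  moreover have fin: "finite {m. \<mu>' m v \<noteq> 0} \<and> F v v v = (\<Sum>m | \<mu>' m v \<noteq> 0. \<kappa>' m *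
      (if fst (prod_decode m) \<in> A then \<beta> (fst (prod_decode m)) v else \<mu>' m v) * \<mu>' m v ^ 2)" for v
  proof -
    obtain N where N: "v \<in> tail_zero N" using tail_zero_exhaust by blast
    let ?S = "SIGMA i:{..<N}. {n. \<mu> i n v \<noteq> 0}"
    \<comment> \<open>Layers from \<open>N\<close> on contribute nothing on
      \<open>tail_zero N\<close>, so the joint family is locally finite.\<close>
    have big: "\<mu> i n v = 0" if "N \<le> i" for i n using N tail_zero_mono[OF that] by (intro R3) blast
    have S: "{m. \<mu>' m v \<noteq> 0} = prod_encode ` ?S"
    proof (intro equalityI subsetI)
      fix m assume m: "m \<in> {m. \<mu>' m v \<noteq> 0}"
      obtain i n where "prod_decode m = (i, n)" by fastforce
      then have "m = prod_encode (i, n)" by (metis prod_decode_inverse)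
      then show "m \<in> prod_encode ` ?S" using m big[of i n] by (force simp: \<mu>'_def)
    qed (auto simp: \<mu>'_def)
    have finS: "finite ?S" using R2 by (intro finite_SigmaI) auto
    have "F v v v = (\<Sum>i<N. layer i v)"
    proof -
      have "(\<Sum>i<K. layer i v) = F v v v - F (tail K v) (tail K v) (tail K v)" for K
        by (induction K) (simp_all add: layer_def)
      then show ?thesis using N by (simp add: tail_zero_def F_simps)
    qed
    also have "\<dots> = (\<Sum>i<N. \<Sum>n | \<mu> i n v \<noteq> 0. \<kappa> i n * (if i \<in> A then \<beta> i v else \<mu> i n v) * \<mu> i n v ^ 2)"
      by (simp only: R4)
    also have "\<dots> = (\<Sum>(i, n)\<in>?S. \<kappa> i n * (if i \<in> A then \<beta> i v else \<mu> i n v) * \<mu> i n v ^ 2)"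
      using R2 by (intro sum.Sigma) auto
    also have "\<dots> = (\<Sum>m | \<mu>' m v \<noteq> 0. \<kappa>' m *
      (if fst (prod_decode m) \<in> A then \<beta> (fst (prod_decode m)) v else \<mu>' m v) * \<mu>' m v ^ 2)"
      unfolding S by (subst sum.reindex)
        (auto simp: \<kappa>'_def \<mu>'_def case_prod_unfold intro!: sum.cong inj_on_subset[OF inj_prod_encode])
    finally show ?thesis using finS by (simp add: S)
  qed
  ultimately show ?thesis by blast
qed

end

section \<open>Embeddings of trilinear forms\<close>

text \<open>If \<open>T w\<close> is small then so is \<open>w\<close>, because the functionals that
  witness it compose with \<open>T\<close>. A small combination of the images therefore comes from a
  small combination of the \<open>y i\<close>.\<close>

lemma indep_mod_small_pullback:
  assumes "cubic_form sV F" "cubic_form sW G" "Vector_Spaces.linear sW sV T"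
    and "\<And>x y z. G x y z = F (T x) (T y) (T z)" "cubic_form.indep_mod_small sW G y r"
  shows "cubic_form.indep_mod_small sV F (\<lambda>i. T (y i)) r"
proof -
  interpret V: cubic_form sV F by fact
  interpret W: cubic_form sW G by fact
  interpret T: Vector_Spaces.linear sW sV T by fact
  have small: "W.small w" if Tw: "V.small (T w)" for w
  proof -
    obtain L where L: "V.fin_functionals L" "\<And>v. v \<in> V.kernel L \<Longrightarrow> F (T w) v v = 0"
      using Tw unfolding V.small_def by blast
    have "W.fin_functionals ((\<lambda>l v. l (T v)) ` L)"
      using L(1) by (auto simp: W.fin_functionals_def V.fin_functionals_def V.functional_def W.functional_def
        T.add T.scale)
    moreover have "T v \<in> V.kernel L" if "v \<in> W.kernel ((\<lambda>l v. l (T v)) ` L)" for v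
      using that by (simp add: V.kernel_def W.kernel_def)
    ultimately show ?thesis unfolding W.small_def using L(2) assms(4) by metis
  qed
  show ?thesis unfolding V.indep_mod_small_def
  proof (intro allI impI)
    fix c i assume c: "V.small (\<Sum>i<r. sV (c i) (T (y i)))" "i < r"
    have "(\<Sum>i<r. sV (c i) (T (y i))) = T (\<Sum>i<r. sW (c i) (y i))"
      by (simp add: T.sum T.scale)
    then have "W.small (\<Sum>i<r. sW (c i) (y i))" using c(1) small by simp
    then show "c i = 0" using assms(5) c(2) unfolding W.indep_mod_small_def by blast
  qed
qed

lemma locally_finite_combination:
  fixes a :: "nat \<Rightarrow> 'w::ab_group_add \<Rightarrow> 'k::field" and t :: "nat \<Rightarrow> 'v::ab_group_add"
  assumes "vector_space sV" "vector_space sW"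
    and "\<And>n. functionals.functional sW (a n)" "\<And>w. finite {n. a n w \<noteq> 0}"
  shows "\<exists>\<Phi>. Vector_Spaces.linear sW sV \<Phi> \<and>
    (\<forall>w N. (\<forall>n\<ge>N. a n w = 0) \<longrightarrow> \<Phi> w = (\<Sum>n<N. sV (a n w) (t n)))"
proof -
  interpret V: vector_space sV by fact
  interpret W: functionals sW using assms(2) by (simp add: functionals_def)
  define \<Phi> where "\<Phi> w = (\<Sum>n | a n w \<noteq> 0. sV (a n w) (t n))" for w
  have \<Phi>: "\<Phi> w = (\<Sum>n<N. sV (a n w) (t n))" if "\<And>n. N \<le> n \<Longrightarrow> a n w = 0" for w N
    unfolding \<Phi>_def using that by (intro sum.mono_neutral_left) (auto intro: ccontr simp: linorder_not_less)
  have bound: "\<exists>N. \<forall>n\<ge>N. a n w = 0" for w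
    using assms(4)[of w] unfolding finite_nat_set_iff_bounded
    by (metis (mono_tags, lifting) leD mem_Collect_eq)
  have "Vector_Spaces.linear sW sV \<Phi>"
    unfolding Vector_Spaces.linear_iff
  proof (intro conjI allI assms)
    fix x y
    obtain M N where M: "\<forall>n\<ge>M. a n x = 0" and N: "\<forall>n\<ge>N. a n y = 0" using bound by metis
    let ?K = "max M N"
    have "\<Phi> (x + y) = (\<Sum>n<?K. sV (a n (x + y)) (t n))"
      using M N by (intro \<Phi>) (simp add: W.functional_add[OF assms(3)])
    also have "\<dots> = (\<Sum>n<?K. sV (a n x) (t n)) + (\<Sum>n<?K. sV (a n y) (t n))"
      by (simp add: W.functional_add[OF assms(3)] V.scale_left_distrib sum.distrib)
    also have "\<dots> = \<Phi> x + \<Phi> y" using M N by (subst (1 2) \<Phi>[of ?K]) auto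
    finally show "\<Phi> (x + y) = \<Phi> x + \<Phi> y" .
  next
    fix c x
    obtain M where M: "\<forall>n\<ge>M. a n x = 0" using bound by metis
    have "\<Phi> (sW c x) = (\<Sum>n<M. sV (a n (sW c x)) (t n))"
      using M by (intro \<Phi>) (simp add: W.functional_scale[OF assms(3)])
    also have "\<dots> = sV c (\<Phi> x)"
      using M by (subst \<Phi>[of M]) (auto simp: W.functional_scale[OF assms(3)] V.scale_sum_right)
    finally show "\<Phi> (sW c x) = sV c (\<Phi> x)" .
  qed
  then show ?thesis using \<Phi> by blast
qed

text \<open>Here every layer may stay coordinate times squares. The coordinates need slots of their
  own in order to be named, so they are interleaved with the functionals
  \<open>\<mu>\<close>.\<close>

lemma embed_infinite_rank:
  assumes "cubic_form sV F" "cubic_form.nondeg sV F" "\<And>r. \<exists>y. cubic_form.indep_mod_small sV F y r"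
    and "cubic_form_coords sW G b \<beta>"
  shows "\<exists>\<Phi>. Vector_Spaces.linear sW sV \<Phi> \<and> (\<forall>w. F (\<Phi> w) (\<Phi> w) (\<Phi> w) = G w w w)"
proof -
  interpret V: cubic_form sV F by fact
  interpret W: cubic_form_coords sW G b \<beta> by fact
  let ?i = "\<lambda>m. fst (prod_decode m)"
  obtain \<kappa> \<mu> where \<mu>: "\<And>m. W.functional (\<mu> m)" "\<And>v. finite {m. \<mu> m v \<noteq> 0}"
    "\<And>v. G v v v = (\<Sum>m | \<mu> m v \<noteq> 0. \<kappa> m * \<beta> (?i m) v * \<mu> m v ^ 2)"
    using W.cubic_decomposition[of UNIV] by auto
  \<comment> \<open>Even slot \<open>2 * i\<close> holds \<open>\<beta> i\<close> with coefficient 0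
    and adds nothing to the cubic; odd slot \<open>2 * m + 1\<close> holds \<open>\<mu> m\<close>
    and names the slot of its coordinate, an earlier one because the first component of
    \<open>prod_decode m\<close> is at most \<open>m\<close>.\<close>
  define \<iota> where "\<iota> n = (if even n then n else 2 * ?i (n div 2))" for n
  define k where "k n = (if even n then 0 else \<kappa> (n div 2))" for n
  define a where "a n w = (if even n then \<beta> (n div 2) w else \<mu> (n div 2) w)" for n w
  have \<iota>_le: "\<iota> n \<le> n" for n
  proof -
    have "?i (n div 2) \<le> n div 2"
      using le_prod_encode_1[of "?i (n div 2)" "snd (prod_decode (n div 2))"] by simp
    then show ?thesis by (auto simp: \<iota>_def)
  qed
  obtain t where t: "\<forall>n. (\<forall>i<n. \<forall>j<n. F (t i) (t j) (t n) = 0) \<and>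
    (\<forall>i\<le>n. F (t i) (t n) (t n) = (if i = \<iota> n then k n / (if \<iota> n = n then 1 else 3) else 0))"
    using V.normal_sequence_infinite[OF assms(2,3), of \<iota> "\<lambda>n. k n / (if \<iota> n = n then 1 else 3)"] by blast
  have bound: "\<exists>N. \<forall>n\<ge>N. \<beta> n w = 0 \<and> \<mu> n w = 0" for w
  proof -
    obtain M where M: "\<forall>n\<ge>M. \<beta> n w = 0" using W.coords_exhaust by blast
    obtain N where N: "\<forall>n\<in>{m. \<mu> m w \<noteq> 0}. n < N" using \<mu>(2) finite_nat_set_iff_bounded by blast
    show ?thesis using M N by (intro exI[of _ "max M N"]) (auto simp: leD)
  qed
  have fa: "W.functional (a n)" for n
    by (cases "even n") (simp_all add: a_def[abs_def] \<mu>(1) W.functional_coord)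
  have fin: "finite {n. a n w \<noteq> 0}" for w
  proof -
    obtain N where N: "\<forall>n\<ge>N. \<beta> n w = 0 \<and> \<mu> n w = 0" using bound by blast
    have "{n. a n w \<noteq> 0} \<subseteq> {..<2 * N}"
    proof
      fix n assume "n \<in> {n. a n w \<noteq> 0}"
      then show "n \<in> {..<2 * N}" using N by (cases "2 * N \<le> n") (auto simp: a_def split: if_splits)
    qed
    then show ?thesis by (rule finite_subset) simp
  qed
  obtain \<Phi> where \<Phi>: "Vector_Spaces.linear sW sV \<Phi>"
    "\<And>w N. (\<forall>n\<ge>N. a n w = 0) \<Longrightarrow> \<Phi> w = (\<Sum>n<N. sV (a n w) (t n))"
    using locally_finite_combination[of sV sW a t, OF V.vector_space_axioms W.vector_space_axioms fa fin] by blast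
  have "F (\<Phi> w) (\<Phi> w) (\<Phi> w) = G w w w" for w
  proof -
    obtain N where N: "\<forall>n\<ge>N. \<beta> n w = 0 \<and> \<mu> n w = 0" using bound by blast
    have "\<Phi> w = (\<Sum>n<2 * N. sV (a n w) (t n))" using N by (intro \<Phi>(2)) (auto simp: a_def)
    then have "F (\<Phi> w) (\<Phi> w) (\<Phi> w) = (\<Sum>n\<in>{0..<2 * N}. k n * a (\<iota> n) w * a n w ^ 2)"
      using V.normal_sequence_cube[of 0 t \<iota> k "2 * N" "\<lambda>n. a n w"] t \<iota>_le by (simp add: V.F_simps Let_def)
    also have "\<dots> = (\<Sum>m<N. \<kappa> m * \<beta> (?i m) w * \<mu> m w ^ 2)"
      by (induction N) (simp_all add: k_def a_def \<iota>_def)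
    also have "\<dots> = (\<Sum>m | \<mu> m w \<noteq> 0. \<kappa> m * \<beta> (?i m) w * \<mu> m w ^ 2)"
      using N by (intro sum.mono_neutral_right) (auto intro: ccontr simp: linorder_not_less)
    finally show ?thesis by (simp add: \<mu>(3))
  qed
  then show ?thesis using \<Phi>(1) by blast
qed

text \<open>The first \<open>s\<close> coordinates go to the independent vectors \<open>y i\<close>.
  The cubic form on the span of these is arbitrary, so its pullback along \<open>Y\<close> is
  subtracted and only the difference \<open>G'\<close> is decomposed.\<close>

lemma embed_finite_rank:
  assumes "cubic_form sV F" "cubic_form.nondeg sV F"
    and "functionals.fin_functionals sV L" "\<And>v. v \<in> functionals.kernel L \<Longrightarrow> cubic_form.small sV F v"
    and "cubic_form.indep_mod_small sV F y s"
    and "cubic_form_coords sW G b \<beta>" "\<And>i. s \<le> i \<Longrightarrow> cubic_form.small sW G (b i)"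
  shows "\<exists>\<Phi>. Vector_Spaces.linear sW sV \<Phi> \<and> (\<forall>w. F (\<Phi> w) (\<Phi> w) (\<Phi> w) = G w w w)"
proof -
  interpret V: cubic_form sV F by fact
  interpret W0: cubic_form_coords sW G b \<beta> by fact
  define Y where "Y w = (\<Sum>i<s. sV (\<beta> i w) (y i))" for w
  have Y_add: "Y (v + w) = Y v + Y w" for v w
    by (simp add: Y_def W0.functional_add[OF W0.functional_coord] V.scale_left_distrib sum.distrib)
  have Y_scale: "Y (sW c w) = sV c (Y w)" for c w
    by (simp add: Y_def W0.functional_scale[OF W0.functional_coord] V.scale_sum_right)
  define G' where "G' u v w = G u v w - F (Y u) (Y v) (Y w)" for u v w
  interpret W: cubic_form_coords sW G' b \<beta>
  proof unfold_locales
    fix x x' y' z c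
    show "G' (x + x') y' z = G' x y' z + G' x' y' z"
      by (simp add: G'_def W0.F_simps V.F_simps Y_add)
    show "G' (sW c x) y' z = c * G' x y' z"
      by (simp add: G'_def W0.F_simps V.F_simps Y_scale algebra_simps)
    show "G' x y' z = G' y' x z" "G' x y' z = G' x z y'"
      using W0.F_swap12 W0.F_swap23 V.F_swap12 V.F_swap23 by (simp_all add: G'_def)
  qed (use V.alg_closed V.two_nonzero V.three_nonzero W0.functional_coord W0.coords_exhaust in auto)
  \<comment> \<open>\<open>Y\<close> vanishes where the first \<open>s\<close> coordinates do, a
    subspace of finite codimension, so smallness of \<open>b i\<close> passes from \<open>G\<close>
    to \<open>G'\<close>.\<close>
  have small: "W.small (b i)" if "i \<notin> {..<s}" for i
  proof -
    obtain M where M: "W0.fin_functionals M" "\<forall>v\<in>W0.kernel M. G (b i) v v = 0"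
      using assms(7)[of i] \<open>i \<notin> {..<s}\<close> unfolding W0.small_def by auto
    let ?M = "M \<union> \<beta> ` {..<s}"
    have "W0.fin_functionals ?M" using M(1) by (auto intro!: W0.fin_functionals_image W0.functional_coord)
    moreover have "G' (b i) v v = 0" if "v \<in> W0.kernel ?M" for v
    proof -
      have "Y v = 0" using that by (simp add: Y_def W0.kernel_image)
      moreover have "G (b i) v v = 0" using that M(2) by simp
      ultimately show ?thesis by (simp add: G'_def V.F_simps)
    qed
    ultimately show ?thesis unfolding W.small_def by blast
  qed
  let ?i = "\<lambda>m. fst (prod_decode m)"
  obtain \<kappa> \<mu> where \<mu>: "\<And>m. W0.functional (\<mu> m)" "\<And>v. finite {m. \<mu> m v \<noteq> 0}"
    "\<And>v. G' v v v = (\<Sum>m | \<mu> m v \<noteq> 0. \<kappa> m * (if ?i m < s then \<beta> (?i m) v else \<mu> m v) * \<mu> m v ^ 2)"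
    using W.cubic_decomposition[of "{..<s}", OF small] by auto
  \<comment> \<open>Slots below \<open>s\<close> hold coordinates and slot \<open>s + m\<close>
    holds \<open>\<mu> m\<close>; it names its coordinate if the layer index is below
    \<open>s\<close>, and itself otherwise.\<close>
  define \<iota> where "\<iota> n = (if ?i (n - s) < s then ?i (n - s) else n)" for n
  define k where "k n = \<kappa> (n - s)" for n
  define a where "a n w = (if n < s then \<beta> n w else \<mu> (n - s) w)" for n w
  obtain t where t: "\<forall>i<s. t i = y i" "\<forall>n\<ge>s. (\<forall>i<n. \<forall>j<n. F (t i) (t j) (t n) = 0) \<and>
    (\<forall>i\<le>n. F (t i) (t n) (t n) = (if i = \<iota> n then k n / (if \<iota> n = n then 1 else 3) else 0))"
    using V.normal_sequence_finite[OF assms(2-5), of \<iota> "\<lambda>n. k n / (if \<iota> n = n then 1 else 3)"]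
    unfolding \<iota>_def by (smt (verit))
  have bound: "\<exists>N. \<forall>n\<ge>N. \<mu> n w = 0" for w
  proof -
    obtain N where N: "\<forall>n\<in>{m. \<mu> m w \<noteq> 0}. n < N" using \<mu>(2) finite_nat_set_iff_bounded by blast
    show ?thesis using N by (intro exI[of _ N]) (auto simp: leD)
  qed
  have fa: "W0.functional (a n)" for n
    by (cases "n < s") (simp_all add: a_def[abs_def] \<mu>(1) W0.functional_coord)
  have a0: "\<forall>n\<ge>s + N. a n w = 0" if "\<forall>n\<ge>N. \<mu> n w = 0" for w N
    using that by (auto simp: a_def)
  have fin: "finite {n. a n w \<noteq> 0}" for w
  proof -
    obtain N where N: "\<forall>n\<ge>N. \<mu> n w = 0" using bound by blast
    have "{n. a n w \<noteq> 0} \<subseteq> {..<s + N}" using a0[OF N] by (auto intro: ccontr simp: linorder_not_less)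
    then show ?thesis by (rule finite_subset) simp
  qed
  obtain \<Phi> where \<Phi>: "Vector_Spaces.linear sW sV \<Phi>"
    "\<And>w N. (\<forall>n\<ge>N. a n w = 0) \<Longrightarrow> \<Phi> w = (\<Sum>n<N. sV (a n w) (t n))"
    using locally_finite_combination[of sV sW a t, OF V.vector_space_axioms W0.vector_space_axioms fa fin] by blast
  have "F (\<Phi> w) (\<Phi> w) (\<Phi> w) = G w w w" for w
  proof -
    obtain N where N: "\<forall>n\<ge>N. \<mu> n w = 0" using bound by blast
    have \<Phi>w: "\<Phi> w = (\<Sum>n<s + N. sV (a n w) (t n))" using a0[OF N] by (rule \<Phi>(2))
    have Yw: "(\<Sum>n<s. sV (a n w) (t n)) = Y w"
      unfolding Y_def using t(1) by (intro sum.cong) (auto simp: a_def)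
    have "F (\<Phi> w) (\<Phi> w) (\<Phi> w) = F (Y w) (Y w) (Y w) + (\<Sum>n\<in>{s..<s + N}. k n * a (\<iota> n) w * a n w ^ 2)"
      using V.normal_sequence_cube[of s t \<iota> k "s + N" "\<lambda>n. a n w"] t(2)
      by (simp add: Yw \<Phi>w Let_def \<iota>_def)
    also have "(\<Sum>n\<in>{s..<s + N}. k n * a (\<iota> n) w * a n w ^ 2) =
        (\<Sum>m<N. k (s + m) * a (\<iota> (s + m)) w * a (s + m) w ^ 2)"
      using sum.shift_bounds_nat_ivl[of "\<lambda>n. k n * a (\<iota> n) w * a n w ^ 2" 0 s N]
      by (simp add: add.commute lessThan_atLeast0)
    also have "\<dots> = (\<Sum>m<N. \<kappa> m * (if ?i m < s then \<beta> (?i m) w else \<mu> m w) * \<mu> m w ^ 2)"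
      by (intro sum.cong) (auto simp: k_def a_def \<iota>_def)
    also have "\<dots> = (\<Sum>m | \<mu> m w \<noteq> 0. \<kappa> m * (if ?i m < s then \<beta> (?i m) w else \<mu> m w) * \<mu> m w ^ 2)"
      using N by (intro sum.mono_neutral_right) (auto intro: ccontr simp: linorder_not_less)
    also have "\<dots> = G' w w w" by (simp add: \<mu>(3))
    finally show ?thesis by (simp add: G'_def)
  qed
  then show ?thesis using \<Phi>(1) by blast
qed

section \<open>Polarisation of formal polynomials\<close>

definition monomials :: "'i set \<Rightarrow> nat \<Rightarrow> 'i multiset set" where
  "monomials S n = {m. size m = n \<and> set_mset m \<subseteq> S}"

text \<open>Ordered monomials. A sum over words unfolds into nested sums over single indices, as in
  a multilinear form, whereas \<open>peval\<close> sums over multisets.\<close>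

definition words :: "'i set \<Rightarrow> nat \<Rightarrow> 'i list set" where
  "words S n = {xs. set xs \<subseteq> S \<and> length xs = n}"

lemma finite_words: "finite S \<Longrightarrow> finite (words S n)"
  unfolding words_def by (rule finite_lists_length_eq)

lemma mset_image_words: "mset ` words S n = monomials S n"
proof (intro equalityI subsetI)
  fix m assume "m \<in> monomials S n"
  moreover obtain xs where "mset xs = m" using ex_mset by blast
  ultimately show "m \<in> mset ` words S n" by (auto simp: monomials_def words_def)
qed (auto simp: monomials_def words_def)

lemma finite_monomials: "finite S \<Longrightarrow> finite (monomials S n)"
  unfolding mset_image_words[symmetric] by (intro finite_imageI finite_words)

lemma sum_words_0: "(\<Sum>xs\<in>words S 0. h xs) = h []"
proof -
  have "words S 0 = {[]}" by (auto simp: words_def)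
  then show ?thesis by simp
qed

lemma sum_words_Suc:
  "finite S \<Longrightarrow> (\<Sum>xs\<in>words S (Suc n). h xs) = (\<Sum>i\<in>S. \<Sum>xs\<in>words S n. h (i # xs))"
proof -
  assume "finite S"
  have eq: "words S (Suc n) = (\<lambda>(i, xs). i # xs) ` (S \<times> words S n)"
    by (force simp: words_def length_Suc_conv)
  have "inj_on (\<lambda>(i, xs). i # xs) (S \<times> words S n)" by (auto simp: inj_on_def)
  then have "(\<Sum>xs\<in>words S (Suc n). h xs) = (\<Sum>(i, xs)\<in>S \<times> words S n. h (i # xs))"
    unfolding eq by (subst sum.reindex) (auto simp: case_prod_unfold)
  then show ?thesis by (simp add: sum.cartesian_product)
qed

lemma prod_mset_eq_0: "i \<in># m \<Longrightarrow> v i = (0::'k::field) \<Longrightarrow> prod_mset (image_mset v m) = 0"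
  by (metis image_eqI prod_mset_zero_iff set_image_mset)

lemma peval_monomials:
  assumes "f \<in> hpoly I n" "finite S" "{i. v i \<noteq> 0} \<subseteq> S"
  shows "peval f v = (\<Sum>m\<in>monomials S n. f m * prod_mset (image_mset v m))"
  unfolding peval_def
proof (rule sum.mono_neutral_left)
  show "finite (monomials S n)" using assms(2) by (rule finite_monomials)
  show "{m. f m \<noteq> 0 \<and> set_mset m \<subseteq> {i. v i \<noteq> 0}} \<subseteq> monomials S n"
    using assms by (auto simp: hpoly_def monomials_def)
  show "\<forall>m\<in>monomials S n - {m. f m \<noteq> 0 \<and> set_mset m \<subseteq> {i. v i \<noteq> 0}}.
    f m * prod_mset (image_mset v m) = 0"
    using prod_mset_eq_0[of _ _ v] by (auto simp: subset_iff)
qed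

text \<open>Group the words by their multiset: however the coefficient of a monomial is distributed
  over its orderings, the value is the same. Symmetric and non-symmetric choices of \<open>h\<close>
  both occur later.\<close>

lemma peval_words:
  assumes "f \<in> hpoly I n" "\<And>m. size m = n \<Longrightarrow> f m = (\<Sum>xs\<in>permutations_of_multiset m. h xs)"
    and "finite S" "{i. v i \<noteq> 0} \<subseteq> S"
  shows "peval f v = (\<Sum>xs\<in>words S n. h xs * prod_list (map v xs))"
proof -
  have "(\<Sum>xs\<in>words S n. h xs * prod_list (map v xs)) =
    (\<Sum>m\<in>mset ` words S n. \<Sum>xs | xs \<in> words S n \<and> mset xs = m. h xs * prod_list (map v xs))"
    by (rule sum.image_gen[OF finite_words[OF assms(3)]])
  also have "\<dots> = (\<Sum>m\<in>monomials S n. f m * prod_mset (image_mset v m))"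
    unfolding mset_image_words
  proof (rule sum.cong[OF refl])
    fix m assume m: "m \<in> monomials S n"
    have "{xs. xs \<in> words S n \<and> mset xs = m} = permutations_of_multiset m"
      using m by (auto simp: words_def monomials_def permutations_of_multiset_def)
    moreover have "prod_list (map v xs) = prod_mset (image_mset v m)"
      if "xs \<in> permutations_of_multiset m" for xs
      using that by (metis mset_map permutations_of_multisetD prod_mset_prod_list)
    ultimately show "(\<Sum>xs | xs \<in> words S n \<and> mset xs = m. h xs * prod_list (map v xs)) =
        f m * prod_mset (image_mset v m)"
      using m assms(2)[of m] by (simp add: sum_distrib_right monomials_def)
  qed
  finally show ?thesis using peval_monomials[OF assms(1,3,4)] by simp
qed

lemma hpoly_sum:
  assumes "\<And>j. j < (s::nat) \<Longrightarrow> f j \<in> hpoly I n"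
  shows "(\<lambda>m. \<Sum>j<s. f j m) \<in> hpoly I n"
  unfolding hpoly_def mem_Collect_eq
proof (intro allI impI)
  fix m assume "(\<Sum>j<s. f j m) \<noteq> 0"
  then obtain j where "j < s" "f j m \<noteq> 0"
    using sum.not_neutral_contains_not_neutral by (metis lessThan_iff)
  then show "size m = n \<and> set_mset m \<subseteq> I" using assms[of j] by (simp add: hpoly_def)
qed

lemma peval_sum:
  assumes "\<And>j. j < s \<Longrightarrow> f j \<in> hpoly I n" "finite {i. v i \<noteq> 0}"
  shows "peval (\<lambda>m. \<Sum>j<s. f j m) v = (\<Sum>j<(s::nat). peval (f j) v)"
proof -
  have h: "(\<lambda>m. \<Sum>j<s. f j m) \<in> hpoly I n"
    by (rule hpoly_sum[OF assms(1)])
  have "(\<Sum>j<s. peval (f j) v) =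
      (\<Sum>j<s. \<Sum>m\<in>monomials {i. v i \<noteq> 0} n. f j m * prod_mset (image_mset v m))"
    by (intro sum.cong refl peval_monomials[OF assms(1) assms(2)]) auto
  also have "\<dots> = (\<Sum>m\<in>monomials {i. v i \<noteq> 0} n. (\<Sum>j<s. f j m) * prod_mset (image_mset v m))"
    unfolding sum_distrib_right by (rule sum.swap)
  also have "\<dots> = peval (\<lambda>m. \<Sum>j<s. f j m) v"
    using peval_monomials[OF h assms(2)] by simp
  finally show ?thesis by simp
qed

lemma hpoly_pmul:
  assumes "g \<in> hpoly I a" "h \<in> hpoly I b"
  shows "pmul g h \<in> hpoly I (a + b)"
  unfolding hpoly_def mem_Collect_eq
proof (intro allI impI)
  fix m assume "pmul g h m \<noteq> 0"
  then obtain x where x: "x \<subseteq># m" "g x * h (m - x) \<noteq> 0"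
    unfolding pmul_def by (metis (mono_tags, lifting) mem_Collect_eq sum.neutral)
  then have "size x = a" "set_mset x \<subseteq> I" "size (m - x) = b" "set_mset (m - x) \<subseteq> I"
    using assms by (auto simp: hpoly_def)
  moreover have "m = x + (m - x)" using x(1) by simp
  ultimately show "size m = a + b \<and> set_mset m \<subseteq> I"
    by (metis set_mset_union size_union sup.bounded_iff)
qed

lemma peval_pmul:
  assumes "g \<in> hpoly I a" "h \<in> hpoly I b" "finite {i. v i \<noteq> 0}"
  shows "peval (pmul g h) v = peval g v * peval h v"
proof -
  let ?S = "{i. v i \<noteq> 0}"
  let ?A = "monomials ?S a" and ?B = "monomials ?S b" and ?M = "monomials ?S (a + b)"
  let ?v = "\<lambda>m. prod_mset (image_mset v m)"
  have "peval g v * peval h v = (\<Sum>(x, y)\<in>?A \<times> ?B. g x * h y * ?v (x + y))"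
    using peval_monomials[OF assms(1,3)] peval_monomials[OF assms(2,3)]
    by (simp add: sum_product sum.cartesian_product case_prod_unfold mult_ac)
  also have "\<dots> = (\<Sum>m\<in>?M. \<Sum>p | p \<in> ?A \<times> ?B \<and> fst p + snd p = m. g (fst p) * h (snd p) * ?v (fst p + snd p))"
    unfolding case_prod_unfold
    by (rule sum.group[symmetric], intro finite_cartesian_product finite_monomials assms(3),
        intro finite_monomials assms(3)) (auto simp: monomials_def)
  also have "\<dots> = (\<Sum>m\<in>?M. pmul g h m * ?v m)"
  proof (rule sum.cong[OF refl])
    fix m assume m: "m \<in> ?M"
    have sub: "{x. x \<subseteq># m \<and> x \<in> ?A} \<subseteq> {x. x \<subseteq># m}" by auto
    have "{x. x \<subseteq># m} \<subseteq> (\<Union>k\<le>size m. monomials (set_mset m) k)"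
      by (auto simp: monomials_def size_mset_mono dest: mset_subset_eqD)
    then have fin: "finite {x. x \<subseteq># m}" by (rule finite_subset) (auto intro: finite_monomials)
    have eq: "{p. p \<in> ?A \<times> ?B \<and> fst p + snd p = m} = (\<lambda>x. (x, m - x)) ` {x. x \<subseteq># m \<and> x \<in> ?A}"
    proof (intro equalityI subsetI)
      fix p assume "p \<in> (\<lambda>x. (x, m - x)) ` {x. x \<subseteq># m \<and> x \<in> ?A}"
      then obtain x where x: "p = (x, m - x)" "x \<subseteq># m" "x \<in> ?A" by auto
      then have "m - x \<in> ?B" using m by (auto simp: monomials_def size_Diff_submset dest: in_diffD)
      then show "p \<in> {p. p \<in> ?A \<times> ?B \<and> fst p + snd p = m}" using x by simp
    qed force
    have "(\<Sum>p | p \<in> ?A \<times> ?B \<and> fst p + snd p = m. g (fst p) * h (snd p) * ?v (fst p + snd p)) =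
        (\<Sum>x | x \<subseteq># m \<and> x \<in> ?A. g x * h (m - x) * ?v m)"
      unfolding eq by (subst sum.reindex) (auto simp: inj_on_def simp del: image_mset_union intro!: sum.cong)
    \<comment> \<open>\<open>pmul\<close> runs over all submultisets, but \<open>g\<close> is zero
      on those of the wrong size.\<close>
    also have "\<dots> = (\<Sum>x | x \<subseteq># m. g x * h (m - x) * ?v m)"
    proof (rule sum.mono_neutral_left[OF fin sub], intro ballI)
      fix x assume x: "x \<in> {x. x \<subseteq># m} - {x. x \<subseteq># m \<and> x \<in> ?A}"
      then have "set_mset x \<subseteq> ?S" using m set_mset_mono by (fastforce simp: monomials_def)
      then have "size x \<noteq> a" using x by (simp add: monomials_def)
      then have "g x = 0" using assms(1) by (auto simp: hpoly_def)
      then show "g x * h (m - x) * ?v m = 0" by simp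
    qed
    also have "\<dots> = pmul g h m * ?v m" by (simp add: pmul_def sum_distrib_right)
    finally show "(\<Sum>p | p \<in> ?A \<times> ?B \<and> fst p + snd p = m. g (fst p) * h (snd p) * ?v (fst p + snd p))
      = pmul g h m * ?v m" .
  qed
  also have "\<dots> = peval (pmul g h) v"
    using peval_monomials[OF hpoly_pmul[OF assms(1,2)] assms(3)] by simp
  finally show ?thesis by simp
qed

text \<open>Lets the argument run on all finitely supported functions on the index type and return
  to \<open>vecs I\<close> only at the end.\<close>

lemma peval_restrict:
  assumes "f \<in> hpoly I n"
  shows "peval f (\<lambda>i. if i \<in> I then v i else 0) = peval f v"
proof -
  have "{m. f m \<noteq> 0 \<and> set_mset m \<subseteq> {i. (if i \<in> I then v i else 0) \<noteq> 0}} = {m. f m \<noteq> 0 \<and> set_mset m \<subseteq> {i. v i \<noteq> 0}}"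
    using assms by (auto simp: hpoly_def subset_iff)
  moreover have "image_mset (\<lambda>i. if i \<in> I then v i else 0) m = image_mset v m" if "f m \<noteq> 0" for m
    using assms that by (intro image_mset_cong) (auto simp: hpoly_def)
  ultimately show ?thesis unfolding peval_def by (intro sum.cong) auto
qed

section \<open>Finitely supported functions and their trilinear forms\<close>

definition pm_scale :: "'k::field \<Rightarrow> ('i \<Rightarrow>\<^sub>0 'k) \<Rightarrow> ('i \<Rightarrow>\<^sub>0 'k)" where
  "pm_scale c = Poly_Mapping.map ((*) c)"

lemma lookup_pm_scale [simp]: "Poly_Mapping.lookup (pm_scale c v) i = c * Poly_Mapping.lookup v i"
  by (simp add: pm_scale_def Poly_Mapping.map.rep_eq when_def)

lemma vector_space_pm_scale: "vector_space (pm_scale :: 'k::field \<Rightarrow> ('i \<Rightarrow>\<^sub>0 'k) \<Rightarrow> _)"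
  by unfold_locales (auto intro!: poly_mapping_eqI simp: lookup_add algebra_simps)

interpretation pm: functionals "pm_scale :: 'k::field \<Rightarrow> ('i \<Rightarrow>\<^sub>0 'k) \<Rightarrow> _"
  using vector_space_pm_scale by (simp add: functionals_def)

abbreviation unit_vec :: "'i \<Rightarrow> ('i \<Rightarrow>\<^sub>0 'k::field)" where
  "unit_vec i \<equiv> Poly_Mapping.single i 1"

lemma poly_mapping_unit_vec_sum:
  assumes "finite S" "Poly_Mapping.keys v \<subseteq> S"
  shows "v = (\<Sum>i\<in>S. pm_scale (Poly_Mapping.lookup v i) (unit_vec i))"
proof (rule poly_mapping_eqI)
  fix k
  have "Poly_Mapping.lookup (\<Sum>i\<in>S. pm_scale (Poly_Mapping.lookup v i) (unit_vec i)) k = (\<Sum>i\<in>S. if i = k then Poly_Mapping.lookup v k else 0)"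
    unfolding lookup_sum by (intro sum.cong) (auto simp: lookup_single when_def)
  then show "Poly_Mapping.lookup v k = Poly_Mapping.lookup (\<Sum>i\<in>S. pm_scale (Poly_Mapping.lookup v i) (unit_vec i)) k"
    using assms by (auto simp: in_keys_iff)
qed

definition trilinear :: "('i \<Rightarrow> 'i \<Rightarrow> 'i \<Rightarrow> 'k::field) \<Rightarrow> ('i \<Rightarrow>\<^sub>0 'k) \<Rightarrow> ('i \<Rightarrow>\<^sub>0 'k) \<Rightarrow> ('i \<Rightarrow>\<^sub>0 'k) \<Rightarrow> 'k" where
  "trilinear T u v w = (\<Sum>i\<in>Poly_Mapping.keys u. \<Sum>j\<in>Poly_Mapping.keys v. \<Sum>k\<in>Poly_Mapping.keys w.
    T i j k * (Poly_Mapping.lookup u i * Poly_Mapping.lookup v j * Poly_Mapping.lookup w k))"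

lemma trilinear_superset:
  assumes "finite S" "Poly_Mapping.keys u \<subseteq> S" "Poly_Mapping.keys v \<subseteq> S" "Poly_Mapping.keys w \<subseteq> S"
  shows "trilinear T u v w = (\<Sum>i\<in>S. \<Sum>j\<in>S. \<Sum>k\<in>S. T i j k * (Poly_Mapping.lookup u i * Poly_Mapping.lookup v j * Poly_Mapping.lookup w k))"
proof -
  have "trilinear T u v w = (\<Sum>i\<in>Poly_Mapping.keys u. \<Sum>j\<in>Poly_Mapping.keys v. \<Sum>k\<in>S. T i j k * (Poly_Mapping.lookup u i * Poly_Mapping.lookup v j * Poly_Mapping.lookup w k))"
    unfolding trilinear_def using assms
    by (intro sum.cong refl sum.mono_neutral_left) (auto simp: in_keys_iff)
  also have "\<dots> = (\<Sum>i\<in>Poly_Mapping.keys u. \<Sum>j\<in>S. \<Sum>k\<in>S. T i j k * (Poly_Mapping.lookup u i * Poly_Mapping.lookup v j * Poly_Mapping.lookup w k))"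
    using assms by (intro sum.cong refl sum.mono_neutral_left) (auto simp: in_keys_iff)
  also have "\<dots> = (\<Sum>i\<in>S. \<Sum>j\<in>S. \<Sum>k\<in>S. T i j k * (Poly_Mapping.lookup u i * Poly_Mapping.lookup v j * Poly_Mapping.lookup w k))"
    using assms by (intro sum.mono_neutral_left) (auto simp: in_keys_iff)
  finally show ?thesis .
qed

lemma cubic_form_trilinear:
  fixes T :: "'i \<Rightarrow> 'i \<Rightarrow> 'i \<Rightarrow> 'k::field"
  assumes "alg_closed TYPE('k)" "(2::'k) \<noteq> 0" "(3::'k) \<noteq> 0"
    and "\<And>i j k. T i j k = T j i k" "\<And>i j k. T i j k = T i k j"
  shows "cubic_form pm_scale (trilinear T)"
proof unfold_locales
  fix x x' y z :: "'i \<Rightarrow>\<^sub>0 'k" and c :: 'k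
  let ?S = "Poly_Mapping.keys x \<union> Poly_Mapping.keys x' \<union> Poly_Mapping.keys y \<union> Poly_Mapping.keys z"
  have S: "finite ?S" "Poly_Mapping.keys x \<subseteq> ?S" "Poly_Mapping.keys x' \<subseteq> ?S" "Poly_Mapping.keys y \<subseteq> ?S" "Poly_Mapping.keys z \<subseteq> ?S" by auto
  have sum: "Poly_Mapping.keys (x + x') \<subseteq> ?S" using keys_add[of x x'] by auto
  have sc: "Poly_Mapping.keys (pm_scale c x) \<subseteq> ?S" by (auto simp: in_keys_iff)
  show "trilinear T (x + x') y z = trilinear T x y z + trilinear T x' y z"
    unfolding trilinear_superset[OF S(1) sum S(4,5)] trilinear_superset[OF S(1,2,4,5)]
      trilinear_superset[OF S(1,3,4,5)]
    by (simp add: lookup_add algebra_simps sum.distrib)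
  show "trilinear T (pm_scale c x) y z = c * trilinear T x y z"
    unfolding trilinear_superset[OF S(1) sc S(4,5)] trilinear_superset[OF S(1,2,4,5)]
    by (simp add: sum_distrib_left mult_ac)
  show "trilinear T x y z = trilinear T y x z"
    unfolding trilinear_superset[OF S(1,2,4,5)] trilinear_superset[OF S(1,4,2,5)]
    by (subst sum.swap) (simp add: assms(4) mult_ac)
  show "trilinear T x y z = trilinear T x z y"
    unfolding trilinear_superset[OF S(1,2,4,5)] trilinear_superset[OF S(1,2,5,4)]
    by (rule sum.cong[OF refl], subst sum.swap) (simp add: assms(5) mult_ac)
qed (use assms in auto)

text \<open>The coefficient is shared equally among the orderings of its monomial, which makes the
  polarisation symmetric.\<close>

definition polar_coeff :: "('i multiset \<Rightarrow> 'k::field) \<Rightarrow> 'i multiset \<Rightarrow> 'k" where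
  "polar_coeff f m = f m / of_nat (card (permutations_of_multiset m))"

definition polarization :: "('i multiset \<Rightarrow> 'k::field) \<Rightarrow> ('i \<Rightarrow>\<^sub>0 'k) \<Rightarrow> ('i \<Rightarrow>\<^sub>0 'k) \<Rightarrow> ('i \<Rightarrow>\<^sub>0 'k) \<Rightarrow> 'k" where
  "polarization f = trilinear (\<lambda>i j k. polar_coeff f {#i, j, k#})"

lemma cubic_form_polarization:
  fixes f :: "'i multiset \<Rightarrow> 'k::field"
  assumes "alg_closed TYPE('k)" "(2::'k) \<noteq> 0" "(3::'k) \<noteq> 0"
  shows "cubic_form pm_scale (polarization f)"
  unfolding polarization_def
  by (rule cubic_form_trilinear[OF assms]) (simp_all add: add_mset_commute)

text \<open>The number of orderings divides \<open>fact (size m)\<close>, which is 1, 2 or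
  6.\<close>

lemma card_permutations_nonzero:
  assumes "(2::'k::field) \<noteq> 0" "(3::'k) \<noteq> 0" "size m \<le> 3"
  shows "of_nat (card (permutations_of_multiset m)) \<noteq> (0::'k)"
proof
  assume 0: "of_nat (card (permutations_of_multiset m)) = (0::'k)"
  have "of_nat (fact (size m)) = (0::'k)"
    unfolding card_permutations_of_multiset_aux[of m, symmetric] of_nat_mult 0 by simp
  moreover have "size m = 0 \<or> size m = 1 \<or> size m = 2 \<or> size m = 3" using assms(3) by linarith
  moreover have "(6::'k) = 2 * 3" by simp
  then have "(6::'k) \<noteq> 0" using assms(1,2) by (metis mult_eq_0_iff)
  ultimately show False using assms by (auto simp: fact_numeral)
qed

lemma sum_polar_coeff:
  assumes "(2::'k::field) \<noteq> 0" "(3::'k) \<noteq> 0" "size m \<le> 3"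
  shows "(\<Sum>xs\<in>permutations_of_multiset m. polar_coeff f (mset xs)) = (f m :: 'k)"
proof -
  have "(\<Sum>xs\<in>permutations_of_multiset m. polar_coeff f (mset xs)) =
      (\<Sum>xs\<in>permutations_of_multiset m. polar_coeff f m)"
    by (intro sum.cong) (auto dest: permutations_of_multisetD)
  then show ?thesis using card_permutations_nonzero[OF assms] by (simp add: polar_coeff_def)
qed

lemma peval_polarization:
  fixes f :: "'i multiset \<Rightarrow> 'k::field"
  assumes "(2::'k) \<noteq> 0" "(3::'k) \<noteq> 0" "f \<in> hpoly I 3"
  shows "peval f (Poly_Mapping.lookup v) = polarization f v v v"
proof -
  have "peval f (Poly_Mapping.lookup v) = (\<Sum>xs\<in>words (Poly_Mapping.keys v) 3. polar_coeff f (mset xs) * prod_list (map (Poly_Mapping.lookup v) xs))"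
    by (intro peval_words[OF assms(3)]) (auto simp: in_keys_iff sum_polar_coeff[OF assms(1,2)])
  also have "\<dots> = polarization f v v v"
    by (simp add: numeral_3_eq_3 sum_words_Suc sum_words_0 polarization_def trilinear_def mult_ac)
  finally show ?thesis .
qed

lemma polarization_unit_vec:
  "polarization f (unit_vec i) (unit_vec j) (unit_vec k) = polar_coeff f {#i, j, k#}"
  by (simp add: polarization_def trilinear_def)

lemma hpoly_derivative:
  assumes "f \<in> hpoly I (Suc n)" 
  shows "(\<lambda>m. \<Sum>j<(r::nat). c j * pderiv_at f (idx j) m) \<in> hpoly I n"
proof (rule hpoly_sum[of r "\<lambda>j m. c j * pderiv_at f (idx j) m"])
  fix j assume "j < r"
  have "size m = n \<and> set_mset m \<subseteq> I" if "f (add_mset (idx j) m) \<noteq> 0" for m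
    using assms(1) that unfolding hpoly_def by fastforce
  then show "(\<lambda>m. c j * pderiv_at f (idx j) m) \<in> hpoly I n"
    by (auto simp: hpoly_def pderiv_at_def)
qed

lemma peval_derivative:
  fixes f :: "'i multiset \<Rightarrow> 'k::field"
  assumes "alg_closed TYPE('k)" "(2::'k) \<noteq> 0" "(3::'k) \<noteq> 0" "f \<in> hpoly I 3"
  shows "peval (\<lambda>m. \<Sum>j<(r::nat). c j * pderiv_at f (idx j) m) (Poly_Mapping.lookup v) =
    3 * polarization f (\<Sum>j<r. pm_scale (c j) (unit_vec (idx j))) v v"
proof -
  interpret cubic_form pm_scale "polarization f" by (rule cubic_form_polarization[OF assms(1-3)])
  let ?h = "\<lambda>xs. \<Sum>j<r. c j * (3 * polar_coeff f (add_mset (idx j) (mset xs)))"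
  have coeff: "(\<Sum>xs\<in>permutations_of_multiset m. ?h xs) = (\<Sum>j<r. c j * pderiv_at f (idx j) m)"
    if "size m = 2" for m
  proof -
    have "(\<Sum>xs\<in>permutations_of_multiset m. ?h xs) =
        (\<Sum>xs\<in>permutations_of_multiset m. \<Sum>j<r. c j * (3 * polar_coeff f (add_mset (idx j) m)))"
      by (intro sum.cong) (auto dest: permutations_of_multisetD)
    also have "\<dots> = (\<Sum>j<r. c j * (of_nat (card (permutations_of_multiset m)) * 3 * polar_coeff f (add_mset (idx j) m)))"
      by (simp add: sum_distrib_left mult_ac)
    also have "\<dots> = (\<Sum>j<r. c j * pderiv_at f (idx j) m)"
    proof (intro sum.cong refl arg_cong2[of _ _ _ _ "(*)"])
      fix j
      let ?N = "of_nat (card (permutations_of_multiset (add_mset (idx j) m))) :: 'k"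
      \<comment> \<open>Both sides count the orderings of the enlarged monomial with one occurrence
        of \<open>idx j\<close> marked: the mark sits in one of 3 positions, and the rest is an
        ordering of \<open>m\<close>.\<close>
      have "card (permutations_of_multiset (add_mset (idx j) m)) * (count m (idx j) + 1)
          = 3 * card (permutations_of_multiset m)"
        using card_permutations_of_multiset_insert_aux[of m "idx j"] that by simp
      then have N: "of_nat (card (permutations_of_multiset m)) * 3 = ?N * of_nat (count m (idx j) + 1)"
        by (metis mult.commute of_nat_mult of_nat_numeral)
      have "?N \<noteq> 0" using card_permutations_nonzero[OF assms(2,3), of "add_mset (idx j) m"] that by simp
      then show "of_nat (card (permutations_of_multiset m)) * 3 * polar_coeff f (add_mset (idx j) m)
          = pderiv_at f (idx j) m"
        unfolding polar_coeff_def pderiv_at_def N by simp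
    qed
    finally show ?thesis .
  qed
  have q: "(\<lambda>m. \<Sum>j<r. c j * pderiv_at f (idx j) m) \<in> hpoly I 2"
    using hpoly_derivative[of f I 2 c idx r] assms(4) by simp
  have "peval (\<lambda>m. \<Sum>j<r. c j * pderiv_at f (idx j) m) (Poly_Mapping.lookup v)
      = (\<Sum>xs\<in>words (Poly_Mapping.keys v) 2. ?h xs * prod_list (map (Poly_Mapping.lookup v) xs))"
    using coeff by (intro peval_words[OF q]) (auto simp: in_keys_iff)
  also have "\<dots> = (\<Sum>i\<in>Poly_Mapping.keys v. \<Sum>k\<in>Poly_Mapping.keys v. \<Sum>j<r. 3 * (c j * (polar_coeff f {#idx j, i, k#} * (Poly_Mapping.lookup v i * Poly_Mapping.lookup v k))))"
    by (simp add: numeral_2_eq_2 sum_words_Suc sum_words_0 sum_distrib_left sum_distrib_right mult_ac)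
  also have "\<dots> = (\<Sum>i\<in>Poly_Mapping.keys v. \<Sum>j<r. \<Sum>k\<in>Poly_Mapping.keys v. 3 * (c j * (polar_coeff f {#idx j, i, k#} * (Poly_Mapping.lookup v i * Poly_Mapping.lookup v k))))"
    by (rule sum.cong[OF refl], rule sum.swap)
  also have "\<dots> = (\<Sum>j<r. \<Sum>i\<in>Poly_Mapping.keys v. \<Sum>k\<in>Poly_Mapping.keys v. 3 * (c j * (polar_coeff f {#idx j, i, k#} * (Poly_Mapping.lookup v i * Poly_Mapping.lookup v k))))"
    by (rule sum.swap)
  also have "\<dots> = 3 * (\<Sum>j<r. c j * polarization f (unit_vec (idx j)) v v)"
    by (simp add: polarization_def trilinear_def sum_distrib_left mult_ac)
  finally show ?thesis by (simp add: F_sum1)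
qed

section \<open>Strength and residual rank via polarisation\<close>

definition linear_poly :: "'i set \<Rightarrow> (('i \<Rightarrow>\<^sub>0 'k) \<Rightarrow> 'k) \<Rightarrow> 'i multiset \<Rightarrow> 'k::field" where
  "linear_poly I l m = (if size m = 1 \<and> set_mset m \<subseteq> I
    then \<Sum>xs\<in>permutations_of_multiset m. l (unit_vec (xs ! 0)) else 0)"

text \<open>Summing over orderings accommodates a non-symmetric \<open>B\<close>: a monomial with
  two distinct indices receives both mixed values, a square only one.\<close>

definition quadratic_poly :: "'i set \<Rightarrow> (('i \<Rightarrow>\<^sub>0 'k) \<Rightarrow> ('i \<Rightarrow>\<^sub>0 'k) \<Rightarrow> 'k) \<Rightarrow> 'i multiset \<Rightarrow> 'k::field" where
  "quadratic_poly I B m = (if size m = 2 \<and> set_mset m \<subseteq> I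
    then \<Sum>xs\<in>permutations_of_multiset m. B (unit_vec (xs ! 0)) (unit_vec (xs ! 1)) else 0)"

lemma hpoly_linear_poly: "linear_poly I l \<in> hpoly I 1"
  and hpoly_quadratic_poly: "quadratic_poly I B \<in> hpoly I 2"
  by (auto simp: hpoly_def linear_poly_def quadratic_poly_def)

lemma sum_permutations_restrict:
  "(if set_mset m \<subseteq> I then \<Sum>xs\<in>permutations_of_multiset m. h xs else 0) =
    (\<Sum>xs\<in>permutations_of_multiset m. if set xs \<subseteq> I then h xs else 0)"
proof -
  have "(\<Sum>xs\<in>permutations_of_multiset m. if set xs \<subseteq> I then h xs else 0) =
      (\<Sum>xs\<in>permutations_of_multiset m. if set_mset m \<subseteq> I then h xs else 0)"
    by (intro sum.cong) (auto simp: permutations_of_multiset_def)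
  then show ?thesis by simp
qed

lemma unit_vec_expansion: "(\<Sum>i\<in>Poly_Mapping.keys v. pm_scale (Poly_Mapping.lookup v i) (unit_vec i)) = v"
  using poly_mapping_unit_vec_sum[of "Poly_Mapping.keys v" v] by simp

lemma peval_linear_poly:
  assumes "pm.functional l" "Poly_Mapping.keys v \<subseteq> I"
  shows "peval (linear_poly I l) (Poly_Mapping.lookup v) = l v"
proof -
  have "peval (linear_poly I l) (Poly_Mapping.lookup v) =
      (\<Sum>xs\<in>words (Poly_Mapping.keys v) 1. (if set xs \<subseteq> I then l (unit_vec (xs ! 0)) else 0) * prod_list (map (Poly_Mapping.lookup v) xs))"
    by (intro peval_words[OF hpoly_linear_poly])
      (auto simp: in_keys_iff linear_poly_def sum_permutations_restrict[symmetric])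
  also have "\<dots> = (\<Sum>i\<in>Poly_Mapping.keys v. Poly_Mapping.lookup v i * l (unit_vec i))"
    unfolding One_nat_def using assms(2) by (simp add: sum_words_Suc sum_words_0) (auto intro!: sum.cong)
  also have "\<dots> = l (\<Sum>i\<in>Poly_Mapping.keys v. pm_scale (Poly_Mapping.lookup v i) (unit_vec i))"
    by (simp add: pm.functional_sum[OF assms(1)])
  also have "\<dots> = l v" by (simp only: unit_vec_expansion)
  finally show ?thesis .
qed

lemma peval_quadratic_poly:
  assumes "\<And>x. pm.functional (B x)" "\<And>y. pm.functional (\<lambda>x. B x y)" "Poly_Mapping.keys v \<subseteq> I"
  shows "peval (quadratic_poly I B) (Poly_Mapping.lookup v) = B v v"
proof -
  have "peval (quadratic_poly I B) (Poly_Mapping.lookup v) = (\<Sum>xs\<in>words (Poly_Mapping.keys v) 2.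
      (if set xs \<subseteq> I then B (unit_vec (xs ! 0)) (unit_vec (xs ! 1)) else 0) * prod_list (map (Poly_Mapping.lookup v) xs))"
    by (intro peval_words[OF hpoly_quadratic_poly])
      (auto simp: in_keys_iff quadratic_poly_def sum_permutations_restrict[symmetric])
  also have "\<dots> = (\<Sum>i\<in>Poly_Mapping.keys v. \<Sum>j\<in>Poly_Mapping.keys v. Poly_Mapping.lookup v i * (Poly_Mapping.lookup v j * B (unit_vec i) (unit_vec j)))"
    unfolding numeral_2_eq_2 using assms(3) by (simp add: sum_words_Suc sum_words_0) (auto intro!: sum.cong)
  also have "\<dots> = (\<Sum>i\<in>Poly_Mapping.keys v. Poly_Mapping.lookup v i * B (unit_vec i) v)"
  proof (rule sum.cong[OF refl])
    fix i
    have "(\<Sum>j\<in>Poly_Mapping.keys v. Poly_Mapping.lookup v j * B (unit_vec i) (unit_vec j)) = B (unit_vec i) v"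
      using pm.functional_sum[OF assms(1)[of "unit_vec i"], of "Poly_Mapping.lookup v" unit_vec "Poly_Mapping.keys v"]
      by (simp only: unit_vec_expansion)
    then show "(\<Sum>j\<in>Poly_Mapping.keys v. Poly_Mapping.lookup v i * (Poly_Mapping.lookup v j * B (unit_vec i) (unit_vec j))) = Poly_Mapping.lookup v i * B (unit_vec i) v"
      by (simp add: sum_distrib_left[symmetric])
  qed
  also have "\<dots> = B v v"
    using pm.functional_sum[OF assms(2)[of v], of "Poly_Mapping.lookup v" unit_vec "Poly_Mapping.keys v"]
    by (simp only: unit_vec_expansion)
  finally show ?thesis .
qed

lemma functional_peval:
  assumes "g \<in> hpoly I 1"
  shows "pm.functional (\<lambda>v. peval g (Poly_Mapping.lookup v))"
proof -
  have ev: "peval g (Poly_Mapping.lookup v) = (\<Sum>i\<in>S. g {#i#} * Poly_Mapping.lookup v i)" if "finite S" "Poly_Mapping.keys v \<subseteq> S" for v S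
  proof -
    have "g m = (\<Sum>xs\<in>permutations_of_multiset m. g (mset xs))" if "size m = 1" for m
      using size_1_singleton_mset[OF that] by auto
    then have "peval g (Poly_Mapping.lookup v) = (\<Sum>xs\<in>words S 1. g (mset xs) * prod_list (map (Poly_Mapping.lookup v) xs))"
      using that by (intro peval_words[OF assms]) (auto simp: in_keys_iff)
    then show ?thesis unfolding One_nat_def using that by (simp add: sum_words_Suc sum_words_0)
  qed
  show ?thesis
  proof (rule pm.functionalI)
    fix x y :: "'a \<Rightarrow>\<^sub>0 'b"
    let ?S = "Poly_Mapping.keys x \<union> Poly_Mapping.keys y"
    have S: "finite ?S" "Poly_Mapping.keys x \<subseteq> ?S" "Poly_Mapping.keys y \<subseteq> ?S" "Poly_Mapping.keys (x + y) \<subseteq> ?S" using keys_add[of x y] by auto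
    show "peval g (Poly_Mapping.lookup (x + y)) = peval g (Poly_Mapping.lookup x) + peval g (Poly_Mapping.lookup y)"
      unfolding ev[OF S(1,2)] ev[OF S(1,3)] ev[OF S(1,4)] by (simp add: lookup_add algebra_simps sum.distrib)
  next
    fix c :: 'b and x :: "'a \<Rightarrow>\<^sub>0 'b"
    have sub: "Poly_Mapping.keys (pm_scale c x) \<subseteq> Poly_Mapping.keys x" by (auto simp: in_keys_iff)
    show "peval g (Poly_Mapping.lookup (pm_scale c x)) = c * peval g (Poly_Mapping.lookup x)"
      unfolding ev[OF finite_keys sub] ev[OF finite_keys[of x] order_refl] by (simp add: sum_distrib_left mult_ac)
  qed
qed

section \<open>Homogeneous polynomials are determined by their values\<close>

lemma hpoly_coeff_zero: "f \<in> hpoly I n \<Longrightarrow> \<not> (size m = n \<and> set_mset m \<subseteq> I) \<Longrightarrow> f m = 0"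
  by (auto simp: hpoly_def)

text \<open>\<open>str_decomp\<close> is an identity of coefficient functions, while the
  constructions yield identities of values; this closes the gap. The values at
  \<open>unit_vec i\<close> and \<open>unit_vec i + unit_vec j\<close> suffice.\<close>

lemma hpoly_2_eqI:
  fixes p q :: "'i multiset \<Rightarrow> 'k::field"
  assumes "(2::'k) \<noteq> 0" "(3::'k) \<noteq> 0" "p \<in> hpoly I 2" "q \<in> hpoly I 2"
    and eq: "\<And>v. Poly_Mapping.keys v \<subseteq> I \<Longrightarrow> peval p (Poly_Mapping.lookup v) = peval q (Poly_Mapping.lookup v)"
  shows "p = q"
proof -
  have ev: "peval f (Poly_Mapping.lookup v) = (\<Sum>i\<in>S. \<Sum>j\<in>S. polar_coeff f {#i, j#} * (Poly_Mapping.lookup v i * Poly_Mapping.lookup v j))"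
    if "f \<in> hpoly I 2" "finite S" "Poly_Mapping.keys v \<subseteq> S" for S v and f :: "'i multiset \<Rightarrow> 'k"
  proof -
    have "peval f (Poly_Mapping.lookup v) = (\<Sum>xs\<in>words S 2. polar_coeff f (mset xs) * prod_list (map (Poly_Mapping.lookup v) xs))"
      using that by (intro peval_words[OF that(1)]) (auto simp: in_keys_iff sum_polar_coeff[OF assms(1,2)])
    then show ?thesis unfolding numeral_2_eq_2 using that by (simp add: sum_words_Suc sum_words_0 mult_ac)
  qed
  have diag: "polar_coeff p {#i, i#} = polar_coeff q {#i, i#}" if "i \<in> I" for i
    using eq[of "unit_vec i"] that ev[OF assms(3), of "{i}" "unit_vec i"] ev[OF assms(4), of "{i}" "unit_vec i"]
    by simp
  have off: "polar_coeff p {#i, j#} = polar_coeff q {#i, j#}" if "i \<in> I" "j \<in> I" "i \<noteq> j" for i j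
  proof -
    let ?v = "unit_vec i + unit_vec j :: 'i \<Rightarrow>\<^sub>0 'k"
    have k: "Poly_Mapping.keys ?v \<subseteq> {i, j}" using keys_add[of "unit_vec i" "unit_vec j"] by auto
    have v: "Poly_Mapping.lookup ?v i = 1" "Poly_Mapping.lookup ?v j = 1" using that(3) by (simp_all add: lookup_add lookup_single when_def)
    have "peval f (Poly_Mapping.lookup ?v) = polar_coeff f {#i, i#} + 2 * polar_coeff f {#i, j#} + polar_coeff f {#j, j#}"
      if "f \<in> hpoly I 2" for f
      using ev[OF that _ k] v \<open>i \<noteq> j\<close> by (simp add: add_mset_commute[of j i])
    from this[OF assms(3)] this[OF assms(4)] eq[of ?v] k that(1,2) diag[of i] diag[of j]
    have "2 * polar_coeff p {#i, j#} = 2 * polar_coeff q {#i, j#}" by auto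
    then show ?thesis using assms(1) by simp
  qed
  show ?thesis
  proof
    fix m
    show "p m = q m"
    proof (cases "size m = 2 \<and> set_mset m \<subseteq> I")
      case False
      then show ?thesis using hpoly_coeff_zero assms(3,4) by metis
    next
      case True
      obtain xs where xs: "mset xs = m" using ex_mset by blast
      then have "length xs = 2" using True by auto
      then obtain i j where "xs = [i, j]" by (auto simp: numeral_2_eq_2 length_Suc_conv)
      then have m: "m = {#i, j#}" using xs by auto
      then have "polar_coeff p m = polar_coeff q m" using True diag off by (cases "i = j") auto
      then show ?thesis using card_permutations_nonzero[OF assms(1,2), of m] True
        by (simp add: polar_coeff_def)
    qed
  qed
qed

text \<open>The cubes of \<open>x + y\<close> and \<open>x - y\<close> isolate
  \<open>6 * F x y y\<close>, and polarising the last two arguments then isolates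
  \<open>2 * F x y z\<close>.\<close>

lemma (in cubic_form) F_eq_0_of_cube_eq_0:
  assumes "\<And>x y. x \<in> X \<Longrightarrow> y \<in> X \<Longrightarrow> x + y \<in> X" "\<And>c x. x \<in> X \<Longrightarrow> scale c x \<in> X"
    and "\<And>x. x \<in> X \<Longrightarrow> F x x x = 0" "x \<in> X" "y \<in> X" "z \<in> X"
  shows "F x y z = 0"
proof -
  have xxy: "F x y y = 0" if "x \<in> X" "y \<in> X" for x y
  proof -
    have e1: "3 * F x x y + 3 * F x y y = 0"
      using F_cube_add[of x y] assms(1,3) that by simp
    have e2: "- 3 * F x x y + 3 * F x y y = 0"
      using assms(3)[OF assms(1)[OF that(1) assms(2)[OF that(2), of "-1"]]] assms(3) that
      unfolding F_cube_add unfolding F_simps by simp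
    have "2 * 3 * F x y y = (3 * F x x y + 3 * F x y y) + (- 3 * F x x y + 3 * F x y y)"
      by (simp add: algebra_simps)
    then have "2 * 3 * F x y y = 0" by (simp only: e1 e2 add_0_left)
    then show ?thesis using two_nonzero three_nonzero by (metis mult_eq_0_iff)
  qed
  have "2 * F x y z = 0"
    using F_quad_add[of x y z] xxy assms by simp
  then show ?thesis using two_nonzero by simp
qed

lemma hpoly_3_eqI:
  fixes p q :: "'i multiset \<Rightarrow> 'k::field"
  assumes "alg_closed TYPE('k)" "(2::'k) \<noteq> 0" "(3::'k) \<noteq> 0" "p \<in> hpoly I 3" "q \<in> hpoly I 3"
    and eq: "\<And>v. Poly_Mapping.keys v \<subseteq> I \<Longrightarrow> peval p (Poly_Mapping.lookup v) = peval q (Poly_Mapping.lookup v)"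
  shows "p = q"
proof
  fix m
  let ?r = "\<lambda>m. p m - q m"
  interpret cubic_form pm_scale "polarization ?r" by (rule cubic_form_polarization[OF assms(1-3)])
  have r: "?r \<in> hpoly I 3" unfolding hpoly_def
    using hpoly_coeff_zero[OF assms(4)] hpoly_coeff_zero[OF assms(5)] by fastforce
  have cube: "polarization ?r v v v = 0" if "Poly_Mapping.keys v \<subseteq> I" for v
  proof -
    have "peval ?r (Poly_Mapping.lookup v) = peval p (Poly_Mapping.lookup v) - peval q (Poly_Mapping.lookup v)"
      using peval_monomials[OF r, of "Poly_Mapping.keys v"] peval_monomials[OF assms(4), of "Poly_Mapping.keys v"]
        peval_monomials[OF assms(5), of "Poly_Mapping.keys v"]
      by (simp add: in_keys_iff sum_subtractf left_diff_distrib subset_iff)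
    then show ?thesis using eq[OF that] peval_polarization[OF assms(2,3) r, of v] by simp
  qed
  show "p m = q m"
  proof (cases "size m = 3 \<and> set_mset m \<subseteq> I")
    case False
    then show ?thesis using hpoly_coeff_zero assms(4,5) by metis
  next
    case True
    obtain xs where xs: "mset xs = m" using ex_mset by blast
    then have "length xs = 3" using True by auto
    then obtain i j k where "xs = [i, j, k]" by (auto simp: numeral_3_eq_3 length_Suc_conv)
    then have m: "m = {#i, j, k#}" using xs by auto
    have "polarization ?r (unit_vec i) (unit_vec j) (unit_vec k) = 0"
    proof (rule F_eq_0_of_cube_eq_0[where X = "{v. Poly_Mapping.keys v \<subseteq> I}"])
      show "x + y \<in> {v. Poly_Mapping.keys v \<subseteq> I}" if "x \<in> {v. Poly_Mapping.keys v \<subseteq> I}" "y \<in> {v. Poly_Mapping.keys v \<subseteq> I}" for x y :: "'i \<Rightarrow>\<^sub>0 'k"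
        using that keys_add[of x y] by auto
      show "pm_scale c x \<in> {v. Poly_Mapping.keys v \<subseteq> I}" if "x \<in> {v. Poly_Mapping.keys v \<subseteq> I}" for c and x :: "'i \<Rightarrow>\<^sub>0 'k"
        using that by (auto simp: in_keys_iff)
    qed (use True m cube in auto)
    then have "?r m = 0"
      using card_permutations_nonzero[OF assms(2,3), of m] True m
      by (simp add: polarization_unit_vec polar_coeff_def)
    then show ?thesis by simp
  qed
qed

section \<open>Finite strength and vanishing in finite codimension\<close>

lemma strength_finite_iff: "strength I n f \<noteq> \<infinity> \<longleftrightarrow> (\<exists>s. str_decomp I n f s)"
  by (simp add: strength_def)

text \<open>In degree 2 both factors of a product are linear, so a decomposition vanishes where all
  left factors do; conversely, the products come from \<open>small_finite_rank\<close>.\<close>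

lemma derivative_strength_finite_iff:
  fixes f :: "'i multiset \<Rightarrow> 'k::field"
  assumes "alg_closed TYPE('k)" "(2::'k) \<noteq> 0" "(3::'k) \<noteq> 0" "f \<in> hpoly I 3"
  shows "strength I 2 (\<lambda>m. \<Sum>j<(r::nat). c j * pderiv_at f (idx j) m) \<noteq> \<infinity> \<longleftrightarrow>
    cubic_form.small pm_scale (polarization f) (\<Sum>j<r. pm_scale (c j) (unit_vec (idx j)))"
proof -
  interpret cubic_form pm_scale "polarization f" by (rule cubic_form_polarization[OF assms(1-3)])
  let ?q = "\<lambda>m. \<Sum>j<r. c j * pderiv_at f (idx j) m"
  let ?w = "\<Sum>j<r. pm_scale (c j) (unit_vec (idx j))"
  have q: "?q \<in> hpoly I 2" using hpoly_derivative[of f I 2 c idx r] assms(4) by simp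
  have ev: "peval ?q (Poly_Mapping.lookup v) = 3 * polarization f ?w v v" for v
    by (rule peval_derivative[OF assms])
  show ?thesis unfolding strength_finite_iff
  proof
    assume "\<exists>s. str_decomp I 2 ?q s"
    then obtain s and g h :: "nat \<Rightarrow> 'i multiset \<Rightarrow> 'k" and d e where
      de: "\<forall>j<s. 0 < d j \<and> d j < 2 \<and> 0 < e j \<and> e j < 2 \<and> g j \<in> hpoly I (d j) \<and> h j \<in> hpoly I (e j)"
      and q_eq: "?q = (\<lambda>m. \<Sum>j<s. pmul (g j) (h j) m)" unfolding str_decomp_def by blast
    have gh: "g j \<in> hpoly I 1 \<and> h j \<in> hpoly I 1" if "j < s" for j
    proof -
      have "d j = 1" "e j = 1" using de that by fastforce+
      then show ?thesis using de that by metis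
    qed
    let ?L = "(\<lambda>j v. peval (g j) (Poly_Mapping.lookup v)) ` {..<s}"
    have "pm.fin_functionals ?L"
      using gh by (intro pm.fin_functionals_image functional_peval) auto
    moreover have "polarization f ?w v v = 0" if "v \<in> pm.kernel ?L" for v
    proof -
      have "pmul (g j) (h j) \<in> hpoly I (1 + 1)" if "j < s" for j
        using gh[OF that] by (intro hpoly_pmul) auto
      then have "peval ?q (Poly_Mapping.lookup v) = (\<Sum>j<s. peval (pmul (g j) (h j)) (Poly_Mapping.lookup v))"
        unfolding q_eq by (intro peval_sum) auto
      also have "\<dots> = (\<Sum>j<s. peval (g j) (Poly_Mapping.lookup v) * peval (h j) (Poly_Mapping.lookup v))"
        using gh by (intro sum.cong refl peval_pmul) auto
      also have "\<dots> = 0" using that by (simp add: pm.kernel_image)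
      finally show ?thesis using ev[of v] assms(3) by simp
    qed
    ultimately show "small ?w" unfolding small_def by blast
  next
    assume "small ?w"
    then obtain ps where ps: "\<forall>(l, m)\<in>set ps. pm.functional l \<and> pm.functional m"
      "\<forall>x y. polarization f ?w x y = (\<Sum>(l, m)\<leftarrow>ps. l x * m y)"
      using small_finite_rank unfolding pm.finite_rank_def by blast
    define s where "s = length ps"
    \<comment> \<open>The factor 3 of \<open>peval_derivative\<close> moves into the left
      factors.\<close>
    define l where "l j v = 3 * fst (ps ! j) v" for j v
    define m where "m j = snd (ps ! j)" for j
    have fl: "pm.functional (l j)" and fm: "pm.functional (m j)" if "j < s" for j
      using ps(1)[unfolded case_prod_unfold] that
      by (auto simp: l_def[abs_def] m_def s_def intro!: pm.functional_times)
    have ev': "peval ?q (Poly_Mapping.lookup v) = (\<Sum>j<s. l j v * m j v)" for v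
    proof -
      have "peval ?q (Poly_Mapping.lookup v) = 3 * (\<Sum>(l, m)\<leftarrow>ps. l v * m v)" using ev ps(2) by simp
      also have "\<dots> = (\<Sum>j<s. l j v * m j v)"
        by (subst sum_list_sum_nth)
          (simp add: l_def m_def s_def case_prod_unfold lessThan_atLeast0 sum_distrib_left mult.assoc)
      finally show ?thesis .
    qed
    let ?g = "\<lambda>j. linear_poly I (l j)" and ?h = "\<lambda>j. linear_poly I (m j)"
    have prod: "pmul (?g j) (?h j) \<in> hpoly I 2" for j
      using hpoly_pmul[OF hpoly_linear_poly hpoly_linear_poly] by (metis one_add_one)
    have "?q = (\<lambda>a. \<Sum>j<s. pmul (?g j) (?h j) a)"
    proof (rule hpoly_2_eqI[OF assms(2,3) q])
      show "(\<lambda>a. \<Sum>j<s. pmul (?g j) (?h j) a) \<in> hpoly I 2" by (rule hpoly_sum[OF prod])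
      fix v :: "'i \<Rightarrow>\<^sub>0 'k" assume v: "Poly_Mapping.keys v \<subseteq> I"
      have "peval (\<lambda>a. \<Sum>j<s. pmul (?g j) (?h j) a) (Poly_Mapping.lookup v) = (\<Sum>j<s. peval (pmul (?g j) (?h j)) (Poly_Mapping.lookup v))"
        using prod by (intro peval_sum) auto
      also have "\<dots> = (\<Sum>j<s. l j v * m j v)"
      proof (rule sum.cong[OF refl])
        fix j assume "j \<in> {..<s}"
        then show "peval (pmul (?g j) (?h j)) (Poly_Mapping.lookup v) = l j v * m j v"
          by (subst peval_pmul[OF hpoly_linear_poly hpoly_linear_poly])
            (simp_all add: peval_linear_poly[OF fl v] peval_linear_poly[OF fm v])
      qed
      finally show "peval ?q (Poly_Mapping.lookup v) = peval (\<lambda>a. \<Sum>j<s. pmul (?g j) (?h j) a) (Poly_Mapping.lookup v)"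
        using ev'[of v] by simp
    qed
    then have "str_decomp I 2 ?q s"
      unfolding str_decomp_def
      by (intro exI[of _ ?g] exI[of _ ?h] exI[of _ "\<lambda>_. 1"] conjI)
        (simp_all add: hpoly_linear_poly[unfolded One_nat_def])
    then show "\<exists>s. str_decomp I 2 ?q s" by blast
  qed
qed

text \<open>Suppose the cubic vanishes on a kernel, and project \<open>v\<close> to
  \<open>p v\<close> in it. As in \<open>a^3 - b^3 = (a - b) * (a^2 + a * b + b^2)\<close>, the
  difference of the cubes of \<open>v\<close> and \<open>p v\<close> has the factor
  \<open>v - p v\<close>, a combination of finitely many \<open>t j\<close>; this yields products of
  linear and quadratic forms.\<close>

lemma nondegenerate_imp_nondeg:
  fixes f :: "'i multiset \<Rightarrow> 'k::field"
  assumes "alg_closed TYPE('k)" "(2::'k) \<noteq> 0" "(3::'k) \<noteq> 0" "f \<in> hpoly I 3" "nondegenerate I f"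
  shows "cubic_form.nondeg pm_scale (polarization f)"
proof -
  interpret cubic_form pm_scale "polarization f" by (rule cubic_form_polarization[OF assms(1-3)])
  let ?F = "polarization f"
  show ?thesis unfolding nondeg_def
  proof (intro allI impI, rule ccontr)
    fix L assume L: "pm.fin_functionals L" and "\<not> (\<exists>v\<in>pm.kernel L. ?F v v v \<noteq> 0)"
    then have zero: "?F v v v = 0" if "v \<in> pm.kernel L" for v using that by blast
    obtain s :: nat and m t where m: "\<And>i. i < s \<Longrightarrow> pm.functional (m i)"
      and P: "\<And>v. v - (\<Sum>i<s. pm_scale (m i v) (t i)) \<in> pm.kernel L"
      using pm.kernel_projection[OF L] by blast
    define p where "p v = v - (\<Sum>i<s. pm_scale (m i v) (t i))" for v
    define B where "B j x y = ?F (t j) x y + ?F (t j) (p x) y + ?F (t j) (p x) (p y)" for j x y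
    have p_add: "p (x + y) = p x + p y" for x y
      unfolding p_def using m by (simp add: pm.functional_simps pm.scale_left_distrib sum.distrib)
    have p_scale: "p (pm_scale c x) = pm_scale c (p x)" for c x
      unfolding p_def using m by (simp add: pm.functional_simps pm.scale_right_diff_distrib pm.scale_sum_right)
    have B1: "pm.functional (\<lambda>x. B j x y)" and B2: "pm.functional (B j x)" for j x y
      unfolding B_def by (auto intro!: pm.functionalI simp: p_add p_scale F_simps algebra_simps)
    have ev: "?F v v v = (\<Sum>j<s. m j v * B j v v)" for v
    proof -
      have "?F v v v - ?F (p v) (p v) (p v) =
          ?F (v - p v) v v + ?F (v - p v) (p v) v + ?F (v - p v) (p v) (p v)"
        using F_swap12[of v "p v"] F_swap12[of "p v" v] F_swap23[of "p v" "p v" v] F_swap12[of "p v" v "p v"]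
        by (simp add: F_simps)
      also have "v - p v = (\<Sum>i<s. pm_scale (m i v) (t i))" by (simp add: p_def)
      also have "?F \<dots> v v + ?F \<dots> (p v) v + ?F \<dots> (p v) (p v) = (\<Sum>j<s. m j v * B j v v)"
        unfolding F_sum1 B_def by (simp add: sum.distrib algebra_simps)
      finally show ?thesis using zero[of "p v"] P by (simp add: p_def)
    qed
    let ?g = "\<lambda>j. linear_poly I (m j)" and ?h = "\<lambda>j. quadratic_poly I (B j)"
    have prod: "pmul (?g j) (?h j) \<in> hpoly I 3" for j
      using hpoly_pmul[OF hpoly_linear_poly[of I "m j"] hpoly_quadratic_poly[of I "B j"]] by (simp add: numeral_3_eq_3)
    have "f = (\<lambda>a. \<Sum>j<s. pmul (?g j) (?h j) a)"
    proof (rule hpoly_3_eqI[OF assms(1-4)])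
      show "(\<lambda>a. \<Sum>j<s. pmul (?g j) (?h j) a) \<in> hpoly I 3" by (rule hpoly_sum[OF prod])
      fix v :: "'i \<Rightarrow>\<^sub>0 'k" assume v: "Poly_Mapping.keys v \<subseteq> I"
      have "peval (\<lambda>a. \<Sum>j<s. pmul (?g j) (?h j) a) (Poly_Mapping.lookup v) = (\<Sum>j<s. peval (pmul (?g j) (?h j)) (Poly_Mapping.lookup v))"
        using prod by (intro peval_sum) auto
      also have "\<dots> = (\<Sum>j<s. m j v * B j v v)"
      proof (rule sum.cong[OF refl])
        fix j assume "j \<in> {..<s}"
        then show "peval (pmul (?g j) (?h j)) (Poly_Mapping.lookup v) = m j v * B j v v"
          by (subst peval_pmul[OF hpoly_linear_poly hpoly_quadratic_poly])
            (simp_all add: peval_linear_poly[OF m v] peval_quadratic_poly[OF B2 B1 v])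
      qed
      finally show "peval f (Poly_Mapping.lookup v) = peval (\<lambda>a. \<Sum>j<s. pmul (?g j) (?h j) a) (Poly_Mapping.lookup v)"
        using ev[of v] peval_polarization[OF assms(2-4), of v] by simp
    qed
    then have "str_decomp I 3 f s"
      unfolding str_decomp_def
      by (intro exI[of _ ?g] exI[of _ ?h] exI[of _ "\<lambda>_. 1"] exI[of _ "\<lambda>_. 2"] conjI)
        (simp_all add: hpoly_linear_poly[unfolded One_nat_def] hpoly_quadratic_poly)
    then show False using assms(5) unfolding nondegenerate_def strength_def by (auto split: if_splits)
  qed
qed

lemma indep_mod_fin_str_iff:
  fixes f :: "'i multiset \<Rightarrow> 'k::field"
  assumes "alg_closed TYPE('k)" "(2::'k) \<noteq> 0" "(3::'k) \<noteq> 0" "f \<in> hpoly I 3"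
  shows "indep_mod_fin_str I f r idx \<longleftrightarrow>
    cubic_form.indep_mod_small pm_scale (polarization f) (\<lambda>j. unit_vec (idx j)) r"
  unfolding indep_mod_fin_str_def derivative_strength_finite_iff[OF assms]
    cubic_form.indep_mod_small_def[OF cubic_form_polarization[OF assms(1-3)]] by simp

text \<open>\<open>rrk\<close> tests only families of unit vectors from \<open>I\<close>, the
  abstract theory arbitrary vectors. An independent family of unit vectors that no unit vector
  extends spans everything modulo small vectors, so no independent family is longer.\<close>

lemma le_rrk_iff:
  fixes f :: "'i multiset \<Rightarrow> 'k::field"
  assumes "alg_closed TYPE('k)" "(2::'k) \<noteq> 0" "(3::'k) \<noteq> 0" "f \<in> hpoly I 3"
  shows "enat r \<le> rrk I f \<longleftrightarrow> (\<exists>y. cubic_form.indep_mod_small pm_scale (polarization f) y r)"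
proof -
  interpret cubic_form pm_scale "polarization f" by (rule cubic_form_polarization[OF assms(1-3)])
  define Q where "Q n \<longleftrightarrow> (\<exists>idx. (\<forall>j<n. idx j \<in> I) \<and> indep_mod_small (\<lambda>j. unit_vec (idx j)) n)" for n
  have rrk: "rrk I f = Sup {enat n | n. Q n}"
    unfolding rrk_def Q_def indep_mod_fin_str_iff[OF assms] ..
  show ?thesis
  proof
    assume r: "enat r \<le> rrk I f"
    have "\<exists>n\<ge>r. Q n"
    proof (rule ccontr)
      assume "\<not> ?thesis"
      then have lt: "n < r" if "Q n" for n using that by (meson not_le)
      have "Q 0" by (simp add: Q_def)
      then have "0 < r" using lt by blast
      have "rrk I f \<le> enat (r - 1)" unfolding rrk
        using lt by (intro Sup_least) fastforce
      then have "enat r \<le> enat (r - 1)" using r by (rule order_trans[rotated])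
      then show False using \<open>0 < r\<close> by simp
    qed
    then show "\<exists>y. indep_mod_small y r" unfolding Q_def using indep_mod_small_mono by blast
  next
    assume "\<exists>y. indep_mod_small y r"
    then obtain y where y: "indep_mod_small y r" by blast
    have "Q r"
    proof (rule ccontr)
      assume "\<not> Q r"
      have "Q 0" by (simp add: Q_def)
      have "\<exists>n<r. Q n \<and> \<not> Q (Suc n)"
      proof (rule ccontr)
        assume step: "\<not> ?thesis"
        have "n \<le> r \<Longrightarrow> Q n" for n
          by (induction n) (use \<open>Q 0\<close> step in \<open>auto simp: Suc_le_eq\<close>)
        then show False using \<open>\<not> Q r\<close> by blast
      qed
      then obtain n where n: "n < r" "Q n" "\<not> Q (Suc n)" by blast
      obtain idx where idx: "\<forall>j<n. idx j \<in> I" "indep_mod_small (\<lambda>j. unit_vec (idx j)) n"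
        using n(2) by (auto simp: Q_def)
      let ?e = "\<lambda>j. unit_vec (idx j)"
      have unit: "unit_vec i \<in> span_mod_small ?e n" for i
      proof (cases "i \<in> I")
        case True
        show ?thesis
        proof (rule ccontr)
          assume not: "unit_vec i \<notin> span_mod_small ?e n"
          let ?idx = "idx(n := i)"
          have "span_mod_small (\<lambda>j. unit_vec (?idx j)) n = span_mod_small ?e n"
            by (rule span_mod_small_cong) simp
          moreover have "indep_mod_small (\<lambda>j. unit_vec (?idx j)) n = indep_mod_small ?e n"
            by (rule indep_mod_small_cong) simp
          ultimately have "indep_mod_small (\<lambda>j. unit_vec (?idx j)) (Suc n)"
            using not idx(2) by (intro indep_mod_small_Suc) auto
          moreover have "\<forall>j<Suc n. ?idx j \<in> I" using idx(1) True by (simp add: less_Suc_eq)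
          ultimately show False using n(3) unfolding Q_def by blast
        qed
      next
        case False
        \<comment> \<open>No monomial of \<open>f\<close> contains an index outside
          \<open>I\<close>, so such unit vectors are small.\<close>
        then have "polar_coeff f (add_mset i m) = 0" for m
          using assms(4) by (force simp: polar_coeff_def hpoly_def)
        then have "polarization f (unit_vec i) v v = 0" for v
          by (simp add: polarization_def trilinear_def)
        then have "small (unit_vec i)" unfolding small_def by (intro exI[of _ "{}"]) simp
        then show ?thesis unfolding span_mod_small_def by (auto intro!: exI[of _ "\<lambda>_. 0"])
      qed
      have "v \<in> span_mod_small ?e n" for v
      proof -
        have "(\<Sum>i\<in>S. pm_scale (Poly_Mapping.lookup v i) (unit_vec i)) \<in> span_mod_small ?e n" for S
        proof (induction S rule: infinite_finite_induct)
          case (insert i S)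
          then show ?case using unit by (simp add: span_mod_small_add span_mod_small_scale)
        qed (use span_mod_small_scale[OF unit, of 0] in auto)
        then show ?thesis using unit_vec_expansion[of v] by metis
      qed
      then have "r \<le> n" using y by (rule indep_mod_small_le_dim)
      then show False using n(1) by simp
    qed
    then show "enat r \<le> rrk I f" unfolding rrk by (intro Sup_upper) auto
  qed
qed

section \<open>Embeddings of cubic spaces\<close>

lemma cubic_form_coords_standard:
  assumes "cubic_form pm_scale G"
  shows "cubic_form_coords pm_scale G unit_vec (\<lambda>n v. Poly_Mapping.lookup v (n::nat))"
proof -
  interpret cubic_form pm_scale G by fact
  show ?thesis
  proof unfold_locales
    show "pm.functional (\<lambda>v. Poly_Mapping.lookup v n)" for n
      by (intro pm.functionalI) (simp_all add: lookup_add)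
    fix v :: "nat \<Rightarrow>\<^sub>0 'a"
    obtain N where N: "\<forall>n\<in>Poly_Mapping.keys v. n < N" using finite_keys[of v] finite_nat_set_iff_bounded by blast
    show "\<exists>N. \<forall>n\<ge>N. Poly_Mapping.lookup v n = 0 \<and> v = (\<Sum>i<n. pm_scale (Poly_Mapping.lookup v i) (unit_vec i))"
    proof (intro exI allI impI conjI)
      fix n assume n: "N \<le> n"
      show "Poly_Mapping.lookup v n = 0" using N n in_keys_iff leD by metis
      show "v = (\<Sum>i<n. pm_scale (Poly_Mapping.lookup v i) (unit_vec i))"
        using N n by (intro poly_mapping_unit_vec_sum) auto
    qed
  qed
qed

text \<open>The vectors \<open>y\<close> come first, then every unit vector, made small by
  subtracting a combination of \<open>y\<close>. The coordinates of \<open>v\<close> are kept for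
  these corrected vectors, and the first \<open>s\<close> slots collect the corrections.\<close>

lemma cubic_form_coords_adapted:
  fixes G :: "(nat \<Rightarrow>\<^sub>0 'k::field) \<Rightarrow> _"
  assumes "cubic_form pm_scale G" "\<And>v. v \<in> cubic_form.span_mod_small pm_scale G y s"
  shows "\<exists>b \<beta>. cubic_form_coords pm_scale G b \<beta> \<and> (\<forall>i\<ge>s. cubic_form.small pm_scale G (b i))"
proof -
  interpret cubic_form pm_scale G by fact
  have "\<forall>n. \<exists>c. small (unit_vec n - (\<Sum>t<s. pm_scale (c t) (y t)))"
    using assms(2) by (auto simp: span_mod_small_def)
  then obtain C where C: "\<And>n. small (unit_vec n - (\<Sum>t<s. pm_scale (C n t) (y t)))" by metis
  define w where "w n = unit_vec n - (\<Sum>t<s. pm_scale (C n t) (y t))" for n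
  define b where "b i = (if i < s then y i else w (i - s))" for i
  define \<beta> where "\<beta> i v = (if i < s then \<Sum>n\<in>Poly_Mapping.keys v. Poly_Mapping.lookup v n * C n i else Poly_Mapping.lookup v (i - s))" for i v
  have \<beta>_sum: "(\<Sum>n\<in>Poly_Mapping.keys v. Poly_Mapping.lookup v n * C n i) = (\<Sum>n\<in>S. Poly_Mapping.lookup v n * C n i)" if "finite S" "Poly_Mapping.keys v \<subseteq> S" for v S i
    using that by (intro sum.mono_neutral_left) (auto simp: in_keys_iff)
  have "pm.functional (\<beta> i)" for i
  proof (rule pm.functionalI)
    fix x y :: "nat \<Rightarrow>\<^sub>0 'k"
    let ?S = "Poly_Mapping.keys x \<union> Poly_Mapping.keys y"
    have S: "finite ?S" "Poly_Mapping.keys x \<subseteq> ?S" "Poly_Mapping.keys y \<subseteq> ?S" "Poly_Mapping.keys (x + y) \<subseteq> ?S" using keys_add[of x y] by auto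
    show "\<beta> i (x + y) = \<beta> i x + \<beta> i y"
      unfolding \<beta>_def \<beta>_sum[OF S(1,2)] \<beta>_sum[OF S(1,3)] \<beta>_sum[OF S(1,4)]
      by (simp add: lookup_add algebra_simps sum.distrib)
  next
    fix c :: 'k and x :: "nat \<Rightarrow>\<^sub>0 'k"
    have sub: "Poly_Mapping.keys (pm_scale c x) \<subseteq> Poly_Mapping.keys x" by (auto simp: in_keys_iff)
    show "\<beta> i (pm_scale c x) = c * \<beta> i x"
      unfolding \<beta>_def \<beta>_sum[OF finite_keys sub] by (simp add: sum_distrib_left mult_ac)
  qed
  moreover have "\<exists>N. \<forall>n\<ge>N. \<beta> n v = 0 \<and> v = (\<Sum>i<n. pm_scale (\<beta> i v) (b i))" for v
  proof -
    obtain N where N: "\<forall>n\<in>Poly_Mapping.keys v. n < N" using finite_keys[of v] finite_nat_set_iff_bounded by blast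
    show ?thesis
    proof (rule exI[of _ "s + N"], intro allI impI)
      fix n assume "s + N \<le> n"
      then obtain K where K: "n = s + K" "N \<le> K" by (metis add_le_cancel_left le_iff_add add.assoc le_add1)
      have keys: "Poly_Mapping.keys v \<subseteq> {..<K}" using N K(2) by auto
      have "(\<Sum>i<s. pm_scale (\<beta> i v) (b i)) = (\<Sum>t<s. pm_scale (\<Sum>k<K. Poly_Mapping.lookup v k * C k t) (y t))"
        using \<beta>_sum[OF _ keys] by (simp add: \<beta>_def b_def)
      also have "\<dots> = (\<Sum>t<s. \<Sum>k<K. pm_scale (Poly_Mapping.lookup v k) (pm_scale (C k t) (y t)))"
        by (simp add: pm.scale_sum_left)
      also have "\<dots> = (\<Sum>k<K. pm_scale (Poly_Mapping.lookup v k) (\<Sum>t<s. pm_scale (C k t) (y t)))"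
        unfolding pm.scale_sum_right by (rule sum.swap)
      finally have "(\<Sum>i<n. pm_scale (\<beta> i v) (b i)) =
          (\<Sum>k<K. pm_scale (Poly_Mapping.lookup v k) (\<Sum>t<s. pm_scale (C k t) (y t))) + (\<Sum>k<K. pm_scale (Poly_Mapping.lookup v k) (w k))"
        unfolding K sum_lessThan_add by (simp add: \<beta>_def b_def)
      also have "\<dots> = (\<Sum>k<K. pm_scale (Poly_Mapping.lookup v k) (unit_vec k))"
        by (simp add: w_def pm.scale_right_diff_distrib sum_subtractf)
      also have "\<dots> = v" using poly_mapping_unit_vec_sum[OF _ keys] by simp
      finally have "v = (\<Sum>i<n. pm_scale (\<beta> i v) (b i))" by (rule sym)
      moreover have "Poly_Mapping.lookup v K = 0" using N K(2) in_keys_iff leD by metis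
      ultimately show "\<beta> n v = 0 \<and> v = (\<Sum>i<n. pm_scale (\<beta> i v) (b i))"
        using K(1) by (simp add: \<beta>_def)
    qed
  qed
  ultimately have "cubic_form_coords pm_scale G b \<beta>" by unfold_locales
  moreover have "small (b i)" if "s \<le> i" for i
    using that C by (simp add: b_def w_def)
  ultimately show ?thesis by blast
qed

text \<open>The last premise is the inequality of residual ranks, phrased through independent
  families.\<close>

lemma embed_sequence_space:
  assumes "cubic_form sV F" "cubic_form.nondeg sV F" "cubic_form pm_scale G"
    and "\<And>y r. cubic_form.indep_mod_small pm_scale G y r \<Longrightarrow> \<exists>y'. cubic_form.indep_mod_small sV F y' r"
  shows "\<exists>\<Phi>. Vector_Spaces.linear pm_scale sV \<Phi> \<and> (\<forall>w :: nat \<Rightarrow>\<^sub>0 _. F (\<Phi> w) (\<Phi> w) (\<Phi> w) = G w w w)"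
proof -
  interpret V: cubic_form sV F by fact
  interpret W: cubic_form pm_scale G by fact
  show ?thesis
  proof (cases "\<forall>r. \<exists>y. V.indep_mod_small y r")
    case True
    then show ?thesis
      using embed_infinite_rank[OF assms(1,2) _ cubic_form_coords_standard[OF assms(3)]] by blast
  next
    case False
    have least: "\<exists>r y. R y r \<and> (\<nexists>y. R y (Suc r))" if "\<exists>r. \<forall>y. \<not> R y r" "\<exists>y. R y 0"
      for R :: "'z \<Rightarrow> nat \<Rightarrow> bool"
    proof (rule ccontr)
      assume "\<not> ?thesis"
      then have "\<exists>y. R y r" for r using that(2) by (induction r) auto
      then show False using that(1) by blast
    qed
    obtain r y where r: "V.indep_mod_small y r" "\<nexists>y. V.indep_mod_small y (Suc r)"
      using least[of V.indep_mod_small] False V.indep_mod_small_0 by blast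
    obtain L where L: "V.fin_functionals L" "\<And>v. v \<in> V.kernel L \<Longrightarrow> V.small v"
      using V.small_finite_codim[OF r(1) V.maximal_indep_spans[OF r]] by blast
    have "\<exists>r. \<forall>y. \<not> W.indep_mod_small y r" using False assms(4) by blast
    then obtain s z where s: "W.indep_mod_small z s" "\<nexists>y. W.indep_mod_small y (Suc s)"
      using least[of W.indep_mod_small] W.indep_mod_small_0 by blast
    obtain b \<beta> where b: "cubic_form_coords pm_scale G b \<beta>" "\<And>i. s \<le> i \<Longrightarrow> W.small (b i)"
      using cubic_form_coords_adapted[OF assms(3) W.maximal_indep_spans[OF s]] by blast
    \<comment> \<open>Only as many vectors are taken from V as the rank \<open>s\<close> of W
      demands; \<open>L\<close> still comes from the full rank \<open>r\<close> of V.\<close>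
    obtain y' where "V.indep_mod_small y' s" using assms(4)[OF s(1)] by blast
    then show ?thesis using embed_finite_rank[OF assms(1,2) L _ b] by blast
  qed
qed

lemma cubic_form_pullback:
  assumes "cubic_form sV F" "vector_space sW" "Vector_Spaces.linear sW sV T"
  shows "cubic_form sW (\<lambda>x y z. F (T x) (T y) (T z))"
proof -
  interpret V: cubic_form sV F by fact
  interpret W: vector_space sW by fact
  interpret T: Vector_Spaces.linear sW sV T by fact
  show ?thesis
    by unfold_locales
      (use V.alg_closed V.two_nonzero V.three_nonzero V.F_swap12 V.F_swap23 in
        \<open>simp_all add: T.add T.scale V.F_simps\<close>)
qed

lemma (in cubic_form) trilinear_determined_by_cube:
  assumes "cubic_form scale H" "\<And>v. F v v v = H v v v"
  shows "F x y z = H x y z"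
proof -
  interpret H: cubic_form scale H by fact
  interpret D: cubic_form scale "\<lambda>x y z. F x y z - H x y z"
  proof unfold_locales
    show "F x y z - H x y z = F y x z - H y x z" "F x y z - H x y z = F x z y - H x z y" for x y z
      using F_swap12[of x y z] H.F_swap12[of x y z] F_swap23[of x y z] H.F_swap23[of x y z] by simp_all
  qed (use alg_closed two_nonzero three_nonzero in
    \<open>simp_all add: F_add1 F_scale1 H.F_add1 H.F_scale1 algebra_simps\<close>)
  have "F x y z - H x y z = 0"
    by (rule D.F_eq_0_of_cube_eq_0[of UNIV]) (use assms(2) in auto)
  then show ?thesis by simp
qed

text \<open>An embedding preserves cubes only; by polarisation it also preserves the trilinear
  forms, and then independent families map to independent families.\<close>

lemma cubic_embeds_imp_rrk_le:
  fixes f :: "'i multiset \<Rightarrow> 'k::field" and g :: "'j multiset \<Rightarrow> 'k"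
  assumes "alg_closed TYPE('k)" "(2::'k) \<noteq> 0" "(3::'k) \<noteq> 0"
    and "f \<in> hpoly I 3" "g \<in> hpoly J 3" "cubic_embeds J g I f"
  shows "rrk J g \<le> rrk I f"
proof -
  obtain \<phi> :: "('j \<Rightarrow> 'k) \<Rightarrow> ('i \<Rightarrow> 'k)" where \<phi>: "\<And>w. w \<in> vecs J \<Longrightarrow> \<phi> w \<in> vecs I"
    "\<And>a b v w. v \<in> vecs J \<Longrightarrow> w \<in> vecs J \<Longrightarrow> \<phi> (\<lambda>x. a * v x + b * w x) = (\<lambda>y. a * \<phi> v y + b * \<phi> w y)"
    "\<And>w. w \<in> vecs J \<Longrightarrow> peval f (\<phi> w) = peval g w"
    using assms(6) unfolding cubic_embeds_def by blast
  interpret V: cubic_form pm_scale "polarization f" by (rule cubic_form_polarization[OF assms(1-3)])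
  interpret W: cubic_form pm_scale "polarization g" by (rule cubic_form_polarization[OF assms(1-3)])
  \<comment> \<open>\<open>\<phi>\<close> is controlled only on \<open>vecs J\<close>, so vectors on
    the whole index type are first cut down to \<open>J\<close>.\<close>
  define \<rho> where "\<rho> v = (\<lambda>j. if j \<in> J then Poly_Mapping.lookup v j else 0)" for v :: "'j \<Rightarrow>\<^sub>0 'k"
  have \<rho>: "\<rho> v \<in> vecs J" for v
  proof -
    have "{j. \<rho> v j \<noteq> 0} \<subseteq> Poly_Mapping.keys v" by (auto simp: \<rho>_def in_keys_iff)
    then have "finite {j. \<rho> v j \<noteq> 0}" by (rule finite_subset) simp
    then show ?thesis by (auto simp: vecs_def \<rho>_def)
  qed
  define T where "T v = Abs_poly_mapping (\<phi> (\<rho> v))" for v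
  have LT: "Poly_Mapping.lookup (T v) = \<phi> (\<rho> v)" for v
    unfolding T_def using \<phi>(1)[OF \<rho>] by (intro lookup_Abs_poly_mapping) (simp add: vecs_def)
  have comb: "\<phi> (\<rho> (pm_scale a v + pm_scale b w)) = (\<lambda>y. a * \<phi> (\<rho> v) y + b * \<phi> (\<rho> w) y)" for a b v w
  proof -
    have "\<rho> (pm_scale a v + pm_scale b w) = (\<lambda>x. a * \<rho> v x + b * \<rho> w x)"
      by (auto simp: \<rho>_def lookup_add)
    then show ?thesis by (simp only: \<phi>(2)[OF \<rho> \<rho>])
  qed
  have T: "Vector_Spaces.linear pm_scale pm_scale T"
    unfolding Vector_Spaces.linear_iff
  proof (intro conjI allI vector_space_pm_scale)
    show "T (x + y) = T x + T y" for x y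
      using comb[of 1 x 1 y] by (intro poly_mapping_eqI) (simp add: LT lookup_add)
    show "T (pm_scale c x) = pm_scale c (T x)" for c x
      using comb[of c x 0 x] by (intro poly_mapping_eqI) (simp add: LT lookup_add)
  qed
  have "polarization g v v v = polarization f (T v) (T v) (T v)" for v
  proof -
    have "polarization g v v v = peval g (\<rho> v)"
      unfolding \<rho>_def peval_restrict[OF assms(5)] by (rule peval_polarization[OF assms(2,3,5), symmetric])
    also have "\<dots> = peval f (Poly_Mapping.lookup (T v))" by (simp only: LT \<phi>(3)[OF \<rho>])
    finally show ?thesis by (simp only: peval_polarization[OF assms(2-4)])
  qed
  then have pull: "polarization g x y z = polarization f (T x) (T y) (T z)" for x y z
    by (rule W.trilinear_determined_by_cube[OF cubic_form_pullback[OF V.cubic_form_axioms vector_space_pm_scale T]])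
  have le: "enat r \<le> rrk I f" if "enat r \<le> rrk J g" for r
  proof -
    from iffD1[OF le_rrk_iff[OF assms(1-3,5)] that] obtain y where "W.indep_mod_small y r" ..
    then have "V.indep_mod_small (\<lambda>i. T (y i)) r"
      by (rule indep_mod_small_pullback[OF V.cubic_form_axioms W.cubic_form_axioms T pull])
    then show ?thesis by (intro iffD2[OF le_rrk_iff[OF assms(1-4)]] exI)
  qed
  show ?thesis
  proof (cases "rrk J g")
    case (enat n)
    then show ?thesis using le[of n] by simp
  next
    case infinity
    have "rrk I f = \<infinity>"
    proof (rule ccontr)
      assume "rrk I f \<noteq> \<infinity>"
      then obtain n where "rrk I f = enat n" by auto
      then show False using le[of "Suc n"] infinity by simp
    qed
    then show ?thesis by simp
  qed
qed

text \<open>Enumerating \<open>J\<close> replaces W by a space of sequences; \<open>T\<close> kills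
  surplus coordinates. Families independent for the pulled back form map to independent families of
  W, so the rank hypothesis carries over.\<close>

lemma rrk_le_imp_cubic_embeds:
  fixes f :: "'i multiset \<Rightarrow> 'k::field" and g :: "'j multiset \<Rightarrow> 'k"
  assumes "alg_closed TYPE('k)" "(2::'k) \<noteq> 0" "(3::'k) \<noteq> 0"
    and "f \<in> hpoly I 3" "nondegenerate I f" "countable J" "g \<in> hpoly J 3" "rrk J g \<le> rrk I f"
  shows "cubic_embeds J g I f"
proof -
  interpret V: cubic_form pm_scale "polarization f" by (rule cubic_form_polarization[OF assms(1-3)])
  interpret W: cubic_form pm_scale "polarization g" by (rule cubic_form_polarization[OF assms(1-3)])
  let ?n = "to_nat_on J"
  define T :: "(nat \<Rightarrow>\<^sub>0 'k) \<Rightarrow> ('j \<Rightarrow>\<^sub>0 'k)" where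
    "T x = Abs_poly_mapping (\<lambda>j. if j \<in> J then Poly_Mapping.lookup x (?n j) else 0)" for x
  have LT: "Poly_Mapping.lookup (T x) = (\<lambda>j. if j \<in> J then Poly_Mapping.lookup x (?n j) else 0)" for x
    unfolding T_def
  proof (rule lookup_Abs_poly_mapping)
    have "finite (?n -` Poly_Mapping.keys x \<inter> J)"
      using assms(6) by (intro finite_vimage_IntI inj_on_to_nat_on) auto
    then show "finite {j. (if j \<in> J then Poly_Mapping.lookup x (?n j) else 0) \<noteq> 0}"
      by (rule finite_subset[rotated]) (auto simp: in_keys_iff)
  qed
  have T: "Vector_Spaces.linear pm_scale pm_scale T"
    unfolding Vector_Spaces.linear_iff
    by (intro conjI allI vector_space_pm_scale poly_mapping_eqI) (auto simp: LT lookup_add)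
  \<comment> \<open>A section of \<open>T\<close> over \<open>vecs J\<close>; the embedding of the
    sequence space is composed with it.\<close>
  define S :: "('j \<Rightarrow> 'k) \<Rightarrow> (nat \<Rightarrow>\<^sub>0 'k)" where
    "S w = Abs_poly_mapping (\<lambda>n. if n \<in> ?n ` J then w (from_nat_into J n) else 0)" for w
  have LS: "Poly_Mapping.lookup (S w) = (\<lambda>n. if n \<in> ?n ` J then w (from_nat_into J n) else 0)" if "w \<in> vecs J" for w
    unfolding S_def
  proof (rule lookup_Abs_poly_mapping)
    have "{n. (if n \<in> ?n ` J then w (from_nat_into J n) else 0) \<noteq> 0} \<subseteq> ?n ` {j. w j \<noteq> 0}"
      using assms(6) by auto
    then show "finite {n. (if n \<in> ?n ` J then w (from_nat_into J n) else 0) \<noteq> 0}"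
      by (rule finite_subset) (use that in \<open>simp add: vecs_def\<close>)
  qed
  have TS: "Poly_Mapping.lookup (T (S w)) = w" if "w \<in> vecs J" for w
    unfolding LT LS[OF that] using that assms(6) by (intro ext) (auto simp: vecs_def)
  let ?G = "\<lambda>x y z. polarization g (T x) (T y) (T z)"
  have G: "cubic_form pm_scale ?G"
    by (rule cubic_form_pullback[OF W.cubic_form_axioms vector_space_pm_scale T])
  have "\<exists>y'. V.indep_mod_small y' r" if "cubic_form.indep_mod_small pm_scale ?G y r" for y r
  proof -
    have "W.indep_mod_small (\<lambda>i. T (y i)) r"
      by (rule indep_mod_small_pullback[OF W.cubic_form_axioms G T refl that])
    then have "enat r \<le> rrk J g" by (intro iffD2[OF le_rrk_iff[OF assms(1-3,7)]] exI)
    then have "enat r \<le> rrk I f" using assms(8) by (rule order_trans)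
    then show ?thesis by (rule iffD1[OF le_rrk_iff[OF assms(1-4)]])
  qed
  then obtain \<Phi> :: "(nat \<Rightarrow>\<^sub>0 'k) \<Rightarrow> ('i \<Rightarrow>\<^sub>0 'k)" where \<Phi>: "Vector_Spaces.linear pm_scale pm_scale \<Phi>"
    "\<And>w. polarization f (\<Phi> w) (\<Phi> w) (\<Phi> w) = ?G w w w"
    using embed_sequence_space[OF V.cubic_form_axioms nondegenerate_imp_nondeg[OF assms(1-5)] G] by blast
  interpret \<Phi>: Vector_Spaces.linear pm_scale pm_scale \<Phi> by fact
  define \<phi> where "\<phi> w = (\<lambda>i. if i \<in> I then Poly_Mapping.lookup (\<Phi> (S w)) i else 0)" for w
  have "\<phi> w \<in> vecs I" for w
  proof -
    have "{i. \<phi> w i \<noteq> 0} \<subseteq> Poly_Mapping.keys (\<Phi> (S w))" by (auto simp: \<phi>_def in_keys_iff)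
    then have "finite {i. \<phi> w i \<noteq> 0}" by (rule finite_subset) simp
    then show ?thesis by (auto simp: vecs_def \<phi>_def)
  qed
  moreover have "\<phi> (\<lambda>x. a * v x + b * w x) = (\<lambda>y. a * \<phi> v y + b * \<phi> w y)"
    if "v \<in> vecs J" "w \<in> vecs J" for a b v w
  proof -
    have "{x. a * v x + b * w x \<noteq> 0} \<subseteq> {x. v x \<noteq> 0} \<union> {x. w x \<noteq> 0}" by auto
    then have "(\<lambda>x. a * v x + b * w x) \<in> vecs J"
      using that unfolding vecs_def by (auto intro: finite_subset)
    then have "S (\<lambda>x. a * v x + b * w x) = pm_scale a (S v) + pm_scale b (S w)"
      using that by (intro poly_mapping_eqI) (simp add: LS lookup_add)
    then show ?thesis by (auto simp: \<phi>_def \<Phi>.add \<Phi>.scale lookup_add)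
  qed
  moreover have "peval f (\<phi> w) = peval g w" if "w \<in> vecs J" for w
  proof -
    have "peval f (\<phi> w) = polarization f (\<Phi> (S w)) (\<Phi> (S w)) (\<Phi> (S w))"
      unfolding \<phi>_def peval_restrict[OF assms(4)] by (rule peval_polarization[OF assms(2-4)])
    also have "\<dots> = peval g (Poly_Mapping.lookup (T (S w)))"
      by (simp only: \<Phi>(2) peval_polarization[OF assms(2,3,7)])
    finally show ?thesis by (simp only: TS[OF that])
  qed
  ultimately show ?thesis unfolding cubic_embeds_def by blast
qed

theorem theorem1p1:
  fixes I :: "'i set" and J :: "'j set"
    and f :: "'i multiset \<Rightarrow> 'k::field" and g :: "'j multiset \<Rightarrow> 'k"
  assumes "alg_closed TYPE('k)"
    and "(2::'k) \<noteq> 0" and "(3::'k) \<noteq> 0"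
    and "f \<in> hpoly I 3" and "nondegenerate I f"
    and "countable J" and "g \<in> hpoly J 3"
  shows "cubic_embeds J g I f \<longleftrightarrow> rrk J g \<le> rrk I f"
  using cubic_embeds_imp_rrk_le[OF assms(1-4,7)] rrk_le_imp_cubic_embeds[OF assms] by blast

end
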